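(* Let $u\in\mathfrak{S}_k(M)$ and $H(r)=\int_{\partial B_r}u^2$. There exist $r_M>0$ and $C_M>0$ (depending on $M$) such that $$r\mapsto \Phi_k(r,u)=(r+C_Mr^2)\,\frac{d}{dr}\log\max\{H(r),\,r^{n-1+2k}\}$$ is nondecreasing for $0<r<r_M$.
   Context: Notation: $n\ge 2$, $k\in\mathbb{N}=\{1,2,\dots\}$, $M>0$, $x=(x',x_n)\in\mathbb{R}^{n-1}\times\mathbb{R}$; $B_r$ is the open ball of radius $r$ about $0$ in $\mathbb{R}^n$; $B_1^+=B_1\cap\{x_n>0\}$; $B_1'=B_1\cap(\mathbb{R}^{n-1}\times\{0\})$. On $\{x_n=0\}$, $\partial_{x_n}u$ denotes the limit from inside $\{x_n>0\}$. Class $\mathfrak{S}_k(M)$: functions $u\in C^{1,\alpha}(B_1^+\cup B_1')$, for some $\alpha\in(0,1)$, such that $|\Delta u|\le M|x'|^{k-1}$ in $B_1^+$ (weak sense); $u\ge0$, $-\partial_{x_n}u\ge0$, $u\,\partial_{x_n}u=0$ on $B_1'$; $0\in\Gamma(u)$, where $\Gamma(u)$ is the boundary of $\{u(\cdot,0)=0\}\subset B_1'$ in the relative topology of $B_1'$; and $\|u\|_{C^1}\le M$. Every such $u$ is extended to $B_1$ by $u(x',-x_n)=u(x',x_n)$. The function $r\mapsto\max\{H(r),r^{n-1+2k}\}$ is locally absolutely continuous on $(0,1)$, so $\Phi_k(\cdot,u)$ is defined almost everywhere; its monotonicity is understood in the sense that it coincides almost everywhere with a nondecreasing function. *)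

theory Defs
  imports "HOL-Analysis.Analysis"
begin

text \<open>
  The space R^n with n \<ge> 2 is the Euclidean space \<open>(real ^ 'm) \<times> real\<close>, so that n = CARD('m) + 1 and
  a point x = (x', x_n) has x' = \<open>fst x\<close> and x_n = \<open>snd x\<close>. The product norm is the Euclidean norm.
\<close>

definition upper_half_ball :: "((real ^ 'm) \<times> real) set" where
  "upper_half_ball = {x \<in> ball 0 1. 0 < snd x}"

definition thin_ball :: "((real ^ 'm) \<times> real) set" where
  "thin_ball = {x \<in> ball 0 1. snd x = 0}"

definition grad :: "('a::real_inner \<Rightarrow> real) \<Rightarrow> 'a \<Rightarrow> 'a" where
  "grad u x = (THE g. GDERIV u x :> g)"

text \<open>
  Hoelder continuity of the gradient is required on compact subsets of \<open>S\<close>, the usual meaning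
  of C^{1,alpha} on a set containing only a part of the boundary. On the (convex) half ball together
  with the thin ball, differentiability within \<open>S\<close> with a continuous gradient says that the interior
  gradient extends continuously to the thin ball.
\<close>

definition C1_holder_on :: "real \<Rightarrow> ('a::euclidean_space \<Rightarrow> real) \<Rightarrow> 'a set \<Rightarrow> bool" where
  "C1_holder_on \<alpha> u S \<longleftrightarrow>
     (\<exists>G. (\<forall>x\<in>S. (u has_derivative (\<lambda>h. G x \<bullet> h)) (at x within S)) \<and>
          (\<forall>K. compact K \<and> K \<subseteq> S \<longrightarrow>
             (\<exists>C. \<forall>x\<in>K. \<forall>y\<in>K. norm (G x - G y) \<le> C * dist x y powr \<alpha>)))"

text \<open>The norm has values in \<open>[0, \<infinity>]\<close>; the supremum of an unbounded function is \<open>\<infinity>\<close>.\<close>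

definition C1_norm :: "((real ^ 'm) \<times> real \<Rightarrow> real) \<Rightarrow> ennreal" where
  "C1_norm u = (SUP x\<in>upper_half_ball \<union> thin_ball. ennreal \<bar>u x\<bar>) +
               (SUP x\<in>upper_half_ball. ennreal (norm (grad u x)))"

definition C1_test_function :: "('a::euclidean_space \<Rightarrow> real) \<Rightarrow> 'a set \<Rightarrow> bool" where
  "C1_test_function \<phi> S \<longleftrightarrow>
     (\<forall>x. \<phi> differentiable (at x)) \<and> continuous_on UNIV (grad \<phi>) \<and>
     compact (closure {x. \<phi> x \<noteq> 0}) \<and> closure {x. \<phi> x \<noteq> 0} \<subseteq> S"

text \<open>\<open>\<Delta>u = f\<close> weakly in \<open>S\<close>, for a continuously differentiable function \<open>u\<close> on \<open>S\<close>.\<close>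

definition weak_laplacian_on ::
    "('a::euclidean_space \<Rightarrow> real) \<Rightarrow> ('a \<Rightarrow> real) \<Rightarrow> 'a set \<Rightarrow> bool" where
  "weak_laplacian_on u f S \<longleftrightarrow>
     (\<forall>\<phi>. C1_test_function \<phi> S \<longrightarrow>
        (LINT x:S|lborel. grad u x \<bullet> grad \<phi> x) = - (LINT x:S|lborel. f x * \<phi> x))"

definition normal_deriv :: "((real ^ 'm) \<times> real \<Rightarrow> real) \<Rightarrow> (real ^ 'm) \<times> real \<Rightarrow> real" where
  "normal_deriv u x = Lim (at x within {y. 0 < snd y}) (\<lambda>y. grad u y \<bullet> (0, 1))"

definition free_boundary :: "((real ^ 'm) \<times> real \<Rightarrow> real) \<Rightarrow> ((real ^ 'm) \<times> real) set" where
  "free_boundary u = (top_of_set thin_ball) frontier_of {x \<in> thin_ball. u x = 0}"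

text \<open>
  Only the values of \<open>u\<close> on the half ball and the thin ball matter here; the even extension to the
  full ball is \<open>even_extension u\<close>.
\<close>

definition signorini_class :: "nat \<Rightarrow> real \<Rightarrow> ((real ^ 'm) \<times> real \<Rightarrow> real) set" where
  "signorini_class k M = {u.
     (\<exists>\<alpha>. 0 < \<alpha> \<and> \<alpha> < 1 \<and> C1_holder_on \<alpha> u (upper_half_ball \<union> thin_ball)) \<and>
     (\<exists>f \<in> borel_measurable borel.
        weak_laplacian_on u f upper_half_ball \<and>
        (AE x\<in>upper_half_ball in lborel. \<bar>f x\<bar> \<le> M * norm (fst x) ^ (k - 1))) \<and>
     (\<forall>x\<in>thin_ball. 0 \<le> u x \<and> 0 \<le> - normal_deriv u x \<and> u x * normal_deriv u x = 0) \<and>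
     0 \<in> free_boundary u \<and>
     C1_norm u \<le> ennreal M}"

definition even_extension :: "((real ^ 'm) \<times> real \<Rightarrow> real) \<Rightarrow> (real ^ 'm) \<times> real \<Rightarrow> real" where
  "even_extension u x = u (fst x, \<bar>snd x\<bar>)"

text \<open>
  Surface measure on the sphere of radius \<open>r > 0\<close>: the area of \<open>E\<close> is n/r times the volume of the
  cone \<open>{t *\<^sub>R x | t x. 0 < t \<and> t < 1 \<and> x \<in> E}\<close>, which is the preimage of \<open>E\<close> in the ball
  under radial projection.
\<close>

definition sphere_surface_measure :: "real \<Rightarrow> 'a::euclidean_space measure" where
  "sphere_surface_measure r =
     scale_measure (ennreal (real DIM('a) / r))
       (distr (restrict_space lborel (ball 0 r - {0})) borel (\<lambda>x. (r / norm x) *\<^sub>R x))"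

definition height :: "('a::euclidean_space \<Rightarrow> real) \<Rightarrow> real \<Rightarrow> real" where
  "height u r = (LINT x:sphere 0 r|sphere_surface_measure r. (u x)\<^sup>2)"

text \<open>The exponent \<open>CARD('m) + 2 * k\<close> is n - 1 + 2k.\<close>

definition log_trunc_height :: "nat \<Rightarrow> ((real ^ 'm) \<times> real \<Rightarrow> real) \<Rightarrow> real \<Rightarrow> real" where
  "log_trunc_height k u r = ln (max (height u r) (r ^ (CARD('m) + 2 * k)))"

definition Phi :: "real \<Rightarrow> nat \<Rightarrow> ((real ^ 'm) \<times> real \<Rightarrow> real) \<Rightarrow> real \<Rightarrow> real" where
  "Phi C k u r = (r + C * r\<^sup>2) * deriv (log_trunc_height k u) r"

end

theory Submission
  imports Defs
begin

text \<open>
  For \<open>H(r) = \<integral>\<^bsub>\<partial>B_r\<^esub> u\<^sup>2\<close> one has \<open>H' = (n - 1) H / r + 2 I\<close> with \<open>I\<close> the integral of \<open>u u_\<nu>\<close> over the sphere. The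
  Signorini conditions make the flat part of the boundary disappear from the energy identity
  \<open>I = \<integral> |\<nabla>u|\<^sup>2 + \<integral> u f\<close> and from the Rellich identity for the derivative of \<open>D(r) = \<integral>\<^bsub>B_r\<^esub> |\<nabla>u|\<^sup>2\<close>. Hence, if
  \<open>f = 0\<close>, Cauchy--Schwarz on the sphere shows that \<open>r I / H\<close> is nondecreasing. For bounded \<open>f\<close> the error
  terms have to be small against \<open>D\<close>. Since \<open>u(0) = 0\<close>, \<open>u \<ge> 0\<close> on the flat part, and \<open>u\<close> is superharmonic up to the
  right-hand side, a Poincare inequality gives \<open>H \<le> C (r D + r\<^bsup>n + 2k + 1\<^esup>)\<close>; where \<open>H > r\<^bsup>n - 1 + 2k\<^esup>\<close> the last
  term is absorbed for small \<open>r\<close>, every error is at most \<open>C r D\<close>, and the factor \<open>1 + C r\<close> compensates for it.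
  At the ends of a component of \<open>{H > r\<^bsup>n - 1 + 2k\<^esup>}\<close> the two branches of the maximum have derivatives ordered
  in the right direction.

  Only the half balls are used. Spherical integrals are written as integrals over cones, and since \<open>u\<close> is
  only \<open>C\<^sup>1\<close>, all identities come from testing the weak equation with cutoffs.
\<close>

section \<open>Truncated logarithmic derivatives\<close>

text \<open>As \<open>f\<close> is only bounded and measurable, the integral \<open>E\<close> of
  \<open>u f\<close> over a half ball, and with it \<open>I\<close>, need not be differentiable at
  every radius. So the frequency is never differentiated. Where the truncation is inactive,
  \<open>I(s)\<close> for \<open>s > r\<close> is bounded below by
  \<open>D(s) - M s^(k-1) (Q(s) - Q(r)) + E(r)\<close>, with \<open>Q\<close> the integral of
  \<open>|u|\<close>. This equals \<open>I\<close> at \<open>r\<close> and is differentiable there;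
  the frequency built from it has positive derivative at \<open>r\<close>. Hence the true frequency
  increases locally to the right, and continuity makes this monotonicity. In the Rellich identity,
  comparing \<open>u\<close> with a dilation mixes values at \<open>x\<close> and \<open>l x\<close>
  on the flat part. Complementarity at both points leaves two cross terms: one has the right sign,
  the other is \<open>o(1 - l)\<close>, because the tangential gradient vanishes where
  \<open>u = 0\<close> on the flat part. The bound on \<open>f\<close> and the truncation exponent
  are matched: \<open>(r^(k-1))^2 r^n = r^(n-2+2k)\<close>, which is at most a multiple of
  \<open>D(r)\<close> where the truncation is inactive. Cauchy-Schwarz thus turns every error into a
  multiple of \<open>D\<close>.\<close>

lemma le_if_locally_right_increasing:
  fixes g :: "real \<Rightarrow> real"
  assumes "a \<le> b" and cont: "continuous_on {a..b} g"
    and loc: "\<And>r. a \<le> r \<Longrightarrow> r < b \<Longrightarrow> \<exists>d>0. \<forall>s\<in>{r<..<r+d}. s < b \<longrightarrow> g r \<le> g s"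
  shows "g a \<le> g b"
proof -
  \<comment> \<open>By continuity this set is closed, so it has a largest element. If that element
    were below \<open>b\<close>, local increase to its right would produce a larger one.\<close>
  define A where "A = {t\<in>{a..b}. g a \<le> g t}"
  have "compact A"
  proof -
    have "closed A" unfolding A_def
      using continuous_closed_preimage[OF cont, of "{g a..}"]
      by (simp add: vimage_def Int_def)
    moreover have "A \<subseteq> {a..b}" by (auto simp: A_def)
    ultimately show ?thesis by (metis compact_Icc compact_Int_closed inf.absorb_iff2)
  qed
  moreover have "a \<in> A" using \<open>a \<le> b\<close> by (auto simp: A_def)
  ultimately obtain c where c: "c \<in> A" "\<And>t. t \<in> A \<Longrightarrow> t \<le> c"
    using compact_attains_sup[of A] by blast
  show ?thesis
  proof (cases "c = b")
    case True then show ?thesis using c by (auto simp: A_def)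
  next
    case False
    then have cb: "a \<le> c" "c < b" using c by (auto simp: A_def)
    then obtain d where d: "d > 0" "\<forall>s\<in>{c<..<c+d}. s < b \<longrightarrow> g c \<le> g s" using loc by blast
    define s where "s = c + min d (b - c) / 2"
    have s: "c < s" "s < c + d" "s < b" using d cb by (auto simp: s_def min_def field_simps)
    then have "g a \<le> g s" using d c by (force simp: A_def)
    then have "s \<in> A" using s cb by (auto simp: A_def)
    then show ?thesis using c s by force
  qed
qed

text \<open>Each isolated point is the only point of \<open>Z\<close> in some member of a countable
  basis, and that member determines the point. It is applied to the set where the two branches of
  the maximum meet.\<close>

lemma countable_isolated_points:
  fixes Z :: "'a::second_countable_topology set"
  shows "countable {x \<in> Z. \<not> x islimpt Z}"
proof -
  obtain B :: "'a set set" where B: "countable B" "topological_basis B"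
    using ex_countable_basis by blast
  have "\<exists>U\<in>B. U \<inter> Z = {x}" if x: "x \<in> Z" "\<not> x islimpt Z" for x
  proof -
    obtain T where T: "x \<in> T" "open T" "\<forall>y\<in>Z. y \<in> T \<longrightarrow> y = x"
      using x unfolding islimpt_def by metis
    then obtain U where "U \<in> B" "x \<in> U" "U \<subseteq> T"
      using B(2) topological_basisE by metis
    then show ?thesis using T x by blast
  qed
  then obtain f where f: "\<And>x. x \<in> Z \<Longrightarrow> \<not> x islimpt Z \<Longrightarrow> f x \<in> B \<and> f x \<inter> Z = {x}" by metis
  have "inj_on f {x \<in> Z. \<not> x islimpt Z}" by (rule inj_onI) (metis (mono_tags) f mem_Collect_eq singleton_inject)
  moreover have "f ` {x \<in> Z. \<not> x islimpt Z} \<subseteq> B" using f by blast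
  ultimately show ?thesis using B(1) countable_image_inj_on countable_subset by metis
qed

lemma eventually_less_isCont:
  fixes f g :: "'a::t2_space \<Rightarrow> real"
  assumes "isCont f r" "isCont g r" "f r < g r"
  shows "eventually (\<lambda>s. f s < g s) (at r)"
proof -
  have "((\<lambda>s. g s - f s) \<longlongrightarrow> g r - f r) (at r)"
    using assms(1,2) by (auto simp: isCont_def intro: tendsto_diff)
  then have "eventually (\<lambda>s. 0 < g s - f s) (at r)"
    by (rule order_tendstoD) (use assms(3) in simp)
  then show ?thesis by simp
qed

text \<open>The form \<open>m * r ^ m / r\<close> avoids the natural-number exponent
  \<open>m - 1\<close> and covers \<open>m = 0\<close>. Divided by \<open>r ^ m\<close> it becomes
  the logarithmic derivative \<open>m / r\<close>.\<close>

lemma power_has_derivative_div: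
  fixes r :: real
  assumes "r \<noteq> 0"
  shows "((\<lambda>r. r ^ m) has_real_derivative m * r ^ m / r) (at r)"
  using DERIV_pow[of m r] assms by (cases m) auto

text \<open>A strict inequality between the branches persists near \<open>r\<close>, so there the
  maximum is a single branch. At a contact point with equal derivatives the branches share their
  tangent, and the remainder of the maximum is the maximum of two remainders that are both
  \<open>o(y - r)\<close>.\<close>

lemma ln_max_power_has_derivative:
  fixes H :: "real \<Rightarrow> real"
  assumes r: "0 < r" and der: "(H has_real_derivative D) (at r)"
    and cont: "isCont H r"
  shows "H r > r ^ m \<Longrightarrow> ((\<lambda>r. ln (max (H r) (r ^ m))) has_real_derivative D / H r) (at r)"
    and "H r < r ^ m \<or> (H r = r ^ m \<and> D = m * r ^ m / r) \<Longrightarrow>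
      ((\<lambda>r. ln (max (H r) (r ^ m))) has_real_derivative m / r) (at r)"
proof -
  have pc: "isCont (\<lambda>r. r ^ m) r" by (intro continuous_intros)
  have pd: "((\<lambda>r. r ^ m) has_real_derivative m * r ^ m / r) (at r)"
    using r by (intro power_has_derivative_div) auto
  have pp: "r ^ m > 0" using r by simp
  { assume *: "H r > r ^ m"
    have ev: "eventually (\<lambda>s. ln (max (H s) (s ^ m)) = ln (H s)) (nhds r)"
    proof -
      have "eventually (\<lambda>s. H s > s ^ m) (at r)"
        using eventually_less_isCont[OF pc cont *] .
      then show ?thesis using * by (auto simp: eventually_nhds_conv_at max_def elim: eventually_mono)
    qed
    have "((\<lambda>r. ln (H r)) has_real_derivative D / H r) (at r)"
      using * pp der by (auto intro!: derivative_eq_intros)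
    then show "((\<lambda>r. ln (max (H r) (r ^ m))) has_real_derivative D / H r) (at r)"
      using DERIV_cong_ev[OF refl ev refl] by blast }
  { assume "H r < r ^ m \<or> (H r = r ^ m \<and> D = m * r ^ m / r)"
    then have md: "((\<lambda>r. max (H r) (r ^ m)) has_real_derivative m * r ^ m / r) (at r) \<and> max (H r) (r ^ m) = r ^ m"
    proof
      assume *: "H r < r ^ m"
      have ev: "eventually (\<lambda>s. max (H s) (s ^ m) = s ^ m) (nhds r)"
      proof -
        have "eventually (\<lambda>s. H s < s ^ m) (at r)"
          using eventually_less_isCont[OF cont pc *] .
        then show ?thesis using * by (auto simp: eventually_nhds_conv_at max_def elim: eventually_mono)
      qed
      show ?thesis using DERIV_cong_ev[OF refl ev refl] pd * by (auto simp: max_def)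
    next
      assume *: "H r = r ^ m \<and> D = m * r ^ m / r"
      let ?d = "m * r ^ m / r"
      have "((\<lambda>y. max (H y - H r - (y - r) * ?d) (y ^ m - r ^ m - (y - r) * ?d) / norm (y - r)) \<longlongrightarrow> 0) (at r)"
      proof -
        have 1: "((\<lambda>y. (H y - H r - (y - r) * ?d) / norm (y - r)) \<longlongrightarrow> 0) (at r)"
          using der * unfolding has_field_derivative_def has_derivative_iff_norm
          by (subst tendsto_rabs_zero_iff[symmetric]) (simp add: mult.commute)
        have 2: "((\<lambda>y. (y ^ m - r ^ m - (y - r) * ?d) / norm (y - r)) \<longlongrightarrow> 0) (at r)"
          using pd unfolding has_field_derivative_def has_derivative_iff_norm
          by (subst tendsto_rabs_zero_iff[symmetric]) (simp add: mult.commute)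
        have "((\<lambda>y. max ((H y - H r - (y - r) * ?d) / norm (y - r)) ((y ^ m - r ^ m - (y - r) * ?d) / norm (y - r))) \<longlongrightarrow> max 0 0) (at r)"
          by (intro tendsto_max 1 2)
        moreover have "max (a / norm (y - r)) (b / norm (y - r)) = max a b / norm (y - r)" for a b y :: real
          by (auto simp: max_def divide_right_mono divide_le_cancel)
        ultimately show ?thesis by simp
      qed
      moreover have "max (H y - H r - (y - r) * ?d) (y ^ m - r ^ m - (y - r) * ?d)
         = max (H y) (y ^ m) - max (H r) (r ^ m) - (y - r) * ?d" for y
        using * by (auto simp: max_def)
      ultimately have "((\<lambda>y. (max (H y) (y ^ m) - max (H r) (r ^ m) - (y - r) * ?d) / norm (y - r)) \<longlongrightarrow> 0) (at r)"
        by simp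
      then have "((\<lambda>r. max (H r) (r ^ m)) has_real_derivative ?d) (at r)"
        unfolding has_field_derivative_def has_derivative_iff_norm
        by (subst (asm) tendsto_rabs_zero_iff[symmetric]) (simp add: mult.commute bounded_linear_mult_right)
      then show ?thesis using * by auto
    qed
    have "((\<lambda>r. ln (max (H r) (r ^ m))) has_real_derivative m * r ^ m / r / r ^ m) (at r)"
      using md pp by (auto intro!: derivative_eq_intros)
    then show "((\<lambda>r. ln (max (H r) (r ^ m))) has_real_derivative m / r) (at r)"
      using r by simp }
qed

text \<open>At an accumulation point of the contact set, \<open>H s - s ^ m\<close> vanishes along
  the contact set, so its derivative is zero and the branches have equal derivatives. The other
  contact points are isolated, hence countably many and negligible.\<close>

lemma AE_ln_max_power_has_derivative:
  fixes H H' :: "real \<Rightarrow> real" and R :: real and m :: nat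
  assumes der: "\<And>r. 0 < r \<Longrightarrow> r < R \<Longrightarrow> (H has_real_derivative H' r) (at r)"
  shows "AE r\<in>{0<..<R} in lborel. ((\<lambda>r. ln (max (H r) (r ^ m))) has_real_derivative
           (if H r > r ^ m then H' r / H r else m / r)) (at r)"
proof -
  define Z where "Z = {r::real. 0 < r \<and> r < R \<and> H r = r ^ m}"
  have *: "H' r = m * r ^ m / r" if "r \<in> Z" "r islimpt Z" for r :: real
  proof -
    have r: "0 < r" "r < R" "H r = r ^ m" using that by (auto simp: Z_def)
    let ?q = "\<lambda>s. H s - s ^ m"
    have "(?q has_real_derivative H' r - m * r ^ m / r) (at r)"
      using r der[of r] by (intro DERIV_diff power_has_derivative_div) auto
    then have "(?q has_real_derivative H' r - m * r ^ m / r) (at r within Z)"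
      by (rule DERIV_subset) auto
    then have 1: "((\<lambda>s. (?q s - ?q r) / (s - r)) \<longlongrightarrow> H' r - m * r ^ m / r) (at r within Z)"
      by (simp only: has_field_derivative_iff)
    have "(?q has_real_derivative 0) (at r within Z)"
      by (rule has_field_derivative_transform_within[of "\<lambda>_. 0" 0 r Z 1])
         (use that in \<open>auto simp: Z_def\<close>)
    then have 2: "((\<lambda>s. (?q s - ?q r) / (s - r)) \<longlongrightarrow> 0) (at r within Z)"
      by (simp only: has_field_derivative_iff)
    have "at r within Z \<noteq> bot" using that(2) trivial_limit_within by blast
    then have "H' r - m * r ^ m / r = 0" using 1 2 by (rule tendsto_unique)
    then show ?thesis by simp
  qed
  have "AE r in lborel. r \<notin> {x \<in> Z. \<not> x islimpt Z}"
    using countable_isolated_points[of Z] countable_imp_null_set_lborel AE_not_in by blast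
  then show ?thesis
  proof (eventually_elim, intro impI)
    fix r assume r: "r \<notin> {x \<in> Z. \<not> x islimpt Z}" "r \<in> {0<..<R}"
    then have d: "(H has_real_derivative H' r) (at r)" using der by auto
    have c: "isCont H r" using d DERIV_isCont by blast
    have "H r < r ^ m \<or> (H r = r ^ m \<and> H' r = m * r ^ m / r)" if "\<not> r ^ m < H r"
      using r * that by (force simp: Z_def not_less le_less)
    then show "((\<lambda>r. ln (max (H r) (r ^ m))) has_real_derivative
           (if H r > r ^ m then H' r / H r else m / r)) (at r)"
      using ln_max_power_has_derivative[OF _ d c, of m] r by auto
  qed
qed

text \<open>The difference \<open>H s - s ^ m\<close> is zero at \<open>c\<close> and nonnegative on
  one side of \<open>c\<close>, which fixes the sign of its derivative there. This orders the two
  values that meet at an end of a component where the truncation is inactive.\<close>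

lemma power_touch_derivative:
  fixes H :: "real \<Rightarrow> real"
  assumes c: "0 < c" and e: "H c = c ^ m" and der: "(H has_real_derivative D) (at c)"
  shows "(\<And>s. a < s \<Longrightarrow> s < c \<Longrightarrow> s ^ m \<le> H s) \<Longrightarrow> a < c \<Longrightarrow> c * D / H c \<le> m"
    and "(\<And>s. c < s \<Longrightarrow> s < b \<Longrightarrow> s ^ m \<le> H s) \<Longrightarrow> c < b \<Longrightarrow> m \<le> c * D / H c"
proof -
  let ?q = "\<lambda>s. H s - s ^ m"
  have q: "(?q has_real_derivative D - m * c ^ m / c) (at c)"
    using c der by (intro DERIV_diff power_has_derivative_div) auto
  have pp: "c ^ m > 0" using c by simp
  { assume *: "\<And>s. a < s \<Longrightarrow> s < c \<Longrightarrow> s ^ m \<le> H s" "a < c"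
    have "D - m * c ^ m / c \<le> 0"
    proof (rule ccontr)
      assume "\<not> ?thesis"
      then obtain d where "d > 0" "\<forall>h>0. h < d \<longrightarrow> ?q (c - h) < ?q c"
        using DERIV_pos_inc_left[OF q] by auto
      moreover obtain h where "0 < h" "h < d" "h < c - a"
        using field_lbound_gt_zero[of d "c - a"] \<open>d > 0\<close> *(2) by auto
      ultimately have "?q (c - h) < ?q c" "a < c - h" "c - h < c" by auto
      then show False using *(1)[of "c - h"] e by auto
    qed
    then show "c * D / H c \<le> m" using c e pp by (simp add: field_simps) }
  { assume *: "\<And>s. c < s \<Longrightarrow> s < b \<Longrightarrow> s ^ m \<le> H s" "c < b"
    have "0 \<le> D - m * c ^ m / c"
    proof (rule ccontr)
      assume "\<not> ?thesis"
      then obtain d where "d > 0" "\<forall>h>0. h < d \<longrightarrow> ?q (c + h) < ?q c"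
        using DERIV_neg_dec_right[OF q] by auto
      moreover obtain h where "0 < h" "h < d" "h < b - c"
        using field_lbound_gt_zero[of d "b - c"] \<open>d > 0\<close> *(2) by auto
      ultimately have "?q (c + h) < ?q c" "c < c + h" "c + h < b" by auto
      then show False using *(1)[of "c + h"] e by auto
    qed
    then show "m \<le> c * D / H c" using c e pp by (simp add: field_simps) }
qed

text \<open>On \<open>Z\<close>, where the power is the maximum, the function is
  \<open>(1 + C * r) * m\<close>, which is nondecreasing. For \<open>a \<le> b\<close> let
  \<open>c\<close> and \<open>d\<close> be the first and last point of \<open>Z\<close> in
  \<open>{a..b}\<close>. Before \<open>c\<close> and after \<open>d\<close> the local hypothesis
  applies, the jumps at \<open>c\<close> and \<open>d\<close> go upwards by the touching lemma, and
  only \<open>(1 + C * c) * m \<le> (1 + C * d) * m\<close> is needed for what lies between.\<close>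

lemma truncated_frequency_mono:
  fixes H H' :: "real \<Rightarrow> real" and C R :: real and m :: nat
  assumes der: "\<And>r. 0 < r \<Longrightarrow> r < R \<Longrightarrow> (H has_real_derivative H' r) (at r)"
    and cont: "continuous_on {0<..<R} H'" and C: "0 \<le> C"
    and loc: "\<And>r. 0 < r \<Longrightarrow> r < R \<Longrightarrow> r ^ m < H r \<Longrightarrow>
      \<exists>d>0. \<forall>s\<in>{r<..<r+d}. s < R \<longrightarrow> (r + C * r\<^sup>2) * (H' r / H r) \<le> (s + C * s\<^sup>2) * (H' s / H s)"
  shows "mono_on {0<..<R} (\<lambda>r. (r + C * r\<^sup>2) * (if r ^ m < H r then H' r / H r else m / r))"
proof -
  let ?f = "\<lambda>r. (r + C * r\<^sup>2) * (H' r / H r)"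
  let ?g = "\<lambda>r. (r + C * r\<^sup>2) * (if r ^ m < H r then H' r / H r else m / r)"
  define Z where "Z = {r::real. H r \<le> r ^ m}"
  have contH: "continuous_on {0<..<R} H"
    by (intro continuous_at_imp_continuous_on) (metis DERIV_isCont der greaterThanLessThan_iff)
  have gZ: "?g r = (1 + C * r) * m" if "r \<in> Z" "0 < r" for r
    using that by (auto simp: Z_def power2_eq_square field_simps)
  have seg: "?f a \<le> ?f b" if ab: "0 < a" "a \<le> b" "b < R" and pos: "\<And>t. a \<le> t \<Longrightarrow> t \<le> b \<Longrightarrow> 0 < H t"
    and Zn: "\<And>t. a < t \<Longrightarrow> t < b \<Longrightarrow> t \<notin> Z" for a b
  proof -
    have cf: "continuous_on {a..b} ?f"
      using ab pos by (intro continuous_intros continuous_on_subset[OF contH] continuous_on_subset[OF cont]) force+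
    have inner: "?f s \<le> ?f t" if "a < s" "s \<le> t" "t < b" for s t
    proof (rule le_if_locally_right_increasing[OF that(2)])
      show "continuous_on {s..t} ?f" using cf by (rule continuous_on_subset) (use that in auto)
      fix r assume r: "s \<le> r" "r < t"
      have r': "0 < r" "r < R" "a < r" "r < b" "t < R" using r ab that by auto
      have "r ^ m < H r" using Zn[OF r'(3,4)] by (auto simp: Z_def)
      then obtain d where d: "d>0" "\<And>s. s\<in>{r<..<r+d} \<Longrightarrow> s < R \<Longrightarrow> ?f r \<le> ?f s"
        using loc[OF r'(1,2)] by blast
      have "?f r \<le> ?f s'" if "s' \<in> {r<..<r+d}" "s' < t" for s'
        by (rule d(2)) (use that r' in auto)
      then show "\<exists>d>0. \<forall>s\<in>{r<..<r+d}. s < t \<longrightarrow> ?f r \<le> ?f s"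
        using d(1) by blast
    qed
    show ?thesis
    proof (cases "a = b")
      case False
      with ab have "a < b" by simp
      \<comment> \<open>Local increase is known only at interior points, since an endpoint may lie
        in \<open>Z\<close>. The factor 1/3 keeps \<open>a + e n\<close> to the left of
        \<open>b - e n\<close>, and continuity carries the inequality to the endpoints.\<close>
      define e where "e = (\<lambda>n. (b - a) / 3 * inverse (real (Suc n)))"
      have e0: "e \<longlonglongrightarrow> 0" unfolding e_def
        by (rule tendsto_mult_right_zero[OF LIMSEQ_inverse_real_of_nat])
      have e1: "0 < e n" "3 * e n \<le> b - a" for n using \<open>a < b\<close> by (auto simp: e_def field_simps mult_right_mono)
      have 1: "(\<lambda>n. ?f (a + e n)) \<longlonglongrightarrow> ?f a"
        by (rule continuous_on_tendsto_compose[OF cf])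
           (use e0 e1 \<open>a < b\<close> tendsto_add[OF tendsto_const e0, of a] in \<open>auto intro!: always_eventually simp: less_imp_le\<close>, smt (verit) e1)
      have 2: "(\<lambda>n. ?f (b - e n)) \<longlonglongrightarrow> ?f b"
        by (rule continuous_on_tendsto_compose[OF cf])
           (use e0 e1 \<open>a < b\<close> tendsto_diff[OF tendsto_const e0, of b] in \<open>auto intro!: always_eventually simp: less_imp_le\<close>, smt (verit) e1)
      have "?f (a + e n) \<le> ?f (b - e n)" for n using e1[of n] by (intro inner) auto
      then show ?thesis using LIMSEQ_le[OF 1 2] by blast
    qed simp
  qed
  have Hpos: "0 < H t" if "t \<notin> Z" "0 < t" for t
    using that by (auto simp: Z_def not_le) (meson less_trans zero_less_power)
  have clZ: "compact (Z \<inter> {a..b})" if "0 < a" "b < R" for a b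
  proof -
    have "continuous_on {a..b} (\<lambda>r. H r - r ^ m)"
      using that by (intro continuous_intros continuous_on_subset[OF contH]) auto
    then have "closed ({a..b} \<inter> (\<lambda>r. H r - r ^ m) -` {..0})"
      by (intro continuous_closed_preimage) auto
    moreover have "{a..b} \<inter> (\<lambda>r. H r - r ^ m) -` {..0} = Z \<inter> {a..b}" by (auto simp: Z_def)
    ultimately show ?thesis by (metis compact_Icc compact_Int_closed inf_assoc inf_commute inf_idem)
  qed
  \<comment> \<open>A strict inequality \<open>H c < c ^ m\<close> would persist near
    \<open>c\<close> and put points of the adjacent interval free of \<open>Z\<close> into
    \<open>Z\<close>. So such a boundary point is a genuine contact point.\<close>
  have H_touch: "H c = c ^ m" if "0 < c" "c < R" "c \<in> Z" "0 < a" "a \<noteq> c" "a < R"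
     "\<And>t. min a c < t \<Longrightarrow> t < max a c \<Longrightarrow> t \<notin> Z" for a c
  proof (rule ccontr)
    assume "\<not> ?thesis"
    then have lt: "H c < c ^ m" using that by (auto simp: Z_def)
    have "isCont H c" "isCont (\<lambda>s. s ^ m) c"
      using that DERIV_isCont[OF der] by (auto intro!: continuous_intros)
    then have "eventually (\<lambda>s. H s < s ^ m) (at c)"
      using lt by (rule eventually_less_isCont)
    then obtain d where d: "d > 0" "\<And>s. s \<noteq> c \<Longrightarrow> dist s c < d \<Longrightarrow> H s < s ^ m"
      unfolding eventually_at by auto
    define h where "h = min d \<bar>a - c\<bar> / 2"
    have h: "0 < h" "h < d" "h < \<bar>a - c\<bar>" using d that by (auto simp: h_def min_def)
    define s where "s = (if a < c then c - h else c + h)"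
    have "s \<notin> Z" by (rule that(7)) (use h in \<open>auto simp: s_def split: if_splits\<close>)
    moreover have "H s < s ^ m" by (rule d(2)) (use h in \<open>auto simp: s_def dist_real_def\<close>)
    ultimately show False by (simp add: Z_def)
  qed
  show ?thesis
  proof (rule mono_onI)
    fix a b assume "a \<in> {0<..<R}" "b \<in> {0<..<R}" "a \<le> b"
    then have ab: "0 < a" "a \<le> b" "b < R" by auto
    show "?g a \<le> ?g b"
    proof (cases "Z \<inter> {a..b} = {}")
      case True
      then have "t \<notin> Z" if "a \<le> t" "t \<le> b" for t using that by auto
      then have "?f a \<le> ?f b" using ab Hpos by (intro seg) auto
      moreover have "a \<notin> Z" "b \<notin> Z" using True ab by auto
      then have "?g a = ?f a" "?g b = ?f b" by (auto simp: Z_def)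
      ultimately show ?thesis by linarith
    next
      case False
      obtain c where c: "c \<in> Z \<inter> {a..b}" "\<And>t. t \<in> Z \<inter> {a..b} \<Longrightarrow> c \<le> t"
        using compact_attains_inf[OF clZ False] ab by blast
      obtain d where d: "d \<in> Z \<inter> {a..b}" "\<And>t. t \<in> Z \<inter> {a..b} \<Longrightarrow> t \<le> d"
        using compact_attains_sup[OF clZ False] ab by blast
      have left: "?g a \<le> (1 + C * c) * m"
      proof (cases "a = c")
        case True
        then have "a \<in> Z" using c(1) by blast
        from gZ[OF this ab(1)] show ?thesis unfolding True by (rule eq_refl)
      next
        case False
        then have ac: "a < c" "c \<le> b" "c < R" using c ab by auto
        have nZ: "t \<notin> Z" if "a \<le> t" "t < c" for t using c(2)[of t] that ac by auto
        have t: "H c = c ^ m" by (rule H_touch[of c a]) (use ac ab c nZ in auto)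
        have "?f a \<le> ?f c"
        proof (rule seg)
          show "0 < H t" if "a \<le> t" "t \<le> c" for t
            using that nZ Hpos ab \<open>H c = c ^ m\<close> ac by (cases "t = c") auto
        qed (use ac ab nZ in auto)
        moreover have "c * H' c / H c \<le> m"
          by (rule power_touch_derivative(1)[where a=a])
             (use t der ac ab nZ in \<open>auto simp: Z_def not_le less_imp_le\<close>)
        then have "(1 + C * c) * (c * H' c / H c) \<le> (1 + C * c) * m"
          using C ab ac by (intro mult_left_mono) auto
        moreover have "?f c = (1 + C * c) * (c * H' c / H c)" by (simp add: power2_eq_square algebra_simps add_divide_distrib)
        moreover have "?g a = ?f a" using nZ[of a] ac by (simp add: Z_def)
        ultimately show ?thesis by linarith
      qed
      have right: "(1 + C * d) * m \<le> ?g b"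
      proof (cases "b = d")
        case True
        then have "b \<in> Z" "0 < b" using d(1) ab by (blast, linarith)
        from gZ[OF this, symmetric] show ?thesis unfolding True by (rule eq_refl)
      next
        case False
        then have db: "a \<le> d" "d < b" using d ab by auto
        have nZ: "t \<notin> Z" if "d < t" "t \<le> b" for t using d(2)[of t] that db by auto
        have t: "H d = d ^ m" by (rule H_touch[of d b]) (use db ab d nZ in auto)
        have "?f d \<le> ?f b"
        proof (rule seg)
          show "0 < H t" if "d \<le> t" "t \<le> b" for t
            using that nZ Hpos ab \<open>H d = d ^ m\<close> db by (cases "t = d") auto
        qed (use db ab nZ in auto)
        moreover have "m \<le> d * H' d / H d"
          by (rule power_touch_derivative(2)[where b=b])
             (use t der db ab nZ in \<open>auto simp: Z_def not_le less_imp_le\<close>)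
        then have "(1 + C * d) * m \<le> (1 + C * d) * (d * H' d / H d)"
          using C ab db by (intro mult_left_mono) auto
        moreover have "?f d = (1 + C * d) * (d * H' d / H d)" by (simp add: power2_eq_square algebra_simps add_divide_distrib)
        moreover have "?g b = ?f b" using nZ[of b] db by (simp add: Z_def)
        ultimately show ?thesis by linarith
      qed
      have "c \<le> d" using c d by auto
      then have "(1 + C * c) * m \<le> (1 + C * d) * m" using C by (intro mult_right_mono) (auto intro: mult_left_mono)
      then show ?thesis using left right by linarith
    qed
  qed
qed

section \<open>Polar coordinates\<close>

lemma nn_integral_lborel_affine:
  fixes f :: "'a::euclidean_space \<Rightarrow> ennreal" and c :: real
  assumes [measurable]: "f \<in> borel_measurable borel" and c: "c \<noteq> 0"
  shows "(\<integral>\<^sup>+x. f x \<partial>lborel) = ennreal (\<bar>c\<bar> ^ DIM('a)) * (\<integral>\<^sup>+x. f (t + c *\<^sub>R x) \<partial>lborel)"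
  by (subst lborel_affine[OF c, of t])
     (simp add: nn_integral_density nn_integral_distr nn_integral_cmult)

lemma nn_integral_power_tail:
  fixes a :: real
  assumes "0 < a" and "0 < n"
  shows "(\<integral>\<^sup>+t. ennreal (1 / t ^ Suc n) * indicator {a..} t \<partial>lborel) = ennreal (1 / (n * a ^ n))"
proof -
  have "(\<integral>\<^sup>+t. ennreal (1 / t ^ Suc n) * indicator {a..} t \<partial>lborel) = ennreal (0 - (- 1 / (n * a ^ n)))"
  proof (rule nn_integral_FTC_atLeast)
    show "((\<lambda>t. - 1 / (n * t ^ n)) has_real_derivative 1 / x ^ Suc n) (at x)" if "a \<le> x" for x
    proof -
      have x: "x > 0" using that assms by auto
      obtain k where k: "n = Suc k" using assms(2) by (cases n) auto
      have "((\<lambda>t. - inverse (real n) * inverse (t ^ n)) has_real_derivative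
          - inverse (real n) * (- (inverse (x ^ n) * (real n * x ^ (n - Suc 0)) * inverse (x ^ n)))) (at x)"
        using x by (intro DERIV_cmult DERIV_inverse' DERIV_pow) auto
      moreover have "- inverse (real n) * (- (inverse (x ^ n) * (real n * x ^ (n - Suc 0)) * inverse (x ^ n))) = 1 / x ^ Suc n"
        using x by (simp add: k field_simps)
          (intro add_pos_nonneg[THEN less_imp_neq, THEN not_sym]; simp)
      ultimately show ?thesis by (simp add: field_simps)
    qed
    have "filterlim (\<lambda>t::real. t ^ n) at_top at_top"
      using filterlim_pow_at_top[OF assms(2) filterlim_ident] .
    then have "((\<lambda>t::real. - inverse (real n) * inverse (t ^ n)) \<longlongrightarrow> - inverse (real n) * 0) at_top"
      by (intro tendsto_mult tendsto_const tendsto_inverse_0_at_top)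
    then show "((\<lambda>t::real. - 1 / (n * t ^ n)) \<longlongrightarrow> 0) at_top"
      by (simp add: field_simps)
  qed (use assms in auto)
  then show ?thesis by simp
qed

text \<open>Directions are averaged over the unit ball through \<open>z / norm z\<close>, so no
  surface measure is involved. Substitute \<open>s = norm z * t\<close>, exchange the integrals and
  substitute \<open>y = t *\<^sub>R z\<close>. In dimension \<open>n\<close>, each \<open>y\<close>
  is then left with the factor \<open>n * norm y ^ n\<close> times the integral of
  \<open>1 / t ^ (n + 1)\<close> over \<open>t > norm y\<close>, which is 1.\<close>

lemma nn_integral_polar:
  fixes g :: "'a::euclidean_space \<Rightarrow> ennreal"
  assumes [measurable]: "g \<in> borel_measurable borel"
  shows "(\<integral>\<^sup>+x. g x \<partial>lborel) =
    (\<integral>\<^sup>+s. \<integral>\<^sup>+z. indicator {0<..} s * ennreal (DIM('a) * s ^ (DIM('a) - 1)) * (indicator (ball 0 1) z * g ((s / norm z) *\<^sub>R z)) \<partial>lborel \<partial>lborel)"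
    (is "_ = ?R")
proof -
  let ?n = "DIM('a)"
  have n: "?n > 0" by simp
  have ballm[measurable]: "ball (0::'a) 1 \<in> sets borel" by simp
  have inner: "(\<integral>\<^sup>+s. indicator {0<..} s * ennreal (?n * s ^ (?n - 1)) * (indicator (ball 0 1) z * g ((s / norm z) *\<^sub>R z)) \<partial>lborel)
     = (\<integral>\<^sup>+t. indicator {0<..} t * ennreal (?n * t ^ (?n - 1)) * (indicator (ball 0 1) z * ennreal (norm z ^ ?n) * g (t *\<^sub>R z)) \<partial>lborel)"
    if z: "z \<noteq> 0" for z :: 'a
  proof -
    have nz: "norm z > 0" using z by simp
    have "(\<integral>\<^sup>+s. indicator {0<..} s * ennreal (?n * s ^ (?n - 1)) * (indicator (ball 0 1) z * g ((s / norm z) *\<^sub>R z)) \<partial>lborel)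
      = ennreal (norm z) * (\<integral>\<^sup>+t. indicator {0<..} (norm z * t) * ennreal (?n * (norm z * t) ^ (?n - 1)) * (indicator (ball 0 1) z * g (((norm z * t) / norm z) *\<^sub>R z)) \<partial>lborel)"
      using nz by (subst nn_integral_real_affine[where c="norm z" and t=0]) auto
    also have "\<dots> = (\<integral>\<^sup>+t. ennreal (norm z) * (indicator {0<..} (norm z * t) * ennreal (?n * (norm z * t) ^ (?n - 1)) * (indicator (ball 0 1) z * g (((norm z * t) / norm z) *\<^sub>R z))) \<partial>lborel)"
      by (rule nn_integral_cmult[symmetric]) measurable
    also have "\<dots> = (\<integral>\<^sup>+t. indicator {0<..} t * ennreal (?n * t ^ (?n - 1)) * (indicator (ball 0 1) z * ennreal (norm z ^ ?n) * g (t *\<^sub>R z)) \<partial>lborel)"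
    proof (intro nn_integral_cong)
      fix t :: real
      have "ennreal (norm z) * ennreal (?n * (norm z * t) ^ (?n - 1)) = ennreal (?n * t ^ (?n - 1)) * ennreal (norm z ^ ?n)" if "t > 0"
      proof -
        have "norm z * (?n * (norm z * t) ^ (?n - 1)) = ?n * t ^ (?n - 1) * norm z ^ ?n"
          using n by (cases ?n) (simp_all add: power_mult_distrib)
        then show ?thesis using that nz by (simp add: ennreal_mult[symmetric])
      qed
      moreover have "norm z * t / norm z = t" "0 < norm z * t \<longleftrightarrow> 0 < t" using nz by (auto simp: zero_less_mult_iff)
      ultimately show "ennreal (norm z) * (indicator {0<..} (norm z * t) * ennreal (?n * (norm z * t) ^ (?n - 1)) * (indicator (ball 0 1) z * g (((norm z * t) / norm z) *\<^sub>R z)))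
        = indicator {0<..} t * ennreal (?n * t ^ (?n - 1)) * (indicator (ball 0 1) z * ennreal (norm z ^ ?n) * g (t *\<^sub>R z))"
        by (cases "t > 0"; cases "z \<in> ball 0 1") (auto simp: mult.assoc[symmetric])
    qed
    finally show ?thesis .
  qed
  \<comment> \<open>In the variable \<open>y = t *\<^sub>R z\<close> the unit ball becomes
    \<open>norm y < t\<close>; the Jacobian \<open>1 / t ^ n\<close> joins the weight
    \<open>(norm y / t) ^ n\<close>.\<close>
  have inner2: "(\<integral>\<^sup>+z. indicator (ball 0 1) z * ennreal (norm z ^ ?n) * g (t *\<^sub>R z) \<partial>lborel) =
     (\<integral>\<^sup>+y. indicator {norm y<..} t * ennreal (norm y ^ ?n / t ^ (2 * ?n)) * g y \<partial>lborel)" if t: "0 < t" for t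
  proof -
    have "(\<integral>\<^sup>+z. indicator (ball 0 1) z * ennreal (norm z ^ ?n) * g (t *\<^sub>R z) \<partial>lborel) =
      ennreal (\<bar>1/t\<bar> ^ ?n) * (\<integral>\<^sup>+y. indicator (ball 0 1) (0 + (1/t) *\<^sub>R y) * ennreal (norm (0 + (1/t) *\<^sub>R y) ^ ?n) * g (t *\<^sub>R (0 + (1/t) *\<^sub>R y)) \<partial>lborel)"
      using t by (intro nn_integral_lborel_affine) auto
    also have "\<dots> = (\<integral>\<^sup>+y. ennreal (\<bar>1/t\<bar> ^ ?n) * (indicator (ball 0 1) (0 + (1/t) *\<^sub>R y) * ennreal (norm (0 + (1/t) *\<^sub>R y) ^ ?n) * g (t *\<^sub>R (0 + (1/t) *\<^sub>R y))) \<partial>lborel)"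
      by (rule nn_integral_cmult[symmetric]) measurable
    also have "\<dots> = (\<integral>\<^sup>+y. indicator {norm y<..} t * ennreal (norm y ^ ?n / t ^ (2 * ?n)) * g y \<partial>lborel)"
    proof (intro nn_integral_cong)
      fix y :: 'a
      have 1: "(0 + (1/t) *\<^sub>R y \<in> ball 0 1) = (t \<in> {norm y<..})" using t by (simp add: field_simps)
      have 2: "t *\<^sub>R (0 + (1/t) *\<^sub>R y) = y" using t by simp
      have 3: "\<bar>1/t\<bar> ^ ?n * norm (0 + (1/t) *\<^sub>R y) ^ ?n = norm y ^ ?n / t ^ (2 * ?n)"
        using t by (simp add: power_mult_distrib power_divide field_simps power_mult power2_eq_square)
      have 4: "ennreal (\<bar>1/t\<bar> ^ ?n) * ennreal (norm (0 + (1/t) *\<^sub>R y) ^ ?n) = ennreal (norm y ^ ?n / t ^ (2 * ?n))"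
        unfolding 3[symmetric] by (rule ennreal_mult[symmetric]) auto
      show "ennreal (\<bar>1/t\<bar> ^ ?n) * (indicator (ball 0 1) (0 + (1/t) *\<^sub>R y) * ennreal (norm (0 + (1/t) *\<^sub>R y) ^ ?n) * g (t *\<^sub>R (0 + (1/t) *\<^sub>R y)))
         = indicator {norm y<..} t * ennreal (norm y ^ ?n / t ^ (2 * ?n)) * g y"
        unfolding 2 4[symmetric] using 1 by (auto simp: indicator_def mult.assoc)
    qed
    finally show ?thesis .
  qed
  have nae: "AE z in lborel. z \<noteq> (0::'a)" by (simp add: AE_lborel_singleton)
  have "?R = (\<integral>\<^sup>+z. \<integral>\<^sup>+s. indicator {0<..} s * ennreal (?n * s ^ (?n - 1)) * (indicator (ball 0 1) z * g ((s / norm z) *\<^sub>R z)) \<partial>lborel \<partial>lborel)"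
    by (rule lborel_pair.Fubini') measurable
  also have "\<dots> = (\<integral>\<^sup>+z. \<integral>\<^sup>+t. indicator {0<..} t * ennreal (?n * t ^ (?n - 1)) * (indicator (ball 0 1) z * ennreal (norm z ^ ?n) * g (t *\<^sub>R z)) \<partial>lborel \<partial>lborel)"
    by (rule nn_integral_cong_AE) (use nae in eventually_elim, rule inner)
  also have "\<dots> = (\<integral>\<^sup>+t. \<integral>\<^sup>+z. indicator {0<..} t * ennreal (?n * t ^ (?n - 1)) * (indicator (ball 0 1) z * ennreal (norm z ^ ?n) * g (t *\<^sub>R z)) \<partial>lborel \<partial>lborel)"
    by (rule lborel_pair.Fubini') measurable
  also have "\<dots> = (\<integral>\<^sup>+t. indicator {0<..} t * ennreal (?n * t ^ (?n - 1)) * (\<integral>\<^sup>+z. (indicator (ball 0 1) z * ennreal (norm z ^ ?n) * g (t *\<^sub>R z)) \<partial>lborel) \<partial>lborel)"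
    by (intro nn_integral_cong nn_integral_cmult) measurable
  also have "\<dots> = (\<integral>\<^sup>+t. indicator {0<..} t * ennreal (?n * t ^ (?n - 1)) * (\<integral>\<^sup>+y. indicator {norm y<..} t * ennreal (norm y ^ ?n / t ^ (2 * ?n)) * g y \<partial>lborel) \<partial>lborel)"
  proof (intro nn_integral_cong)
    fix t :: real
    show "indicator {0<..} t * ennreal (?n * t ^ (?n - 1)) * (\<integral>\<^sup>+z. (indicator (ball 0 1) z * ennreal (norm z ^ ?n) * g (t *\<^sub>R z)) \<partial>lborel)
      = indicator {0<..} t * ennreal (?n * t ^ (?n - 1)) * (\<integral>\<^sup>+y. indicator {norm y<..} t * ennreal (norm y ^ ?n / t ^ (2 * ?n)) * g y \<partial>lborel)"
      by (cases "t > 0") (use inner2[of t] in \<open>simp_all only:\<close>, simp)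
  qed
  also have "\<dots> = (\<integral>\<^sup>+t. \<integral>\<^sup>+y. indicator {0<..} t * ennreal (?n * t ^ (?n - 1)) * (indicator {norm y<..} t * ennreal (norm y ^ ?n / t ^ (2 * ?n)) * g y) \<partial>lborel \<partial>lborel)"
  proof -
    have [measurable]: "(\<lambda>y. indicator {norm y<..} t :: ennreal) \<in> borel_measurable (borel :: 'a measure)" for t :: real
    proof -
      have "(\<lambda>y. indicator {norm y<..} t :: ennreal) = indicator (ball (0::'a) t)" by (auto simp: indicator_def)
      then show ?thesis by (simp only:) (rule borel_measurable_indicator, simp)
    qed
    show ?thesis by (intro nn_integral_cong nn_integral_cmult[symmetric]) measurable
  qed
  also have "\<dots> = (\<integral>\<^sup>+y. \<integral>\<^sup>+t. indicator {0<..} t * ennreal (?n * t ^ (?n - 1)) * (indicator {norm y<..} t * ennreal (norm y ^ ?n / t ^ (2 * ?n)) * g y) \<partial>lborel \<partial>lborel)"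
  proof -
    have eq: "(\<lambda>p. indicator {norm (snd p)<..} (fst p) :: ennreal) = indicator {p::real\<times>'a. norm (snd p) < fst p}"
      by (auto simp: indicator_def)
    have [measurable]: "(\<lambda>p::real\<times>'a. indicator {norm (snd p)<..} (fst p) :: ennreal) \<in> borel_measurable (borel \<Otimes>\<^sub>M borel)"
      unfolding eq by measurable
    show ?thesis by (rule lborel_pair.Fubini'[symmetric]) (simp add: case_prod_beta, measurable)
  qed
  also have "\<dots> = (\<integral>\<^sup>+y. g y \<partial>lborel)"
  proof (rule nn_integral_cong_AE, use nae in eventually_elim)
    fix y :: 'a assume "y \<noteq> 0"
    then have y: "norm y > 0" by simp
    have "(\<integral>\<^sup>+t. indicator {0<..} t * ennreal (?n * t ^ (?n - 1)) * (indicator {norm y<..} t * ennreal (norm y ^ ?n / t ^ (2 * ?n)) * g y) \<partial>lborel)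
       = (\<integral>\<^sup>+t. (ennreal (?n * norm y ^ ?n) * g y) * (ennreal (1 / t ^ Suc ?n) * indicator {norm y..} t) \<partial>lborel)"
    proof (rule nn_integral_cong_AE)
      have "AE t in lborel. t \<noteq> norm y" by (simp add: AE_lborel_singleton)
      then show "AE t in lborel. indicator {0<..} t * ennreal (?n * t ^ (?n - 1)) * (indicator {norm y<..} t * ennreal (norm y ^ ?n / t ^ (2 * ?n)) * g y)
         = (ennreal (?n * norm y ^ ?n) * g y) * (ennreal (1 / t ^ Suc ?n) * indicator {norm y..} t)"
      proof eventually_elim
        fix t assume t: "t \<noteq> norm y"
        show "indicator {0<..} t * ennreal (?n * t ^ (?n - 1)) * (indicator {norm y<..} t * ennreal (norm y ^ ?n / t ^ (2 * ?n)) * g y)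
         = (ennreal (?n * norm y ^ ?n) * g y) * (ennreal (1 / t ^ Suc ?n) * indicator {norm y..} t)"
        proof (cases "norm y < t")
          case True
          then have tp: "t > 0" using y by linarith
          obtain k where k: "?n = Suc k" using n by (cases ?n) auto
          have "(?n * t ^ (?n - 1)) * (norm y ^ ?n / t ^ (2 * ?n)) = (?n * norm y ^ ?n) * (1 / t ^ Suc ?n)"
            using tp unfolding k by (simp add: field_simps power_add mult_2_right)
          then have "ennreal (?n * t ^ (?n - 1)) * ennreal (norm y ^ ?n / t ^ (2 * ?n)) = ennreal (?n * norm y ^ ?n) * ennreal (1 / t ^ Suc ?n)"
            using tp by (simp add: ennreal_mult[symmetric])
          then show ?thesis using True tp by (simp add: mult.assoc[symmetric]) (simp add: mult_ac)
        next
          case False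
          then show ?thesis using t by auto
        qed
      qed
    qed
    also have "\<dots> = (ennreal (?n * norm y ^ ?n) * g y) * ennreal (1 / (?n * norm y ^ ?n))"
      by (subst nn_integral_cmult) (simp_all add: nn_integral_power_tail[OF y n, simplified])
    also have "\<dots> = (ennreal (?n * norm y ^ ?n) * ennreal (1 / (?n * norm y ^ ?n))) * g y" by (simp add: mult_ac)
    also have "ennreal (?n * norm y ^ ?n) * ennreal (1 / (?n * norm y ^ ?n)) = 1"
      using y by (simp add: ennreal_mult[symmetric])
    finally show "(\<integral>\<^sup>+t. indicator {0<..} t * ennreal (?n * t ^ (?n - 1)) * (indicator {norm y<..} t * ennreal (norm y ^ ?n / t ^ (2 * ?n)) * g y) \<partial>lborel) = g y" by simp
  qed
  finally show ?thesis ..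
qed

section \<open>Integrals over half balls and half spheres\<close>

text \<open>Continuity on the open half ball gives measurability, and boundedness gives
  integrability and a dominating constant. Bundling the two lets products, inner products and
  compositions be treated by introduction rules, without any extension to the closure.\<close>

definition bounded_continuous_on :: "'a::topological_space set \<Rightarrow> ('a \<Rightarrow> 'b::real_normed_vector) \<Rightarrow> bool" where
  "bounded_continuous_on A F \<longleftrightarrow> continuous_on A F \<and> bounded (F ` A)"

lemma bounded_continuous_onD: "bounded_continuous_on A F \<Longrightarrow> continuous_on A F"
  by (simp add: bounded_continuous_on_def)

lemma bounded_continuous_onE:
  assumes "bounded_continuous_on A F"
  obtains K where "0 < K" "\<And>x. x \<in> A \<Longrightarrow> norm (F x) \<le> K"
  using assms bounded_pos[of "F ` A"] unfolding bounded_continuous_on_def by auto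

lemma bounded_continuous_onI:
  "continuous_on A F \<Longrightarrow> (\<And>x. x \<in> A \<Longrightarrow> norm (F x) \<le> K) \<Longrightarrow> bounded_continuous_on A F"
  by (auto simp: bounded_continuous_on_def bounded_iff)

lemma bounded_continuous_on_const: "bounded_continuous_on A (\<lambda>x. c)"
  by (rule bounded_continuous_onI[where K="norm c"]) auto

lemma bounded_continuous_on_add:
  assumes "bounded_continuous_on A F" "bounded_continuous_on A G"
  shows "bounded_continuous_on A (\<lambda>x. F x + G x)"
  using assms bounded_plus_comp[of F A G] by (auto simp: bounded_continuous_on_def intro: continuous_intros)

lemma bounded_continuous_on_diff:
  assumes "bounded_continuous_on A F" "bounded_continuous_on A G"
  shows "bounded_continuous_on A (\<lambda>x. F x - G x)"
  using assms bounded_minus_comp[of F A G] by (auto simp: bounded_continuous_on_def intro: continuous_intros)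

lemma bounded_continuous_on_bilinear:
  assumes "bounded_bilinear B" "bounded_continuous_on A F" "bounded_continuous_on A G"
  shows "bounded_continuous_on A (\<lambda>x. B (F x) (G x))"
proof -
  interpret bounded_bilinear B by fact
  obtain K L where K: "0 < K" "\<And>x. x \<in> A \<Longrightarrow> norm (F x) \<le> K" and L: "0 < L" "\<And>x. x \<in> A \<Longrightarrow> norm (G x) \<le> L"
    using assms(2,3) bounded_continuous_onE by metis
  obtain C where C: "0 < C" "\<And>a b. norm (B a b) \<le> norm a * norm b * C" using pos_bounded by blast
  have "norm (B (F x) (G x)) \<le> K * L * C" if "x \<in> A" for x
  proof -
    have "norm (F x) * norm (G x) * C \<le> K * L * C"
      using K L C that by (intro mult_right_mono mult_mono) auto
    then show ?thesis using C(2)[of "F x" "G x"] by linarith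
  qed
  with continuous_on[OF bounded_continuous_onD[OF assms(2)] bounded_continuous_onD[OF assms(3)]]
  show ?thesis by (rule bounded_continuous_onI)
qed

lemmas bounded_continuous_on_mult = bounded_continuous_on_bilinear[OF bounded_bilinear_mult]
lemmas bounded_continuous_on_inner = bounded_continuous_on_bilinear[OF bounded_bilinear_inner]
lemmas bounded_continuous_on_scaleR = bounded_continuous_on_bilinear[OF bounded_bilinear_scaleR]

lemma bounded_continuous_on_minus: "bounded_continuous_on A F \<Longrightarrow> bounded_continuous_on A (\<lambda>x. - F x)"
  by (auto simp: bounded_continuous_on_def image_image bounded_iff intro: continuous_intros)

lemma bounded_continuous_on_norm: "bounded_continuous_on A F \<Longrightarrow> bounded_continuous_on A (\<lambda>x. norm (F x))"
  by (auto simp: bounded_continuous_on_def bounded_iff intro: continuous_intros)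

lemma bounded_continuous_on_abs: "bounded_continuous_on A F \<Longrightarrow> bounded_continuous_on A (\<lambda>x. \<bar>F x :: real\<bar>)"
  using bounded_continuous_on_norm[of A F] by simp

lemma bounded_continuous_on_power: "bounded_continuous_on A F \<Longrightarrow> bounded_continuous_on A (\<lambda>x. (F x :: real) ^ n)"
  by (induction n) (auto intro: bounded_continuous_on_const bounded_continuous_on_mult)

lemma bounded_continuous_on_linear:
  assumes "bounded_linear L" "bounded_continuous_on A F"
  shows "bounded_continuous_on A (\<lambda>x. L (F x))"
proof -
  have "bounded (L ` F ` A)"
    using assms by (intro bounded_linear_image) (auto simp: bounded_continuous_on_def)
  then show ?thesis
    using bounded_linear.continuous_on[OF assms(1) bounded_continuous_onD[OF assms(2)]]
    by (simp add: bounded_continuous_on_def image_image)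
qed

lemmas bounded_continuous_on_fst = bounded_continuous_on_linear[OF bounded_linear_fst]
lemmas bounded_continuous_on_snd = bounded_continuous_on_linear[OF bounded_linear_snd]

lemma bounded_continuous_on_id: "bounded A \<Longrightarrow> bounded_continuous_on A (\<lambda>x. x)"
  by (auto simp: bounded_continuous_on_def)

lemma bounded_continuous_on_subset: "bounded_continuous_on A F \<Longrightarrow> B \<subseteq> A \<Longrightarrow> bounded_continuous_on B F"
  by (auto simp: bounded_continuous_on_def intro: continuous_on_subset bounded_subset)

lemma bounded_continuous_on_sgn: "0 \<notin> A \<Longrightarrow> bounded_continuous_on A (\<lambda>x. x /\<^sub>R norm x)"
  by (rule bounded_continuous_onI[where K=1]) (auto intro!: continuous_intros simp: field_simps)

lemma bounded_continuous_on_compose: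
  assumes "bounded_continuous_on B F" "continuous_on A g" "g ` A \<subseteq> B"
  shows "bounded_continuous_on A (\<lambda>x. F (g x))"
proof -
  have "(\<lambda>x. F (g x)) ` A \<subseteq> F ` B" using assms(3) by auto
  then show ?thesis using assms continuous_on_compose2[of B F A g]
    by (auto simp: bounded_continuous_on_def intro: bounded_subset)
qed

lemmas bounded_continuous_intros = bounded_continuous_on_const bounded_continuous_on_add bounded_continuous_on_diff
  bounded_continuous_on_mult bounded_continuous_on_inner bounded_continuous_on_scaleR bounded_continuous_on_minus
  bounded_continuous_on_norm bounded_continuous_on_abs bounded_continuous_on_power bounded_continuous_on_fst
  bounded_continuous_on_snd

lemma set_integrable_bounded:
  fixes F :: "'a::euclidean_space \<Rightarrow> real"
  assumes "bounded A" "A \<in> sets borel" "set_borel_measurable lborel A F" "\<And>x. x \<in> A \<Longrightarrow> \<bar>F x\<bar> \<le> K"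
  shows "set_integrable lborel A F"
proof -
  have "set_integrable lborel A (\<lambda>x. K)"
    using assms emeasure_bounded_finite[of A] unfolding set_integrable_def
    by (intro integrable_scaleR_left integrable_real_indicator) auto
  then show ?thesis
    by (rule set_integrable_bound[OF _ assms(3)]) (use assms(4) in \<open>force intro!: AE_I2\<close>)
qed

lemma bounded_continuous_on_set_integrable:
  fixes F :: "'a::euclidean_space \<Rightarrow> real"
  assumes "bounded_continuous_on B F" "A \<subseteq> B" "bounded A" "A \<in> sets borel"
  shows "set_integrable lborel A F"
proof -
  obtain K where "\<And>x. x \<in> B \<Longrightarrow> norm (F x) \<le> K" using bounded_continuous_onE[OF assms(1)] by blast
  moreover have "set_borel_measurable lborel A F"
    using borel_measurable_continuous_on_indicator[OF assms(4) continuous_on_subset[OF bounded_continuous_onD[OF assms(1)] assms(2)]]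
    by (simp add: set_borel_measurable_def)
  ultimately show ?thesis using assms by (intro set_integrable_bounded[where K=K]) auto
qed

text \<open>The integral of \<open>(t * f x + g x)\<^sup>2\<close> is a nonnegative quadratic
  polynomial in \<open>t\<close>; evaluating it at its minimum gives the discriminant
  inequality.\<close>

lemma set_integral_Cauchy_Schwarz:
  fixes f g :: "'a \<Rightarrow> real"
  assumes f: "set_integrable M A (\<lambda>x. (f x)\<^sup>2)" and g: "set_integrable M A (\<lambda>x. (g x)\<^sup>2)"
    and fg: "set_integrable M A (\<lambda>x. f x * g x)"
  shows "(LINT x:A|M. f x * g x)\<^sup>2 \<le> (LINT x:A|M. (f x)\<^sup>2) * (LINT x:A|M. (g x)\<^sup>2)"
proof -
  let ?a = "LINT x:A|M. (f x)\<^sup>2" and ?b = "LINT x:A|M. f x * g x" and ?c = "LINT x:A|M. (g x)\<^sup>2"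
  have q: "0 \<le> t\<^sup>2 * ?a + 2 * t * ?b + ?c" for t
  proof -
    have "0 \<le> (LINT x:A|M. (t * f x + g x)\<^sup>2)"
      unfolding set_lebesgue_integral_def by (intro Bochner_Integration.integral_nonneg) auto
    also have "\<dots> = (LINT x:A|M. t\<^sup>2 * (f x)\<^sup>2 + (2 * t) * (f x * g x) + (g x)\<^sup>2)"
      by (simp add: power2_sum power_mult_distrib algebra_simps)
    also have "\<dots> = t\<^sup>2 * ?a + (2 * t) * ?b + ?c"
      using f g fg by (subst set_integral_add set_integral_mult_right; simp)+
    finally show ?thesis by simp
  qed
  have a0: "0 \<le> ?a" unfolding set_lebesgue_integral_def by (intro Bochner_Integration.integral_nonneg) auto
  show ?thesis
  proof (cases "?a = 0")
    case True
    have "?b = 0"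
    proof (rule ccontr)
      assume "?b \<noteq> 0"
      \<comment> \<open>If the quadratic coefficient vanishes, the polynomial is affine in
        \<open>t\<close>, and this \<open>t\<close> gives it the value -1.\<close>
      then show False using q[of "- (?c + 1) / (2 * ?b)"] True by (simp add: field_simps)
    qed
    then show ?thesis using True by simp
  next
    case False
    have "0 \<le> ?a * ((- ?b / ?a)\<^sup>2 * ?a + 2 * (- ?b / ?a) * ?b + ?c)"
      using q[of "- ?b / ?a"] a0 by (intro mult_nonneg_nonneg) auto
    also have "\<dots> = ?a * ?c - ?b\<^sup>2" using False by (simp add: field_simps power2_eq_square)
    finally show ?thesis by simp
  qed
qed

section \<open>Half balls and cone integrals for half spheres\<close>

definition half_ball :: "real \<Rightarrow> ('b::euclidean_space \<times> real) set" where
  "half_ball r = {x \<in> ball 0 r. 0 < snd x}"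

lemma mem_half_ball: "x \<in> half_ball r \<longleftrightarrow> norm x < r \<and> 0 < snd x"
  by (auto simp: half_ball_def)

lemma open_half_ball: "open (half_ball r :: ('b::euclidean_space \<times> real) set)"
proof -
  have "half_ball r = ball 0 r \<inter> {x::'b \<times> real. 0 < snd x}" by (auto simp: half_ball_def)
  then show ?thesis by (simp add: open_Int open_Collect_less continuous_on_snd)
qed

lemma half_ball_borel [measurable]: "half_ball r \<in> sets borel"
  by (simp add: open_half_ball)

lemma bounded_half_ball: "bounded (half_ball r)"
  by (rule bounded_subset[OF bounded_ball[of 0 r]]) (auto simp: half_ball_def)

lemma half_ball_mono: "r \<le> s \<Longrightarrow> half_ball r \<subseteq> half_ball s"
  by (auto simp: mem_half_ball)

lemma half_ball_nonzero: "x \<in> half_ball r \<Longrightarrow> x \<noteq> 0"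
  by (auto simp: mem_half_ball)

lemma ray_in_half_ball:
  assumes "z \<in> half_ball 1" "0 < s" "s < r"
  shows "(s / norm z) *\<^sub>R z \<in> half_ball r"
  using assms half_ball_nonzero[OF assms(1)] by (auto simp: mem_half_ball)

lemma scale_mem_half_ball:
  assumes "x \<in> half_ball r" "0 < l" "l < 1"
  shows "l *\<^sub>R x \<in> half_ball r"
proof -
  have "l * norm x \<le> 1 * norm x" using assms by (intro mult_right_mono) auto
  then show ?thesis using assms by (auto simp: mem_half_ball)
qed

text \<open>Radial cutoffs are written as functions of \<open>x \<bullet> x\<close>, which is smooth
  also at the origin. On the half ball its values lie in the compact interval \<open>{0..1}\<close>,
  where \<open>q\<close> is bounded.\<close>

lemma bounded_continuous_on_inner_self:
  fixes q :: "real \<Rightarrow> real"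
  assumes q: "continuous_on UNIV q"
  shows "bounded_continuous_on (half_ball 1) (\<lambda>x. q (x \<bullet> x))"
proof -
  have "compact (q ` {0..1})" by (intro compact_continuous_image continuous_on_subset[OF q]) auto
  then obtain K where K: "\<And>t. t \<in> {0..1} \<Longrightarrow> norm (q t) \<le> K" using compact_imp_bounded bounded_iff by (metis imageI)
  have "x \<bullet> x \<in> {0..1}" if "x \<in> half_ball 1" for x :: "'a \<times> real"
    using that by (auto simp: mem_half_ball dot_square_norm intro!: power_le_one)
  then show ?thesis
    by (intro bounded_continuous_onI[where K=K] continuous_on_compose2[OF q] continuous_intros K) auto
qed

lemma half_ball_integrable:
  fixes F :: "'b::euclidean_space \<times> real \<Rightarrow> real"
  assumes "bounded_continuous_on (half_ball 1) F" "r \<le> 1"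
  shows "set_integrable lborel (half_ball r) F"
  using assms by (intro bounded_continuous_on_set_integrable[OF assms(1)] half_ball_mono bounded_half_ball half_ball_borel)

text \<open>The integral of \<open>F(r\<omega>)\<close> over the unit upper half sphere, as a cone integral.\<close>

definition half_sphere_integral :: "('b::euclidean_space \<times> real \<Rightarrow> real) \<Rightarrow> real \<Rightarrow> real" where
  "half_sphere_integral F r = DIM('b \<times> real) * (LINT z:half_ball 1|lborel. F ((r / norm z) *\<^sub>R z))"

lemma ray_bounded_continuous:
  assumes "bounded_continuous_on (half_ball 1) F" "0 < s" "s < 1"
  shows "bounded_continuous_on (half_ball 1) (\<lambda>z. F ((s / norm z) *\<^sub>R z))"
  by (rule bounded_continuous_on_compose[OF assms(1)])
     (use assms ray_in_half_ball half_ball_nonzero in \<open>force intro!: continuous_intros\<close>)+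

lemma ray_integrable:
  fixes F :: "'b::euclidean_space \<times> real \<Rightarrow> real"
  assumes "bounded_continuous_on (half_ball 1) F" "0 < s" "s < 1"
  shows "set_integrable lborel (half_ball 1) (\<lambda>z. F ((s / norm z) *\<^sub>R z))"
  by (rule half_ball_integrable[OF ray_bounded_continuous[OF assms]]) simp

lemma half_sphere_integral_cong:
  assumes "\<And>x. norm x = s \<Longrightarrow> 0 < snd x \<Longrightarrow> F x = G x" "0 < s"
  shows "half_sphere_integral F s = half_sphere_integral G s"
proof -
  have "F ((s / norm z) *\<^sub>R z) = G ((s / norm z) *\<^sub>R z)" if "z \<in> half_ball 1" for z
    using that assms half_ball_nonzero[OF that] by (intro assms(1)) (auto simp: mem_half_ball)
  then show ?thesis unfolding half_sphere_integral_def
    by (intro arg_cong2[where f="(*)"] refl set_lebesgue_integral_cong) auto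
qed

lemma half_sphere_integral_add:
  assumes "bounded_continuous_on (half_ball 1) F" "bounded_continuous_on (half_ball 1) G" "0 < s" "s < 1"
  shows "half_sphere_integral (\<lambda>x. F x + G x) s = half_sphere_integral F s + half_sphere_integral G s"
  unfolding half_sphere_integral_def using assms
  by (subst set_integral_add(2)) (auto intro!: ray_integrable simp: distrib_left)

lemma half_sphere_integral_cmult:
  "half_sphere_integral (\<lambda>x. c * F x) s = c * half_sphere_integral F s"
  unfolding half_sphere_integral_def by simp

lemma half_sphere_integral_mono:
  assumes "bounded_continuous_on (half_ball 1) F" "bounded_continuous_on (half_ball 1) G" "0 < s" "s < 1"
    "\<And>x. norm x = s \<Longrightarrow> 0 < snd x \<Longrightarrow> F x \<le> G x"
  shows "half_sphere_integral F s \<le> half_sphere_integral G s"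
proof -
  have "F ((s / norm z) *\<^sub>R z) \<le> G ((s / norm z) *\<^sub>R z)" if "z \<in> half_ball 1" for z
    using that assms(3) half_ball_nonzero[OF that] by (intro assms(5)) (auto simp: mem_half_ball)
  then show ?thesis
    unfolding half_sphere_integral_def using assms
    by (intro mult_left_mono set_integral_mono ray_integrable) auto
qed

lemma half_sphere_integral_Cauchy_Schwarz:
  assumes "bounded_continuous_on (half_ball 1) F" "bounded_continuous_on (half_ball 1) G" "0 < s" "s < 1"
  shows "(half_sphere_integral (\<lambda>x. F x * G x) s)\<^sup>2
    \<le> half_sphere_integral (\<lambda>x. (F x)\<^sup>2) s * half_sphere_integral (\<lambda>x. (G x)\<^sup>2) s"
proof -
  have "(LINT z:half_ball 1|lborel. F ((s / norm z) *\<^sub>R z) * G ((s / norm z) *\<^sub>R z))\<^sup>2 \<le>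
     (LINT z:half_ball 1|lborel. (F ((s / norm z) *\<^sub>R z))\<^sup>2) * (LINT z:half_ball 1|lborel. (G ((s / norm z) *\<^sub>R z))\<^sup>2)"
    using assms ray_integrable[OF bounded_continuous_on_power[of _ F 2]]
      ray_integrable[OF bounded_continuous_on_power[of _ G 2]] ray_integrable[OF bounded_continuous_on_mult[of _ F G]]
    by (intro set_integral_Cauchy_Schwarz) auto
  then show ?thesis unfolding half_sphere_integral_def
    by (simp add: power_mult_distrib power2_eq_square mult_ac mult_left_mono)
qed

lemma half_sphere_integral_bound:
  fixes F :: "'b::euclidean_space \<times> real \<Rightarrow> real"
  assumes "bounded_continuous_on (half_ball 1) F" "0 < s" "s < 1"
    "\<And>x. norm x = s \<Longrightarrow> 0 < snd x \<Longrightarrow> \<bar>F x\<bar> \<le> K"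
  shows "\<bar>half_sphere_integral F s\<bar> \<le> K * half_sphere_integral (\<lambda>_::'b \<times> real. 1) s"
proof -
  have "half_sphere_integral F s \<le> half_sphere_integral (\<lambda>_::'b \<times> real. K * 1) s"
    by (rule half_sphere_integral_mono[OF assms(1) bounded_continuous_on_const assms(2,3)]) (use assms(4) in force)
  moreover have "half_sphere_integral (\<lambda>x. (-1) * F x) s \<le> half_sphere_integral (\<lambda>_::'b \<times> real. K * 1) s"
    by (rule half_sphere_integral_mono[OF bounded_continuous_on_mult[OF bounded_continuous_on_const assms(1)] bounded_continuous_on_const assms(2,3)])
       (use assms(4) in force)
  ultimately show ?thesis unfolding half_sphere_integral_cmult by linarith
qed

lemma half_sphere_integral_const: "half_sphere_integral (\<lambda>_::'b::euclidean_space \<times> real. c) s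
    = DIM('b \<times> real) * measure lborel (half_ball 1 :: ('b \<times> real) set) * c"
  using emeasure_bounded_finite[OF bounded_half_ball[of "1::real"]]
  by (simp add: half_sphere_integral_def set_lebesgue_integral_def)

lemma ray_set_integral_tendsto:
  fixes q :: "nat \<Rightarrow> 'a::euclidean_space \<Rightarrow> real"
  assumes "\<And>i. set_borel_measurable lborel A (q i)" "set_borel_measurable lborel A Q"
    and "\<And>z. z \<in> A \<Longrightarrow> (\<lambda>i. q i z) \<longlonglongrightarrow> Q z" and "\<And>i z. z \<in> A \<Longrightarrow> \<bar>q i z\<bar> \<le> K"
    and A: "bounded A" "A \<in> sets borel"
  shows "(\<lambda>i. LINT z:A|lborel. q i z) \<longlonglongrightarrow> (LINT z:A|lborel. Q z)"
  unfolding set_lebesgue_integral_def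
proof (rule integral_dominated_convergence[where w="\<lambda>z. indicator A z *\<^sub>R K"])
  show "integrable lborel (\<lambda>z. indicator A z *\<^sub>R K)"
    using A emeasure_bounded_finite[of A] by (intro integrable_scaleR_left integrable_real_indicator) auto
  show "AE x in lborel. (\<lambda>i. indicator A x *\<^sub>R q i x) \<longlonglongrightarrow> indicator A x *\<^sub>R Q x"
    using assms(3) by (intro AE_I2) (auto simp: indicator_def)
  show "AE x in lborel. norm (indicator A x *\<^sub>R q i x) \<le> indicator A x *\<^sub>R K" for i
    using assms(4) by (intro AE_I2) (auto simp: indicator_def)
qed (use assms(1,2) in \<open>auto simp: set_borel_measurable_def\<close>)

lemma bounded_continuous_on_set_borel_measurable:
  fixes F :: "'a::euclidean_space \<Rightarrow> real"
  assumes "bounded_continuous_on A F" "A \<in> sets borel"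
  shows "set_borel_measurable lborel A F"
  using borel_measurable_continuous_on_indicator[OF assms(2) bounded_continuous_onD[OF assms(1)]]
    by (simp add: set_borel_measurable_def)

text \<open>The cone integral has a domain independent of the radius, so the derivative may be taken
  under the integral along each ray. The difference quotients are dominated by the bound for the
  gradient, by the mean value inequality on the ray.\<close>

lemma half_sphere_integral_has_derivative:
  fixes F :: "'b::euclidean_space \<times> real \<Rightarrow> real"
  assumes F: "bounded_continuous_on (half_ball 1) F" and GF: "bounded_continuous_on (half_ball 1) GF"
    and der: "\<And>x. x \<in> half_ball 1 \<Longrightarrow> (F has_derivative (\<lambda>h. GF x \<bullet> h)) (at x)"
    and s: "0 < s" "s < 1"
  shows "(half_sphere_integral F has_real_derivative half_sphere_integral (\<lambda>x. GF x \<bullet> (x /\<^sub>R norm x)) s) (at s)"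
proof -
  obtain K where K: "0 < K" "\<And>x. x \<in> half_ball 1 \<Longrightarrow> norm (GF x) \<le> K" using bounded_continuous_onE[OF GF] by blast
  have bc: "bounded_continuous_on (half_ball 1) (\<lambda>x. GF x \<bullet> (x /\<^sub>R norm x))"
    by (intro bounded_continuous_on_inner GF bounded_continuous_on_sgn) (simp add: mem_half_ball)
  let ?p = "\<lambda>t z::'b \<times> real. (t / norm z) *\<^sub>R z"
  have dz: "((\<lambda>t. F (?p t z)) has_real_derivative GF (?p t z) \<bullet> (?p t z /\<^sub>R norm (?p t z))) (at t)"
    if "z \<in> half_ball 1" "0 < t" "t < 1" for z t
  proof -
    have nz: "norm z > 0" using half_ball_nonzero[OF that(1)] by simp
    have "((\<lambda>t. ?p t z) has_derivative (\<lambda>h. ?p h z)) (at t)"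
      using nz by (auto intro!: derivative_eq_intros simp: field_simps)
    from has_derivative_compose[OF this der[OF ray_in_half_ball[OF that]]]
    have "((\<lambda>t. F (?p t z)) has_derivative (\<lambda>h. GF (?p t z) \<bullet> ?p h z)) (at t)" by simp
    moreover have "(\<lambda>h. GF (?p t z) \<bullet> ?p h z) = (*) (GF (?p t z) \<bullet> (?p t z /\<^sub>R norm (?p t z)))"
      using nz that by (auto simp: fun_eq_iff field_simps)
    ultimately show ?thesis by (simp add: has_field_derivative_def)
  qed
  have lip: "\<bar>F (?p t z) - F (?p s z)\<bar> \<le> K * \<bar>t - s\<bar>" if "z \<in> half_ball 1" "0 < t" "t < 1" for z t
  proof -
    have "norm (F (?p t z) - F (?p s z)) \<le> K * norm (t - s)"
    proof (rule field_differentiable_bound[where S="{0<..<1}"])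
      show "((\<lambda>t. F (?p t z)) has_real_derivative GF (?p x z) \<bullet> (?p x z /\<^sub>R norm (?p x z))) (at x within {0<..<1})"
        if "x \<in> {0<..<1}" for x using dz[of z x] that \<open>z \<in> half_ball 1\<close> by (auto intro: DERIV_subset)
      fix x assume x: "x \<in> {0<..<1::real}"
      have p: "?p x z \<in> half_ball 1" using x that by (intro ray_in_half_ball) auto
      have "\<bar>GF (?p x z) \<bullet> (?p x z /\<^sub>R norm (?p x z))\<bar> \<le> norm (GF (?p x z)) * norm (?p x z /\<^sub>R norm (?p x z))"
        by (rule Cauchy_Schwarz_ineq2)
      also have "norm (?p x z /\<^sub>R norm (?p x z)) = 1" using half_ball_nonzero[OF p] by (metis norm_sgn sgn_div_norm)
      finally show "norm (GF (?p x z) \<bullet> (?p x z /\<^sub>R norm (?p x z))) \<le> K" using K(2)[OF p] by simp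
    qed (use that s in auto)
    then show ?thesis by simp
  qed
  have "((\<lambda>t. (half_sphere_integral F t - half_sphere_integral F s) / (t - s)) \<longlongrightarrow>
      half_sphere_integral (\<lambda>x. GF x \<bullet> (x /\<^sub>R norm x)) s) (at s within {0<..<1})"
    unfolding tendsto_at_iff_sequentially comp_def
  proof (intro allI impI)
    fix X :: "nat \<Rightarrow> real" assume X: "\<forall>i. X i \<in> {0<..<1} - {s}" "X \<longlonglongrightarrow> s"
    let ?q = "\<lambda>i z. (F (?p (X i) z) - F (?p s z)) / (X i - s)"
    have "(\<lambda>i. LINT z:half_ball 1|lborel. ?q i z) \<longlonglongrightarrow> (LINT z:half_ball 1|lborel. GF (?p s z) \<bullet> (?p s z /\<^sub>R norm (?p s z)))"
    proof (rule ray_set_integral_tendsto[OF _ _ _ _ bounded_half_ball half_ball_borel])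
      have "bounded_continuous_on (half_ball 1) (\<lambda>z. inverse (X i - s) * (F (?p (X i) z) - F (?p s z)))" for i
        using X s by (intro bounded_continuous_intros ray_bounded_continuous F) auto
      then show "set_borel_measurable lborel (half_ball 1) (?q i)" for i
        by (intro bounded_continuous_on_set_borel_measurable) (simp_all add: field_simps)
      show "set_borel_measurable lborel (half_ball 1) (\<lambda>z. GF (?p s z) \<bullet> (?p s z /\<^sub>R norm (?p s z)))"
        by (intro bounded_continuous_on_set_borel_measurable ray_bounded_continuous[OF bc] s) simp
      fix z :: "'b \<times> real" assume z: "z \<in> half_ball 1"
      have "((\<lambda>t. (F (?p t z) - F (?p s z)) / (t - s)) \<longlongrightarrow> GF (?p s z) \<bullet> (?p s z /\<^sub>R norm (?p s z))) (at s)"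
        using dz[OF z s] by (simp add: has_field_derivative_iff)
      then show "(\<lambda>i. ?q i z) \<longlonglongrightarrow> GF (?p s z) \<bullet> (?p s z /\<^sub>R norm (?p s z))"
        using X unfolding tendsto_at_iff_sequentially comp_def by auto
      show "\<bar>?q i z\<bar> \<le> K" for i
        using lip[OF z, of "X i"] X s by (auto simp: abs_divide divide_le_eq)
    qed
    from tendsto_mult_left[OF this, of "DIM('b \<times> real)"]
    have "(\<lambda>i. DIM('b \<times> real) * (LINT z:half_ball 1|lborel. ?q i z)) \<longlonglongrightarrow> half_sphere_integral (\<lambda>x. GF x \<bullet> (x /\<^sub>R norm x)) s"
      unfolding half_sphere_integral_def .
    moreover have "DIM('b \<times> real) * (LINT z:half_ball 1|lborel. ?q i z) = (half_sphere_integral F (X i) - half_sphere_integral F s) / (X i - s)" for i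
    proof -
      have "(LINT z:half_ball 1|lborel. ?q i z) = ((LINT z:half_ball 1|lborel. F (?p (X i) z)) - (LINT z:half_ball 1|lborel. F (?p s z))) / (X i - s)"
        using X s by (subst set_integral_diff(2)[symmetric]) (auto intro!: ray_integrable F)
      then show ?thesis unfolding half_sphere_integral_def
        by (simp only: right_diff_distrib times_divide_eq_right)
    qed
    ultimately show "(\<lambda>i. (half_sphere_integral F (X i) - half_sphere_integral F s) / (X i - s)) \<longlonglongrightarrow> half_sphere_integral (\<lambda>x. GF x \<bullet> (x /\<^sub>R norm x)) s"
      by (simp only:)
  qed
  moreover have "at s within {0<..<1} = at s" using s by (intro at_within_open) auto
  ultimately show ?thesis by (simp add: has_field_derivative_iff)
qed

lemma half_sphere_integral_continuous:
  fixes F :: "'b::euclidean_space \<times> real \<Rightarrow> real"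
  assumes F: "bounded_continuous_on (half_ball 1) F"
  shows "continuous_on {0<..<1} (half_sphere_integral F)"
  unfolding continuous_on_sequentially comp_def
proof (intro allI impI ballI)
  fix X :: "nat \<Rightarrow> real" and s :: real assume X: "s \<in> {0<..<1}" "(\<forall>n. X n \<in> {0<..<1}) \<and> X \<longlonglongrightarrow> s"
  obtain K where K: "0 < K" "\<And>x. x \<in> half_ball 1 \<Longrightarrow> norm (F x) \<le> K" using bounded_continuous_onE[OF F] by blast
  let ?p = "\<lambda>t z::'b \<times> real. (t / norm z) *\<^sub>R z"
  have "(\<lambda>i. LINT z:half_ball 1|lborel. F (?p (X i) z)) \<longlonglongrightarrow> (LINT z:half_ball 1|lborel. F (?p s z))"
  proof (rule ray_set_integral_tendsto[OF _ _ _ _ bounded_half_ball half_ball_borel])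
    show "set_borel_measurable lborel (half_ball 1) (\<lambda>z. F (?p (X i) z))" for i
      using X by (auto intro!: bounded_continuous_on_set_borel_measurable ray_bounded_continuous F)
    show "set_borel_measurable lborel (half_ball 1) (\<lambda>z. F (?p s z))"
      using X by (auto intro!: bounded_continuous_on_set_borel_measurable ray_bounded_continuous F)
    fix z :: "'b \<times> real" assume z: "z \<in> half_ball 1"
    have "(\<lambda>i. ?p (X i) z) \<longlonglongrightarrow> ?p s z" using X half_ball_nonzero[OF z] by (intro tendsto_intros) auto
    then show "(\<lambda>i. F (?p (X i) z)) \<longlonglongrightarrow> F (?p s z)"
      using X z by (intro continuous_on_tendsto_compose[OF bounded_continuous_onD[OF F]]) (auto intro!: ray_in_half_ball always_eventually)
    show "\<bar>F (?p (X i) z)\<bar> \<le> K" for i using K(2)[OF ray_in_half_ball[OF z]] X by simp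
  qed
  from tendsto_mult_left[OF this, of "DIM('b \<times> real)"]
  show "(\<lambda>i. half_sphere_integral F (X i)) \<longlonglongrightarrow> half_sphere_integral F s" by (simp add: half_sphere_integral_def)
qed

lemma half_sphere_integral_set_integrable:
  fixes F :: "'b::euclidean_space \<times> real \<Rightarrow> real"
  assumes "bounded_continuous_on (half_ball 1) F" "A \<subseteq> {0<..<1}" "A \<in> sets borel"
  shows "set_integrable lborel A (\<lambda>s. s ^ p * half_sphere_integral F s)"
proof -
  obtain K where K: "0 < K" "\<And>x. x \<in> half_ball 1 \<Longrightarrow> norm (F x) \<le> K" using bounded_continuous_onE[OF assms(1)] by blast
  have "bounded_continuous_on {0<..<1} (half_sphere_integral F)"
  proof (rule bounded_continuous_onI[OF half_sphere_integral_continuous[OF assms(1)]])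
    fix s :: real assume "s \<in> {0<..<1}"
    then show "norm (half_sphere_integral F s) \<le> K * half_sphere_integral (\<lambda>_::'b \<times> real. 1) 1"
      using half_sphere_integral_bound[OF assms(1), of s K] K(2) half_sphere_integral_const[of 1, where 'b='b]
      by (auto simp: mem_half_ball)
  qed
  then show ?thesis
    using assms by (intro bounded_continuous_on_set_integrable[where B="{0<..<1}"] bounded_continuous_intros)
      (auto intro!: bounded_continuous_on_id bounded_subset[OF bounded_closed_interval[of 0 "1::real"]])
qed

text \<open>The polar formula is available for nonnegative functions. A bounded \<open>F\<close> is
  shifted by its bound \<open>K\<close>; the formula holds for \<open>F + K\<close> and for the
  constant \<open>K\<close>, and subtraction removes the shift.\<close>

lemma half_ball_polar:
  fixes F :: "'b::euclidean_space \<times> real \<Rightarrow> real"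
  assumes F: "bounded_continuous_on (half_ball 1) F" and r: "0 < r" "r \<le> 1"
  shows "(LINT x:half_ball r|lborel. F x) = (LINT s:{0<..<r}|lborel. s ^ DIM('b) * half_sphere_integral F s)"
proof -
  have nonneg_case: "(LINT x:half_ball r|lborel. F x) = (LINT s:{0<..<r}|lborel. s ^ DIM('b) * half_sphere_integral F s)"
    if F: "bounded_continuous_on (half_ball 1) F" and F0: "\<And>x. x \<in> half_ball 1 \<Longrightarrow> 0 \<le> F x" for F :: "'b \<times> real \<Rightarrow> real"
  proof -
    let ?n = "DIM('b \<times> real)"
    let ?g = "\<lambda>x. ennreal (indicator (half_ball r) x *\<^sub>R F x)"
    have m: "(\<lambda>x. indicator (half_ball r) x *\<^sub>R F x) \<in> borel_measurable borel"
      using half_ball_integrable[OF F r(2)] by (auto simp: set_integrable_def)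
    have hs0: "0 \<le> half_sphere_integral F s" if "0 < s" "s < 1" for s
      unfolding half_sphere_integral_def set_lebesgue_integral_def
      by (intro mult_nonneg_nonneg Bochner_Integration.integral_nonneg) (auto simp: indicator_def F0 ray_in_half_ball that)
    have inner: "(\<integral>\<^sup>+z. indicator {0<..} s * ennreal (?n * s ^ (?n - 1)) * (indicator (ball 0 1) z * ?g ((s / norm z) *\<^sub>R z)) \<partial>lborel)
        = ennreal (indicator {0<..<r} s *\<^sub>R (s ^ DIM('b) * half_sphere_integral F s))" for s :: real
    proof (cases "0 < s \<and> s < r")
      case False
      have "indicator {0<..} s * ennreal (?n * s ^ (?n - 1)) * (indicator (ball 0 1) z * ?g ((s / norm z) *\<^sub>R z)) = 0" for z :: "'b \<times> real"
        using False by (cases "z = 0") (auto simp: indicator_def mem_half_ball)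
      then have L0: "(\<integral>\<^sup>+z. indicator {0<..} s * ennreal (?n * s ^ (?n - 1)) * (indicator (ball 0 1) z * ?g ((s / norm z) *\<^sub>R z)) \<partial>lborel)
          = integral\<^sup>N lborel (\<lambda>z::'b \<times> real. 0)"
        by (intro nn_integral_cong)
      have R0: "indicator {0<..<r} s *\<^sub>R (s ^ DIM('b) * half_sphere_integral F s) = 0" using False by simp
      show ?thesis unfolding L0 R0 by simp
    next
      case True
      then have s: "0 < s" "s < 1" "s < r" using r by auto
      have "(\<integral>\<^sup>+z. indicator {0<..} s * ennreal (?n * s ^ (?n - 1)) * (indicator (ball 0 1) z * ?g ((s / norm z) *\<^sub>R z)) \<partial>lborel)
         = (\<integral>\<^sup>+z. ennreal (?n * s ^ (?n - 1)) * ennreal (indicator (half_ball 1) z *\<^sub>R F ((s / norm z) *\<^sub>R z)) \<partial>lborel)"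
      proof (rule nn_integral_cong)
        fix z :: "'b \<times> real"
        have "indicator (ball 0 1) z * ?g ((s / norm z) *\<^sub>R z) = ennreal (indicator (half_ball 1) z *\<^sub>R F ((s / norm z) *\<^sub>R z))"
        proof (cases "z \<in> half_ball 1")
          case True
          then show ?thesis using ray_in_half_ball[OF True s(1,3)] by (auto simp: mem_half_ball)
        next
          case False
          then have "indicator (ball 0 1) z = (0::ennreal) \<or> (s / norm z) *\<^sub>R z \<notin> half_ball r"
            using s by (auto simp: mem_half_ball zero_less_mult_iff zero_less_divide_iff)
          then show ?thesis using False by auto
        qed
        then show "indicator {0<..} s * ennreal (?n * s ^ (?n - 1)) * (indicator (ball 0 1) z * ?g ((s / norm z) *\<^sub>R z))
          = ennreal (?n * s ^ (?n - 1)) * ennreal (indicator (half_ball 1) z *\<^sub>R F ((s / norm z) *\<^sub>R z))"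
          using s by simp
      qed
      also have "\<dots> = ennreal (?n * s ^ (?n - 1)) * (\<integral>\<^sup>+z. ennreal (indicator (half_ball 1) z *\<^sub>R F ((s / norm z) *\<^sub>R z)) \<partial>lborel)"
        using ray_integrable[OF F s(1,2)] by (intro nn_integral_cmult) (auto simp: set_integrable_def)
      also have "(\<integral>\<^sup>+z. ennreal (indicator (half_ball 1) z *\<^sub>R F ((s / norm z) *\<^sub>R z)) \<partial>lborel)
          = ennreal (LINT z:half_ball 1|lborel. F ((s / norm z) *\<^sub>R z))"
        unfolding set_lebesgue_integral_def
        using ray_integrable[OF F s(1,2)] by (intro nn_integral_eq_integral) (auto simp: set_integrable_def indicator_def F0 ray_in_half_ball s)
      also have "ennreal (?n * s ^ (?n - 1)) * \<dots> = ennreal (?n * s ^ (?n - 1) * (LINT z:half_ball 1|lborel. F ((s / norm z) *\<^sub>R z)))"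
        using s by (intro ennreal_mult[symmetric]) (auto simp: set_lebesgue_integral_def indicator_def F0 ray_in_half_ball intro!: Bochner_Integration.integral_nonneg)
      also have "\<dots> = ennreal (indicator {0<..<r} s *\<^sub>R (s ^ DIM('b) * half_sphere_integral F s))"
        using s by (simp add: half_sphere_integral_def mult_ac)
      finally show ?thesis .
    qed
    have F0r: "0 \<le> F x" if "x \<in> half_ball r" for x
      using F0 half_ball_mono[OF r(2), where 'a='b] that by blast
    have "ennreal (LINT x:half_ball r|lborel. F x) = (\<integral>\<^sup>+x. ?g x \<partial>lborel)"
      unfolding set_lebesgue_integral_def
      using half_ball_integrable[OF F r(2)] F0r
      by (intro nn_integral_eq_integral[symmetric] AE_I2) (auto simp: set_integrable_def indicator_def)
    also have "\<dots> = (\<integral>\<^sup>+s. ennreal (indicator {0<..<r} s *\<^sub>R (s ^ DIM('b) * half_sphere_integral F s)) \<partial>lborel)"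
      by (subst nn_integral_polar[OF measurable_compose[OF m measurable_ennreal]]) (simp only: inner)
    also have "\<dots> = ennreal (LINT s:{0<..<r}|lborel. s ^ DIM('b) * half_sphere_integral F s)"
      unfolding set_lebesgue_integral_def
    proof (rule nn_integral_eq_integral)
      show "integrable lborel (\<lambda>s. indicator {0<..<r} s *\<^sub>R (s ^ DIM('b) * half_sphere_integral F s))"
        using half_sphere_integral_set_integrable[OF F, of "{0<..<r}" "DIM('b)"] r
        unfolding set_integrable_def by fastforce
      show "AE s in lborel. 0 \<le> indicator {0<..<r} s *\<^sub>R (s ^ DIM('b) * half_sphere_integral F s)"
        using r by (intro AE_I2) (auto simp: indicator_def hs0)
    qed
    finally have e: "ennreal (LINT x:half_ball r|lborel. F x) = ennreal (LINT s:{0<..<r}|lborel. s ^ DIM('b) * half_sphere_integral F s)" .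
    have "0 \<le> (LINT x:half_ball r|lborel. F x)"
      unfolding set_lebesgue_integral_def by (rule Bochner_Integration.integral_nonneg) (auto simp: indicator_def F0r)
    moreover have "0 \<le> (LINT s:{0<..<r}|lborel. s ^ DIM('b) * half_sphere_integral F s)"
      unfolding set_lebesgue_integral_def using r by (intro Bochner_Integration.integral_nonneg) (auto simp: indicator_def hs0)
    ultimately show ?thesis using e by (simp only: ennreal_inj)
  qed
  obtain K where K: "0 < K" "\<And>x. x \<in> half_ball 1 \<Longrightarrow> norm (F x) \<le> K" using bounded_continuous_onE[OF F] by blast
  note bK = bounded_continuous_on_const[of "half_ball 1 :: ('b \<times> real) set" K]
  have "(LINT x:half_ball r|lborel. F x + K) = (LINT s:{0<..<r}|lborel. s ^ DIM('b) * half_sphere_integral (\<lambda>x. F x + K) s)"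
    by (rule nonneg_case[OF bounded_continuous_on_add[OF F bK]]) (use K in force)
  also have "\<dots> = (LINT s:{0<..<r}|lborel. s ^ DIM('b) * half_sphere_integral F s + s ^ DIM('b) * half_sphere_integral (\<lambda>x::'b \<times> real. K) s)"
    using r by (intro set_lebesgue_integral_cong) (auto simp: half_sphere_integral_add[OF F bK] distrib_left)
  also have "\<dots> = (LINT s:{0<..<r}|lborel. s ^ DIM('b) * half_sphere_integral F s) + (LINT s:{0<..<r}|lborel. s ^ DIM('b) * half_sphere_integral (\<lambda>x::'b \<times> real. K) s)"
    using r by (intro set_integral_add half_sphere_integral_set_integrable F bK) auto
  also have "(LINT s:{0<..<r}|lborel. s ^ DIM('b) * half_sphere_integral (\<lambda>x::'b \<times> real. K) s) = (LINT x:(half_ball r :: ('b \<times> real) set)|lborel. K)"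
    by (rule nonneg_case[OF bK, symmetric]) (use K in auto)
  finally show ?thesis
    using half_ball_integrable[OF F r(2)] half_ball_integrable[OF bK r(2)] by (subst (asm) set_integral_add) auto
qed

lemma half_ball_integral_has_derivative:
  fixes F :: "'b::euclidean_space \<times> real \<Rightarrow> real"
  assumes F: "bounded_continuous_on (half_ball 1) F" and r: "0 < r" "r < 1"
  shows "((\<lambda>r. LINT x:half_ball r|lborel. F x) has_real_derivative r ^ DIM('b) * half_sphere_integral F r) (at r)"
proof -
  let ?a = "\<lambda>s. s ^ DIM('b) * half_sphere_integral F s"
  \<comment> \<open>The spherical integrals are known to be continuous only on the open interval
    \<open>{0<..<1}\<close>. Starting the radial integral at \<open>c > 0\<close> allows the
    fundamental theorem of calculus on a compact interval; the part below \<open>c\<close> is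
    constant near \<open>r\<close>.\<close>
  define c d where "c = r / 2" and "d = (1 + r) / 2"
  have cd: "0 < c" "c < r" "r < d" "d < 1" using r by (auto simp: c_def d_def)
  have ca: "continuous_on {c..d} ?a"
    using cd by (intro continuous_intros continuous_on_subset[OF half_sphere_integral_continuous[OF F]]) auto
  have eq: "(LINT x:half_ball t|lborel. F x) = (LINT x:half_ball c|lborel. F x) + integral {c..t} ?a" if t: "c \<le> t" "t \<le> d" for t
  proof -
    have "(LINT x:half_ball t|lborel. F x) = (LINT s:{0<..<t}|lborel. ?a s)"
      using t cd by (intro half_ball_polar F) auto
    also have "{0<..<t} = {0<..<c} \<union> {c..<t}" using t cd by auto
    also have "(LINT s:{0<..<c} \<union> {c..<t}|lborel. ?a s) = (LINT s:{0<..<c}|lborel. ?a s) + (LINT s:{c..<t}|lborel. ?a s)"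
      using t cd by (intro set_integral_Un half_sphere_integral_set_integrable F) auto
    also have "(LINT s:{0<..<c}|lborel. ?a s) = (LINT x:half_ball c|lborel. F x)"
      using cd by (intro half_ball_polar[symmetric] F) auto
    also have "(LINT s:{c..<t}|lborel. ?a s) = integral {c..<t} ?a"
      using t cd by (intro set_borel_integral_eq_integral half_sphere_integral_set_integrable F) auto
    also have "integral {c..<t} ?a = integral {c..t} ?a"
      by (rule integral_spike_set; rule negligible_subset[of "{t}"]) auto
    finally show ?thesis .
  qed
  have "((\<lambda>t. integral {c..t} ?a) has_real_derivative ?a r) (at r within {c..d})"
    by (rule integral_has_real_derivative[OF ca]) (use cd in auto)
  moreover have "at r within {c..d} = at r" using cd by (intro at_within_interior) (auto simp: interior_atLeastAtMost_real)
  ultimately have "((\<lambda>t. (LINT x:half_ball c|lborel. F x) + integral {c..t} ?a) has_real_derivative 0 + ?a r) (at r)"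
    by (intro DERIV_add DERIV_const) auto
  then have d': "((\<lambda>t. (LINT x:half_ball c|lborel. F x) + integral {c..t} ?a) has_real_derivative ?a r) (at r)" by simp
  have "eventually (\<lambda>t. t \<in> {c<..<d}) (nhds r)" using cd by (intro eventually_nhds_in_open) auto
  then have "eventually (\<lambda>t. (LINT x:half_ball c|lborel. F x) + integral {c..t} ?a = (LINT x:half_ball t|lborel. F x)) (nhds r)"
    by eventually_elim (rule eq[symmetric]; simp)
  from DERIV_cong_ev[OF refl this refl] d' show ?thesis by blast
qed

lemma measure_half_ball_scale:
  fixes r :: real
  assumes "0 < r"
  shows "measure lborel (half_ball r :: ('b::euclidean_space \<times> real) set) = r ^ DIM('b \<times> real) * measure lborel (half_ball 1 :: ('b \<times> real) set)"
proof -
  let ?n = "DIM('b \<times> real)"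
  have "emeasure lborel (half_ball r :: ('b \<times> real) set) = (\<integral>\<^sup>+x. indicator (half_ball r :: ('b \<times> real) set) x \<partial>lborel)" by simp
  also have "\<dots> = ennreal (\<bar>r\<bar> ^ ?n) * (\<integral>\<^sup>+x. indicator (half_ball r :: ('b \<times> real) set) (0 + r *\<^sub>R x) \<partial>lborel)"
    using assms by (intro nn_integral_lborel_affine) auto
  also have "(\<lambda>x. indicator (half_ball r :: ('b \<times> real) set) (0 + r *\<^sub>R x) :: ennreal) = indicator (half_ball 1)"
    using assms by (auto simp: fun_eq_iff indicator_def mem_half_ball zero_less_mult_iff)
  finally show ?thesis using assms by (simp add: measure_def enn2real_mult)
qed

lemma measure_half_ball_pos:
  "0 < measure lborel (half_ball 1 :: ('b::euclidean_space \<times> real) set)"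
proof -
  have "((0, 1/2) :: 'b \<times> real) \<in> half_ball 1" by (simp add: mem_half_ball norm_Pair)
  then have "\<not> negligible (half_ball 1 :: ('b \<times> real) set)"
    using open_not_negligible[OF open_half_ball] by blast
  then have "emeasure lborel (half_ball 1 :: ('b \<times> real) set) \<noteq> 0"
    by (auto simp: negligible_iff_null_sets intro: null_sets_completionI)
  then show ?thesis
    using emeasure_bounded_finite[OF bounded_half_ball[of "1::real", where 'a='b]]
    by (simp add: measure_def enn2real_positive_iff zero_less_iff_neq_zero)
qed

section \<open>Integration by parts from the weak formulation\<close>

lemma grad_eqI:
  fixes u :: "'a::euclidean_space \<Rightarrow> real"
  assumes "(u has_derivative (\<lambda>h. g \<bullet> h)) (at x)"
  shows "grad u x = g"
  unfolding grad_def
proof (rule the_equality)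
  show "GDERIV u x :> g" using assms by (simp add: gderiv_def inner_commute)
  fix g' assume "GDERIV u x :> g'"
  then have "(u has_derivative (\<lambda>h. g' \<bullet> h)) (at x)" by (simp add: gderiv_def inner_commute)
  then have "(\<lambda>h. g' \<bullet> h) = (\<lambda>h. g \<bullet> h)" using assms by (rule has_derivative_unique)
  then show "g' = g" by (metis inner_eq_zero_iff inner_diff_left right_minus_eq)
qed

text \<open>The open sets \<open>S\<close> and \<open>- K\<close> cover the space. On the second
  both \<open>\<phi>\<close> and \<open>G\<close> vanish, so differentiability and continuity of the
  gradient need checking only on \<open>S\<close>.\<close>

lemma C1_test_functionI:
  fixes \<phi> :: "'a::euclidean_space \<Rightarrow> real"
  assumes S: "open S" and K: "compact K" "K \<subseteq> S"
    and der: "\<And>x. x \<in> S \<Longrightarrow> (\<phi> has_derivative (\<lambda>h. G x \<bullet> h)) (at x)"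
    and cont: "continuous_on S G" and out: "\<And>x. x \<notin> K \<Longrightarrow> \<phi> x = 0" "\<And>x. x \<notin> K \<Longrightarrow> G x = 0"
  shows "C1_test_function \<phi> S \<and> grad \<phi> = G"
proof
  have oK: "open (- K)" using K by (simp add: compact_imp_closed open_Compl)
  have der': "(\<phi> has_derivative (\<lambda>h. G x \<bullet> h)) (at x)" for x
  proof (cases "x \<in> S")
    case False
    then have x: "x \<in> - K" using K by auto
    have "((\<lambda>_. 0) has_derivative (\<lambda>h. G x \<bullet> h)) (at x)" using out(2)[of x] x by simp
    then show ?thesis by (rule has_derivative_transform_within_open[OF _ oK x]) (use out in auto)
  qed (rule der)
  show g: "grad \<phi> = G" using grad_eqI[OF der'] by auto
  have "continuous_on (- K) G" using out(2) by (subst continuous_on_cong[OF refl, of _ G "\<lambda>_. 0"]) auto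
  then have "continuous_on (S \<union> - K) G" using cont S oK by (intro continuous_on_open_Un)
  moreover have "S \<union> - K = UNIV" using K by auto
  ultimately have "continuous_on UNIV (grad \<phi>)" by (simp add: g)
  moreover have "closure {x. \<phi> x \<noteq> 0} \<subseteq> K"
    using out(1) K by (intro closure_minimal compact_imp_closed) auto
  moreover from this have "compact (closure {x. \<phi> x \<noteq> 0})"
    using K by (metis closed_closure compact_Int_closed inf.absorb_iff2)
  ultimately show "C1_test_function \<phi> S"
    using der' K unfolding C1_test_function_def differentiable_def by blast
qed

section \<open>A continuously differentiable cutoff\<close>

definition positive_square :: "real \<Rightarrow> real" where "positive_square t = (max 0 t)\<^sup>2"

lemma positive_square_has_derivative: "(positive_square has_real_derivative 2 * max 0 t) (at t)"
proof -
  consider "t < 0" | "t > 0" | "t = 0" by linarith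
  then show ?thesis
  proof cases
    case 1
    show ?thesis
      by (rule has_field_derivative_transform_within_open[where f="\<lambda>_. 0" and S="{..<0}"])
         (use 1 in \<open>auto simp: positive_square_def max_def\<close>)
  next
    case 2
    show ?thesis
      by (rule has_field_derivative_transform_within_open[where f="\<lambda>t. t\<^sup>2" and S="{0<..}"])
         (use 2 in \<open>auto simp: positive_square_def max_def intro!: derivative_eq_intros\<close>)
  next
    case 3
    have "((\<lambda>h. positive_square h / h) \<longlongrightarrow> 0) (at 0)"
    proof (rule Lim_null_comparison[where g="\<lambda>h. \<bar>h\<bar>"])
      show "\<forall>\<^sub>F h in at 0. norm (positive_square h / h) \<le> \<bar>h\<bar>"
        by (intro always_eventually) (auto simp: positive_square_def max_def power2_eq_square abs_mult)
    qed (intro tendsto_rabs_zero tendsto_ident_at)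
    then show ?thesis using 3 by (simp add: has_field_derivative_iff) (simp add: positive_square_def)
  qed
qed

text \<open>Composing two truncated squares gives a function that is 1 on the negative axis and 0
  beyond 1. It is continuously differentiable with derivative in \<open>{-4..0}\<close>, which is
  enough because the test functions are only required to be of class C^1.\<close>

definition cutoff :: "real \<Rightarrow> real" where "cutoff t = positive_square (1 - positive_square t)"
definition cutoff_deriv :: "real \<Rightarrow> real" where "cutoff_deriv t = - 4 * max 0 (1 - positive_square t) * max 0 t"

lemma cutoff_has_derivative: "(cutoff has_real_derivative cutoff_deriv t) (at t)"
proof -
  have "((\<lambda>t. 1 - positive_square t) has_real_derivative 0 - 2 * max 0 t) (at t)"
    by (intro DERIV_diff positive_square_has_derivative DERIV_const)
  from DERIV_chain2[OF positive_square_has_derivative this]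
  show ?thesis unfolding cutoff_def[abs_def] cutoff_deriv_def by (simp add: algebra_simps)
qed

lemma positive_square_simps: "t \<le> 0 \<Longrightarrow> positive_square t = 0" "1 \<le> t \<Longrightarrow> 1 \<le> positive_square t" "0 \<le> positive_square t"
  by (auto simp: positive_square_def max_def one_le_power)

lemma cutoff_simps: "t \<le> 0 \<Longrightarrow> cutoff t = 1" "1 \<le> t \<Longrightarrow> cutoff t = 0"
  using positive_square_simps(2)[of t] positive_square_simps(1)[of "1 - positive_square t"]
  by (auto simp: cutoff_def positive_square_simps(1)) (simp add: positive_square_def)

lemma cutoff_deriv_simps: "t \<le> 0 \<Longrightarrow> cutoff_deriv t = 0" "1 \<le> t \<Longrightarrow> cutoff_deriv t = 0"
  using positive_square_simps(2)[of t] by (auto simp: cutoff_deriv_def max_def)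

lemma cutoff_range: "0 \<le> cutoff t" "cutoff t \<le> 1"
  by (auto simp: cutoff_def positive_square_def intro!: power_le_one)

lemma cutoff_deriv_range: "cutoff_deriv t \<le> 0" "- 4 \<le> cutoff_deriv t"
proof -
  show "cutoff_deriv t \<le> 0" by (simp add: cutoff_deriv_def)
  have "max 0 (1 - positive_square t) * max 0 t \<le> 1"
  proof (cases "t \<le> 1")
    case True
    then have "max 0 (1 - positive_square t) * max 0 t \<le> 1 * 1" by (intro mult_mono) (auto simp: positive_square_def)
    then show ?thesis by simp
  next
    case False then show ?thesis using positive_square_simps(2)[of t] by (auto simp: max_def)
  qed
  then show "- 4 \<le> cutoff_deriv t" by (simp add: cutoff_deriv_def)
qed

lemma cutoff_continuous: "continuous_on A cutoff" "continuous_on A cutoff_deriv"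
proof -
  have "continuous_on A positive_square" unfolding positive_square_def[abs_def] by (intro continuous_intros)
  then show "continuous_on A cutoff_deriv" unfolding cutoff_deriv_def[abs_def] by (intro continuous_intros)
  show "continuous_on A cutoff"
    by (rule DERIV_continuous_on) (rule has_field_derivative_at_within[OF cutoff_has_derivative])
qed

text \<open>The layer lies in a cylinder of height \<open>e\<close> over the unit ball. This factor
  \<open>e\<close> compensates for the derivative of the cutoff in the last variable, which is of
  size \<open>4 / e\<close>.\<close>

lemma half_ball_layer_measure:
  assumes "0 < e"
  shows "measure lborel {x \<in> half_ball 1 :: ('b \<times> real) set. e \<le> snd x \<and> snd x \<le> 2 * e} \<le> e * measure lborel (ball (0::'b::euclidean_space) 1)"
    (is "measure lborel ?L \<le> _")
proof -
  have fin: "emeasure lborel (ball (0::'b) 1) < \<infinity>" by (intro emeasure_bounded_finite bounded_ball)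
  have sub: "(?L :: ('b \<times> real) set) \<subseteq> ball 0 1 \<times> {e..2*e}"
    by (auto simp: mem_half_ball) (meson norm_fst_le le_less_trans)
  have "emeasure lborel (ball (0::'b) 1 \<times> {e..2*e}) = emeasure lborel (ball (0::'b) 1) * emeasure lborel {e..2*e}"
    unfolding lborel_prod[symmetric] by (intro lborel.emeasure_pair_measure_Times) auto
  also have "\<dots> = ennreal (e * measure lborel (ball (0::'b) 1))"
    using assms fin by (simp add: emeasure_eq_ennreal_measure ennreal_mult[symmetric] mult.commute)
  finally have eq: "emeasure lborel (ball (0::'b) 1 \<times> {e..2*e}) = ennreal (e * measure lborel (ball (0::'b) 1))" .
  have "emeasure lborel (?L :: ('b \<times> real) set) \<le> ennreal (e * measure lborel (ball (0::'b) 1))"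
    unfolding eq[symmetric]
  proof (rule emeasure_mono[OF sub])
    have "ball (0::'b) 1 \<times> {e..2*e} \<in> sets (borel \<Otimes>\<^sub>M borel)" by (intro pair_measureI) auto
    then show "ball (0::'b) 1 \<times> {e..2*e} \<in> sets lborel" unfolding borel_prod by simp
  qed
  then show ?thesis using assms by (simp add: measure_def enn2real_leI)
qed

text \<open>A general field \<open>V\<close> takes the place of a gradient so that the same
  divergence inequality serves both \<open>G\<close> and the sum of \<open>G\<close> with the
  gradient of a dilation.\<close>

definition weak_divergence :: "('b::euclidean_space \<times> real \<Rightarrow> 'b \<times> real) \<Rightarrow> ('b \<times> real \<Rightarrow> real) \<Rightarrow> bool" where
  "weak_divergence V F \<longleftrightarrow> (\<forall>\<phi>. C1_test_function \<phi> (half_ball 1) \<longrightarrow>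
     (LINT x:half_ball 1|lborel. V x \<bullet> grad \<phi> x) = - (LINT x:half_ball 1|lborel. F x * \<phi> x))"

lemma bounded_measurable_mult_integrable:
  fixes F :: "'b::euclidean_space \<times> real \<Rightarrow> real"
  assumes [measurable]: "F \<in> borel_measurable borel" and F: "\<And>x. x \<in> half_ball 1 \<Longrightarrow> \<bar>F x\<bar> \<le> K"
    and G: "bounded_continuous_on (half_ball 1) G" and r: "r \<le> 1"
  shows "set_integrable lborel (half_ball r) (\<lambda>x. F x * G x)"
proof -
  obtain L where L: "0 < L" "\<And>x. x \<in> half_ball 1 \<Longrightarrow> norm (G x) \<le> L" using bounded_continuous_onE[OF G] by blast
  have "(\<lambda>x. indicator (half_ball r) x *\<^sub>R G x) \<in> borel_measurable borel"
    using half_ball_integrable[OF G r] by (auto simp: set_integrable_def)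
  then have "(\<lambda>x. F x * (indicator (half_ball r) x *\<^sub>R G x)) \<in> borel_measurable borel" by measurable
  then have m: "set_borel_measurable lborel (half_ball r) (\<lambda>x. F x * G x)"
    by (simp add: set_borel_measurable_def mult_ac)
  show ?thesis
  proof (rule set_integrable_bounded[OF bounded_half_ball half_ball_borel m])
    fix x :: "'b \<times> real" assume "x \<in> half_ball r"
    then have "x \<in> half_ball 1" using half_ball_mono[OF r] by blast
    then show "\<bar>F x * G x\<bar> \<le> K * L" using F[of x] L(2)[of x] unfolding abs_mult
      by (intro mult_mono) auto
  qed
qed

text \<open>The setting for testing the equation of \<open>V\<close> with a multiplier
  \<open>w\<close>: formally, the integral of \<open>V \<bullet> Gw + F * w\<close> is the outward
  flux of \<open>w V\<close>. The choices used below are \<open>u\<close>, \<open>- u\<close>, the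
  constant -1 and a difference quotient of \<open>u\<close> along dilations.\<close>

locale weak_pair =
  fixes V :: "'b::euclidean_space \<times> real \<Rightarrow> 'b \<times> real" and F w :: "'b \<times> real \<Rightarrow> real" and Gw :: "'b \<times> real \<Rightarrow> 'b \<times> real" and KF :: real
  assumes weak: "weak_divergence V F" and V: "bounded_continuous_on (half_ball 1) V"
    and F: "F \<in> borel_measurable borel" "\<And>x. x \<in> half_ball 1 \<Longrightarrow> \<bar>F x\<bar> \<le> KF"
    and w: "bounded_continuous_on (half_ball 1) w" and Gw: "bounded_continuous_on (half_ball 1) Gw"
    and der: "\<And>x. x \<in> half_ball 1 \<Longrightarrow> (w has_derivative (\<lambda>h. Gw x \<bullet> h)) (at x)"
begin

text \<open>Test functions vanish near the flat part of the boundary. The additional cutoff in the last variable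
  costs a term that lives on a layer of width \<open>e\<close> and is at most \<open>4 c / e\<close> there.\<close>

lemma weak_cutoff:
  assumes p: "\<And>t. (p has_real_derivative p' t) (at t)" "continuous_on UNIV p'"
    and supp: "\<And>t. \<rho>\<^sup>2 \<le> t \<Longrightarrow> p t = 0" "\<And>t. \<rho>\<^sup>2 \<le> t \<Longrightarrow> p' t = 0" and \<rho>: "0 < \<rho>" "\<rho> < 1"
    and range: "\<And>t. 0 \<le> p t" "\<And>t. p t \<le> 1" and c: "0 \<le> c" "0 < t0"
    and near: "\<And>x. x \<in> half_ball 1 \<Longrightarrow> norm x \<le> \<rho> \<Longrightarrow> snd x < t0 \<Longrightarrow> - c \<le> w x * snd (V x)"
  shows "(LINT x:half_ball 1|lborel. p (x \<bullet> x) * (V x \<bullet> Gw x) + 2 * p' (x \<bullet> x) * w x * (V x \<bullet> x) + F x * (p (x \<bullet> x) * w x))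
      \<le> 4 * c * measure lborel (ball (0::'b) 1)"
proof -
  let ?H = "half_ball 1 :: ('b \<times> real) set"
  let ?A = "\<lambda>x. p (x \<bullet> x) * (V x \<bullet> Gw x) + 2 * p' (x \<bullet> x) * w x * (V x \<bullet> x)"
  let ?B = "\<lambda>x. F x * (p (x \<bullet> x) * w x)"
  let ?L = "measure lborel (ball (0::'b) 1)"
  have cp: "continuous_on UNIV p" by (rule DERIV_continuous_on) (use p(1) in auto)
  have bid: "bounded_continuous_on ?H (\<lambda>x. x)" by (rule bounded_continuous_on_id[OF bounded_half_ball])
  note bxx = bounded_continuous_on_inner_self
  have bA: "bounded_continuous_on ?H ?A"
    by (intro bounded_continuous_intros bxx cp p(2) V Gw w bid)
  have bpw: "bounded_continuous_on ?H (\<lambda>x. p (x \<bullet> x) * w x)" by (intro bounded_continuous_intros bxx cp w)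
  have iA: "set_integrable lborel ?H ?A" by (rule half_ball_integrable[OF bA]) simp
  have iB: "set_integrable lborel ?H ?B" by (rule bounded_measurable_mult_integrable[OF F bpw]) auto
  obtain KA where KA: "0 < KA" "\<And>x. x \<in> ?H \<Longrightarrow> norm (?A x) \<le> KA" using bounded_continuous_onE[OF bA] by blast
  obtain Kw where Kw: "0 < Kw" "\<And>x. x \<in> ?H \<Longrightarrow> norm (p (x \<bullet> x) * w x) \<le> Kw" using bounded_continuous_onE[OF bpw] by blast
  \<comment> \<open>This factor is 0 for \<open>snd x \<le> e\<close> and 1 for
    \<open>2 * e \<le> snd x\<close>, so it makes the support compact inside the half ball and tends
    to 1 pointwise as \<open>e\<close> tends to 0.\<close>
  define z where "z e x = 1 - cutoff (snd x / e - 1)" for e :: real and x :: "'b \<times> real"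
  define z' where "z' e x = - cutoff_deriv (snd x / e - 1) / e" for e :: real and x :: "'b \<times> real"
  have bz: "bounded_continuous_on ?H (z e)" "bounded_continuous_on ?H (z' e)" if e: "0 < e" for e
  proof -
    have c: "continuous_on ?H (\<lambda>x. snd x / e - 1)" using e by (intro continuous_intros) auto
    show "bounded_continuous_on ?H (z e)"
    proof (rule bounded_continuous_onI[where K=1])
      show "continuous_on ?H (z e)" unfolding z_def
        by (intro continuous_intros continuous_on_compose2[OF cutoff_continuous(1) c]) auto
      show "norm (z e x) \<le> 1" for x using cutoff_range[of "snd x / e - 1"] by (simp add: z_def)
    qed
    show "bounded_continuous_on ?H (z' e)"
    proof (rule bounded_continuous_onI[where K="4/e"])
      show "continuous_on ?H (z' e)" unfolding z'_def using e
        by (intro continuous_intros continuous_on_compose2[OF cutoff_continuous(2) c]) auto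
      show "norm (z' e x) \<le> 4 / e" for x
        using cutoff_deriv_range[of "snd x / e - 1"] e by (simp add: z'_def divide_simps abs_le_iff)
    qed
  qed
  have main: "(LINT x:?H|lborel. z e x * (?A x + ?B x)) \<le> 4 * c * ?L" if e: "0 < e" "2 * e < t0" for e
  proof -
    define G where "G x = (if x \<in> ?H then z e x *\<^sub>R (p (x \<bullet> x) *\<^sub>R Gw x + (2 * p' (x \<bullet> x) * w x) *\<^sub>R x) + (z' e x * (p (x \<bullet> x) * w x)) *\<^sub>R (0, 1) else 0)" for x
    define \<phi> where "\<phi> x = (if x \<in> ?H then z e x * (p (x \<bullet> x) * w x) else 0)" for x
    define K :: "('b \<times> real) set" where "K = {x. norm x \<le> \<rho>} \<inter> {x. e \<le> snd x}"
    have zs: "z e x = 0" "z' e x = 0" if "snd x \<le> e" for x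
      using that e cutoff_simps(1)[of "snd x / e - 1"] cutoff_deriv_simps(1)[of "snd x / e - 1"] by (auto simp: z_def z'_def field_simps)
    have ps: "p (x \<bullet> x) = 0" "p' (x \<bullet> x) = 0" if "\<rho> \<le> norm x" for x :: "'b \<times> real"
      using that \<rho> supp[of "x \<bullet> x"] by (auto simp: dot_square_norm power_mono)
    have "C1_test_function \<phi> ?H \<and> grad \<phi> = G"
    proof (rule C1_test_functionI[OF open_half_ball, of K])
      have "K = cball 0 \<rho> \<inter> {x. e \<le> snd x}" by (auto simp: K_def)
      then show "compact K" by (simp add: compact_Int_closed closed_Collect_le continuous_on_snd)
      show "K \<subseteq> ?H" using \<rho> e by (auto simp: K_def mem_half_ball)
      show "\<phi> x = 0" "G x = 0" if "x \<notin> K" for x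
        using that zs[of x] ps[of x] by (auto simp: K_def \<phi>_def G_def not_le zero_prod_def)
      have "continuous_on ?H (\<lambda>x. z e x *\<^sub>R (p (x \<bullet> x) *\<^sub>R Gw x + (2 * p' (x \<bullet> x) * w x) *\<^sub>R x) + (z' e x * (p (x \<bullet> x) * w x)) *\<^sub>R ((0::'b), 1::real))"
        by (intro bounded_continuous_onD bounded_continuous_intros bz bxx cp p(2) w Gw bid e)
      then show "continuous_on ?H G" by (rule continuous_on_eq) (simp add: G_def)
      fix x assume x: "x \<in> ?H"
      have dz: "((\<lambda>x. z e x) has_derivative (\<lambda>h. z' e x * snd h)) (at x)"
      proof -
        have "((\<lambda>x::'b \<times> real. snd x / e - 1) has_derivative (\<lambda>h. snd h / e)) (at x)"
          using e by (auto intro!: derivative_eq_intros simp: field_simps)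
        from DERIV_compose_FDERIV[OF cutoff_has_derivative this]
        have "((\<lambda>x::'b \<times> real. cutoff (snd x / e - 1)) has_derivative (\<lambda>h. snd h / e * cutoff_deriv (snd x / e - 1))) (at x)" .
        from has_derivative_diff[OF has_derivative_const[of 1] this]
        show ?thesis unfolding z_def z'_def by (simp add: mult.commute)
      qed
      have dp: "((\<lambda>x. p (x \<bullet> x)) has_derivative (\<lambda>h. 2 * (x \<bullet> h) * p' (x \<bullet> x))) (at x)"
      proof -
        have "((\<lambda>x. x \<bullet> x) has_derivative (\<lambda>h. 2 * (x \<bullet> h))) (at x)"
          by (auto intro!: derivative_eq_intros simp: inner_commute)
        from DERIV_compose_FDERIV[OF p(1) this] show ?thesis .
      qed
      from has_derivative_mult[OF dz has_derivative_mult[OF dp der[OF x]]]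
      have "((\<lambda>x. z e x * (p (x \<bullet> x) * w x)) has_derivative (\<lambda>h. G x \<bullet> h)) (at x)"
        using x by (simp add: G_def inner_add_left inner_Pair algebra_simps prod_eq_iff)
           (simp add: inner_prod_def algebra_simps)
      then show "(\<phi> has_derivative (\<lambda>h. G x \<bullet> h)) (at x)"
        by (rule has_derivative_transform_within_open[OF _ open_half_ball x]) (simp add: \<phi>_def)
    qed
    then have t: "C1_test_function \<phi> ?H" "grad \<phi> = G" by auto
    \<comment> \<open>This is the part of \<open>V \<bullet> grad \<phi>\<close> that comes from
      differentiating the cutoff in the last variable. A bound from below suffices, as only an
      inequality is claimed.\<close>
    let ?C = "\<lambda>x. z' e x * (p (x \<bullet> x) * (w x * snd (V x)))"
    have bC: "bounded_continuous_on ?H ?C" by (intro bounded_continuous_intros bz bxx cp w V e)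
    have bzA: "bounded_continuous_on ?H (\<lambda>x. z e x * ?A x)" by (intro bounded_continuous_on_mult bz bA e)
    have bzpw: "bounded_continuous_on ?H (\<lambda>x. z e x * (p (x \<bullet> x) * w x))" by (intro bounded_continuous_on_mult bz bpw e)
    have izB: "set_integrable lborel ?H (\<lambda>x. F x * (z e x * (p (x \<bullet> x) * w x)))"
      by (rule bounded_measurable_mult_integrable[OF F bzpw]) auto
    have "(LINT x:?H|lborel. z e x * ?A x + ?C x) = (LINT x:?H|lborel. V x \<bullet> grad \<phi> x)"
      unfolding t(2)
    proof (rule set_lebesgue_integral_cong)
      show "\<forall>x. x \<in> ?H \<longrightarrow> z e x * ?A x + ?C x = V x \<bullet> G x"
        by (auto simp: G_def inner_add_right algebra_simps inner_prod_def)
    qed simp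
    also have "\<dots> = - (LINT x:?H|lborel. F x * \<phi> x)"
      using weak t(1) by (auto simp: weak_divergence_def)
    also have "(LINT x:?H|lborel. F x * \<phi> x) = (LINT x:?H|lborel. F x * (z e x * (p (x \<bullet> x) * w x)))"
      by (intro set_lebesgue_integral_cong) (auto simp: \<phi>_def)
    finally have eq: "(LINT x:?H|lborel. z e x * ?A x + ?C x) = - (LINT x:?H|lborel. F x * (z e x * (p (x \<bullet> x) * w x)))" .
    have "(LINT x:?H|lborel. z e x * (?A x + ?B x)) = (LINT x:?H|lborel. z e x * ?A x + F x * (z e x * (p (x \<bullet> x) * w x)))"
      by (intro set_lebesgue_integral_cong) (auto simp: algebra_simps)
    also have "\<dots> = (LINT x:?H|lborel. z e x * ?A x) + (LINT x:?H|lborel. F x * (z e x * (p (x \<bullet> x) * w x)))"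
      by (intro set_integral_add izB half_ball_integrable[OF bzA]) simp
    also have "\<dots> = - (LINT x:?H|lborel. ?C x)"
      using eq set_integral_add(2)[OF half_ball_integrable[OF bzA order_refl] half_ball_integrable[OF bC order_refl]] by linarith
    also have "\<dots> \<le> 4 * c * ?L"
    proof -
      \<comment> \<open>Outside this layer \<open>z'\<close> is zero. Inside it \<open>?C\<close> is
        at least \<open>- (4 * c / e)\<close>, by \<open>z' \<le> 4 / e\<close>,
        \<open>p \<le> 1\<close> and the flux hypothesis; the layer has measure at most
        \<open>e * ?L\<close>, so the width cancels.\<close>
      let ?S = "{x \<in> ?H. e \<le> snd x \<and> snd x \<le> 2 * e}"
      have Sm: "?S \<in> sets borel"
      proof -
        have "?S = ?H \<inter> ({x. e \<le> snd x} \<inter> {x. snd x \<le> 2 * e})" by auto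
        moreover have "closed ({x::'b \<times> real. e \<le> snd x} \<inter> {x. snd x \<le> 2 * e})"
          by (intro closed_Int closed_Collect_le continuous_intros)
        ultimately show ?thesis by simp
      qed
      have fin: "emeasure lborel ?S < \<infinity>" by (intro emeasure_bounded_finite bounded_subset[OF bounded_half_ball[of 1]]) auto
      have "- (4 * c / e) * measure lborel ?S = (LINT x:?H|lborel. indicator ?S x *\<^sub>R (- (4 * c / e)))"
      proof -
        have "(LINT x:?H|lborel. indicator ?S x *\<^sub>R (- (4 * c / e))) = (LINT x|lborel. indicator ?S x *\<^sub>R (- (4 * c / e)))"
          unfolding set_lebesgue_integral_def by (intro Bochner_Integration.integral_cong) (auto simp: indicator_def)
        also have "\<dots> = measure lborel ?S *\<^sub>R (- (4 * c / e))"
          using Sm fin by (subst integral_scaleR_left) (auto simp: integrable_indicator_iff)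
        finally show ?thesis by simp
      qed
      also have "\<dots> \<le> (LINT x:?H|lborel. ?C x)"
      proof (rule set_integral_mono)
        show "set_integrable lborel ?H (\<lambda>x. indicator ?S x *\<^sub>R (- (4 * c / e)))"
        proof -
          have eqf: "(\<lambda>x. indicator ?H x *\<^sub>R (indicator ?S x *\<^sub>R (- (4 * c / e)))) = (\<lambda>x. indicator ?S x *\<^sub>R (- (4 * c / e)))"
            by (auto simp: fun_eq_iff indicator_def)
          show ?thesis unfolding set_integrable_def eqf
            using Sm fin by (intro integrable_scaleR_left integrable_real_indicator) auto
        qed
        show "set_integrable lborel ?H ?C" by (rule half_ball_integrable[OF bC]) simp
        fix x assume x: "x \<in> ?H"
        have z'0: "0 \<le> z' e x" "z' e x \<le> 4 / e"
          using cutoff_deriv_range[of "snd x / e - 1"] e by (auto simp: z'_def divide_simps)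
        show "indicator ?S x *\<^sub>R (- (4 * c / e)) \<le> ?C x"
        proof (cases "x \<in> ?S \<and> norm x \<le> \<rho>")
          case True
          have "- c \<le> w x * snd (V x)" using near[OF x] True e by auto
          then have "- (w x * snd (V x)) \<le> c" by simp
          have A0: "0 \<le> z' e x * p (x \<bullet> x)" using z'0 range[of "x \<bullet> x"] by simp
          have A1: "z' e x * p (x \<bullet> x) \<le> (4 / e) * 1"
            using z'0 range[of "x \<bullet> x"] e by (intro mult_mono) auto
          from mult_left_mono[OF \<open>- (w x * snd (V x)) \<le> c\<close> A0] mult_right_mono[OF A1 c(1)]
          have "z' e x * p (x \<bullet> x) * - (w x * snd (V x)) \<le> (4 / e) * 1 * c" by linarith
          then show ?thesis using True by (simp add: mult_ac)
        next
          case False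
          have "?C x = 0"
          proof (cases "x \<in> ?S")
            case True then show ?thesis using False ps(1)[of x] by auto
          next
            case False
            then have "snd x \<le> e \<or> 2 * e < snd x" using x by auto
            then have "z' e x = 0"
            proof
              assume "2 * e < snd x"
              then have "1 \<le> snd x / e - 1" using e by (simp add: field_simps)
              then show ?thesis using cutoff_deriv_simps(2) by (simp add: z'_def)
            qed (rule zs)
            then show ?thesis by simp
          qed
          moreover have "indicator ?S x *\<^sub>R (- (4 * c / e)) \<le> 0" using c e by (auto simp: indicator_def)
          ultimately show ?thesis by linarith
        qed
      qed
      finally have "- (LINT x:?H|lborel. ?C x) \<le> (4 * c / e) * measure lborel ?S" by simp
      also have "\<dots> \<le> (4 * c / e) * (e * ?L)"
        using c e by (intro mult_left_mono half_ball_layer_measure) auto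
      also have "\<dots> = 4 * c * ?L" using e by simp
      finally show ?thesis .
    qed
    finally show ?thesis .
  qed
  \<comment> \<open>The factor 1/3 gives \<open>2 * X i < t0\<close>, so each layer lies where the
    flux hypothesis is available.\<close>
  define X where "X i = t0 / 3 * inverse (real (Suc i))" for i
  have X: "0 < X i" "2 * X i < t0" for i using c(2) by (auto simp: X_def field_simps)
     (smt (verit) c(2) mult_nonneg_nonneg of_nat_0_le_iff)
  have X0: "X \<longlonglongrightarrow> 0" unfolding X_def by (rule tendsto_mult_right_zero[OF LIMSEQ_inverse_real_of_nat])
  have lim: "(\<lambda>i. LINT x:?H|lborel. z (X i) x * (?A x + ?B x)) \<longlonglongrightarrow> (LINT x:?H|lborel. ?A x + ?B x)"
  proof (rule ray_set_integral_tendsto[OF _ _ _ _ bounded_half_ball half_ball_borel])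
    have mAB: "(\<lambda>x. indicator ?H x *\<^sub>R (?A x + ?B x)) \<in> borel_measurable borel"
      using set_integral_add(1)[OF iA iB] by (auto simp: set_integrable_def)
    then show "set_borel_measurable lborel ?H (\<lambda>x. ?A x + ?B x)" by (simp add: set_borel_measurable_def)
    show "set_borel_measurable lborel ?H (\<lambda>x. z (X i) x * (?A x + ?B x))" for i
    proof -
      have "(\<lambda>x. indicator ?H x *\<^sub>R z (X i) x) \<in> borel_measurable borel"
        using bounded_continuous_on_set_borel_measurable[OF bz(1)[OF X(1)] half_ball_borel] by (simp add: set_borel_measurable_def)
      then have "(\<lambda>x. (indicator ?H x *\<^sub>R z (X i) x) * (indicator ?H x *\<^sub>R (?A x + ?B x))) \<in> borel_measurable borel"
        using mAB by (rule borel_measurable_times)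
      also have "(\<lambda>x. (indicator ?H x *\<^sub>R z (X i) x) * (indicator ?H x *\<^sub>R (?A x + ?B x))) = (\<lambda>x. indicator ?H x *\<^sub>R (z (X i) x * (?A x + ?B x)))"
        by (auto simp: fun_eq_iff indicator_def)
      finally show ?thesis by (simp add: set_borel_measurable_def)
    qed
    fix x assume x: "x \<in> ?H"
    then have sx: "0 < snd x" by (simp add: mem_half_ball)
    have "eventually (\<lambda>i. X i < snd x / 2) sequentially" using X0 sx by (intro order_tendstoD(2)[OF X0]) auto
    then have "eventually (\<lambda>i. z (X i) x * (?A x + ?B x) = ?A x + ?B x) sequentially"
    proof eventually_elim
      fix i assume "X i < snd x / 2"
      then have "1 \<le> snd x / X i - 1" using X(1)[of i] by (simp add: field_simps)
      then show "z (X i) x * (?A x + ?B x) = ?A x + ?B x" by (simp add: z_def cutoff_simps)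
    qed
    then show "(\<lambda>i. z (X i) x * (?A x + ?B x)) \<longlonglongrightarrow> ?A x + ?B x" by (rule tendsto_eventually)
    have z1: "\<bar>z (X i) x\<bar> \<le> 1" for i using cutoff_range[of "snd x / X i - 1"] by (auto simp: z_def)
    have "\<bar>?B x\<bar> \<le> KF * Kw" using F(2)[OF x] Kw(2)[OF x] unfolding abs_mult by (intro mult_mono) auto
    then have "\<bar>?A x + ?B x\<bar> \<le> KA + KF * Kw" using KA(2)[OF x] by simp
    then have "\<bar>z (X i) x\<bar> * \<bar>?A x + ?B x\<bar> \<le> 1 * (KA + KF * Kw)" for i using z1 by (intro mult_mono) auto
    then show "\<bar>z (X i) x * (?A x + ?B x)\<bar> \<le> KA + KF * Kw" for i by (simp add: abs_mult)
  qed
  show ?thesis by (rule LIMSEQ_le_const2[OF lim]) (use main X in auto)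
qed

text \<open>The hypothesis on \<open>snd (V x)\<close> controls the flux through the flat part of the boundary.\<close>

lemma half_ball_divergence:
  assumes r: "0 < r" "r < 1" and c: "0 \<le> c" "0 < t0"
    and near: "\<And>x. x \<in> half_ball 1 \<Longrightarrow> norm x \<le> r \<Longrightarrow> snd x < t0 \<Longrightarrow> - c \<le> w x * snd (V x)"
  shows "(LINT x:half_ball r|lborel. V x \<bullet> Gw x + F x * w x)
     \<le> r ^ DIM('b) * half_sphere_integral (\<lambda>x. w x * (V x \<bullet> (x /\<^sub>R norm x))) r + 4 * c * measure lborel (ball (0::'b) 1)"
proof (rule field_le_epsilon)
  fix e :: real assume e: "0 < e"
  let ?H = "half_ball 1 :: ('b \<times> real) set"
  let ?L = "measure lborel (ball (0::'b) 1)"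
  let ?S = "half_sphere_integral (\<lambda>x. w x * (V x \<bullet> (x /\<^sub>R norm x)))"
  let ?a = "\<lambda>s. s ^ DIM('b) * ?S s"
  have bnu: "bounded_continuous_on ?H (\<lambda>x. w x * (V x \<bullet> (x /\<^sub>R norm x)))"
    by (intro bounded_continuous_on_mult bounded_continuous_on_inner w V bounded_continuous_on_sgn) (simp add: mem_half_ball)
  have ca: "isCont ?a r"
  proof -
    have "continuous_on {0<..<1} ?a" by (intro continuous_intros half_sphere_integral_continuous[OF bnu])
    then show ?thesis using r by (simp add: continuous_on_eq_continuous_at)
  qed
  then have "\<exists>d>0. \<forall>s. dist s r < d \<longrightarrow> dist (?a s) (?a r) < e"
    using e unfolding continuous_at_eps_delta by blast
  then obtain d where d: "d > 0" "\<And>s. \<bar>s - r\<bar> < d \<Longrightarrow> \<bar>?a s - ?a r\<bar> < e"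
    unfolding dist_real_def by blast
  \<comment> \<open>\<open>D i\<close> is the width of the cutoff in the variable
    \<open>norm x ^ 2\<close>. The bound \<open>r * d\<close> keeps the transition shell within
    distance \<open>d\<close> of the sphere, where \<open>?a\<close> differs from its value at
    \<open>r\<close> by less than \<open>e\<close>; the bound \<open>r\<^sup>2\<close> ensures
    \<open>p i 0 = 1\<close>.\<close>
  define D where "D i = r * (min r d) * inverse (real (Suc i))" for i
  have Dpos: "0 < D i" "D i \<le> r * d" "D i \<le> r\<^sup>2" for i
  proof -
    have i: "inverse (real (Suc i)) \<le> 1" by (simp add: field_simps)
    show "0 < D i" using r d by (simp add: D_def)
    have "D i \<le> r * min r d * 1" unfolding D_def using r d i by (intro mult_left_mono) auto
    moreover have "r * min r d \<le> r * d" "r * min r d \<le> r * r" using r by (auto intro: mult_left_mono)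
    ultimately show "D i \<le> r * d" "D i \<le> r\<^sup>2" by (auto simp: power2_eq_square)
  qed
  have D0: "D \<longlonglongrightarrow> 0" unfolding D_def by (rule tendsto_mult_right_zero[OF LIMSEQ_inverse_real_of_nat])
  define p where "p i t = cutoff ((t - (r\<^sup>2 - D i)) / D i)" for i t
  define p' where "p' i t = cutoff_deriv ((t - (r\<^sup>2 - D i)) / D i) / D i" for i t
  have dp: "(p i has_real_derivative p' i t) (at t)" for i t
  proof -
    have "((\<lambda>t. (t - (r\<^sup>2 - D i)) / D i) has_real_derivative 1 / D i) (at t)"
      using Dpos(1)[of i] by (auto intro!: derivative_eq_intros)
    from DERIV_chain2[OF cutoff_has_derivative this] show ?thesis by (simp add: p_def[abs_def] p'_def)
  qed
  have cp': "continuous_on A (p' i)" for i A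
    unfolding p'_def[abs_def] using Dpos(1)[of i]
    by (intro continuous_intros continuous_on_compose2[OF cutoff_continuous(2)[of UNIV]]) auto
  have cp: "continuous_on A (p i)" for i A
    by (rule DERIV_continuous_on) (rule has_field_derivative_at_within[OF dp])
  have supp: "p i t = 0" "p' i t = 0" if "r\<^sup>2 \<le> t" for i t
  proof -
    have "1 \<le> (t - (r\<^sup>2 - D i)) / D i" using that Dpos(1)[of i] by (simp add: le_divide_eq)
    then show "p i t = 0" "p' i t = 0" by (simp_all add: p_def p'_def cutoff_simps cutoff_deriv_simps)
  qed
  have pin: "p i t = 1" "p' i t = 0" if "t \<le> r\<^sup>2 - D i" for i t
  proof -
    have "(t - (r\<^sup>2 - D i)) / D i \<le> 0" using that Dpos(1)[of i] by (simp add: divide_le_0_iff)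
    then show "p i t = 1" "p' i t = 0" by (simp_all add: p_def p'_def cutoff_simps cutoff_deriv_simps)
  qed
  have p01: "0 \<le> p i t" "p i t \<le> 1" "p' i t \<le> 0" for i t
    using cutoff_range cutoff_deriv_range Dpos(1)[of i] by (auto simp: p_def p'_def divide_nonpos_pos)
  have bVG: "bounded_continuous_on ?H (\<lambda>x. V x \<bullet> Gw x)" by (intro bounded_continuous_intros V Gw)
  note bq = bounded_continuous_on_inner_self
  have iVG: "set_integrable lborel ?H (\<lambda>x. V x \<bullet> Gw x)" "set_integrable lborel ?H (\<lambda>x. F x * w x)"
    by (auto intro!: half_ball_integrable bVG bounded_measurable_mult_integrable[OF F w])
  let ?E = "\<lambda>x. V x \<bullet> Gw x + F x * w x"
  have iE: "set_integrable lborel ?H ?E" by (intro set_integral_add iVG)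
  obtain KV where KV: "0 < KV" "\<And>x. x \<in> ?H \<Longrightarrow> norm (V x \<bullet> Gw x) \<le> KV" using bounded_continuous_onE[OF bVG] by blast
  obtain Kw where Kw: "0 < Kw" "\<And>x. x \<in> ?H \<Longrightarrow> norm (w x) \<le> Kw" using bounded_continuous_onE[OF w] by blast
  have step: "(LINT x:?H|lborel. p i (x \<bullet> x) * ?E x) \<le> ?a r + e + 4 * c * ?L" for i
  proof -
    let ?G = "\<lambda>x. 2 * p' i (x \<bullet> x) * w x * (V x \<bullet> x)"
    have bpVG: "bounded_continuous_on ?H (\<lambda>x. p i (x \<bullet> x) * (V x \<bullet> Gw x))"
      and bpw: "bounded_continuous_on ?H (\<lambda>x. p i (x \<bullet> x) * w x)"
      and bG: "bounded_continuous_on ?H ?G"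
      by (intro bounded_continuous_intros bq cp cp' V Gw w bounded_continuous_on_id bounded_half_ball)+
    have ii: "set_integrable lborel ?H (\<lambda>x. p i (x \<bullet> x) * (V x \<bullet> Gw x))" "set_integrable lborel ?H ?G"
      "set_integrable lborel ?H (\<lambda>x. F x * (p i (x \<bullet> x) * w x))"
      by (auto intro!: half_ball_integrable bpVG bG bounded_measurable_mult_integrable[OF F bpw])
    have "(LINT x:?H|lborel. p i (x \<bullet> x) * (V x \<bullet> Gw x) + ?G x + F x * (p i (x \<bullet> x) * w x)) \<le> 4 * c * ?L"
      by (rule weak_cutoff[OF dp cp' supp r p01(1,2) c near]) auto
    moreover have "(LINT x:?H|lborel. p i (x \<bullet> x) * (V x \<bullet> Gw x) + ?G x + F x * (p i (x \<bullet> x) * w x))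
       = (LINT x:?H|lborel. p i (x \<bullet> x) * (V x \<bullet> Gw x)) + (LINT x:?H|lborel. ?G x) + (LINT x:?H|lborel. F x * (p i (x \<bullet> x) * w x))"
      using ii by (simp add: set_integral_add)
    moreover have "(LINT x:?H|lborel. p i (x \<bullet> x) * ?E x) = (LINT x:?H|lborel. p i (x \<bullet> x) * (V x \<bullet> Gw x)) + (LINT x:?H|lborel. F x * (p i (x \<bullet> x) * w x))"
      by (subst set_integral_add(2)[symmetric, OF ii(1,3)]) (simp add: algebra_simps)
    moreover have "- (?a r + e) \<le> (LINT x:?H|lborel. ?G x)"
    proof -
      \<comment> \<open>\<open>?b\<close> is the derivative of \<open>p i (s\<^sup>2)\<close>:
        nonpositive, with integral -1 and supported in the transition shell. In polar coordinates
        the integral of \<open>?G\<close> is therefore minus a weighted average of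
        \<open>?a\<close>, hence at least \<open>- (?a r + e)\<close>.\<close>
      let ?b = "\<lambda>s. 2 * s * p' i (s\<^sup>2)"
      have eqb: "s ^ DIM('b) * half_sphere_integral ?G s = ?b s * ?a s" if "s \<in> {0<..<1}" for s
      proof -
        have "half_sphere_integral ?G s = half_sphere_integral (\<lambda>x. ?b s * (w x * (V x \<bullet> (x /\<^sub>R norm x)))) s"
          using that by (intro half_sphere_integral_cong) (auto simp: dot_square_norm)
        also have "\<dots> = ?b s * ?S s" by (rule half_sphere_integral_cmult)
        finally show ?thesis by (simp only: mult.left_commute)
      qed
      have ibc: "set_integrable lborel {0<..<1} (\<lambda>s. ?b s * k)" for k
      proof (rule set_integrable_subset)
        show "set_integrable lborel {0..1} (\<lambda>s. ?b s * k)"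
          by (intro borel_integrable_atLeastAtMost' continuous_intros continuous_on_compose2[OF cp'[of UNIV]]) auto
      qed auto
      have "((\<lambda>s. p i (s\<^sup>2)) has_real_derivative ?b s) (at s within {0..1})" for s
      proof -
        have "((\<lambda>s::real. s\<^sup>2) has_real_derivative 2 * s) (at s)" by (auto intro!: derivative_eq_intros)
        from has_field_derivative_at_within[OF DERIV_chain2[OF dp[of i "s\<^sup>2"] this]] show ?thesis
          by (simp add: mult_ac)
      qed
      then have "(?b has_integral p i (1\<^sup>2) - p i (0\<^sup>2)) {0..1}"
        by (intro fundamental_theorem_of_calculus) (auto simp: has_real_derivative_iff_has_vector_derivative[symmetric])
      moreover have "p i (1\<^sup>2) = 0" "p i (0\<^sup>2) = 1"
        using supp(1)[of 1] pin(1)[of 0 i] Dpos(3)[of i] r by (auto simp: power_le_one)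
      ultimately have "(?b has_integral -1) {0<..<1}" by (simp add: has_integral_Icc_iff_Ioo)
      then have b1: "(LINT s:{0<..<1}|lborel. ?b s) = -1"
        using set_borel_integral_eq_integral(2)[OF ibc[of 1]] by (simp add: integral_unique)
      have "- (?a r + e) = (LINT s:{0<..<1}|lborel. ?b s * (?a r + e))"
        using b1 by simp
      also have "\<dots> \<le> (LINT s:{0<..<1}|lborel. s ^ DIM('b) * half_sphere_integral ?G s)"
      proof (rule set_integral_mono[OF ibc half_sphere_integral_set_integrable[OF bG]])
        fix s :: real assume s: "s \<in> {0<..<1}"
        show "?b s * (?a r + e) \<le> s ^ DIM('b) * half_sphere_integral ?G s"
        proof (cases "r\<^sup>2 - D i < s\<^sup>2 \<and> s\<^sup>2 < r\<^sup>2")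
          case True
          then have "s < r" using r s by (simp add: power_less_imp_less_base[of s 2 r])
          have "(r - s) * r \<le> (r - s) * (r + s)" using \<open>s < r\<close> s by (intro mult_left_mono) auto
          also have "\<dots> < D i" using True by (simp add: power2_eq_square algebra_simps)
          also have "\<dots> \<le> d * r" using Dpos(2)[of i] by (simp add: mult.commute)
          finally have "r - s < d" using r by simp
          then have "?a s \<le> ?a r + e" using d(2)[of s] \<open>s < r\<close> by (simp add: abs_less_iff)
          moreover have "?b s \<le> 0" using p01(3)[of i "s\<^sup>2"] s by (simp add: mult_nonneg_nonpos)
          ultimately have "?b s * (?a r + e) \<le> ?b s * ?a s" by (rule mult_left_mono_neg)
          then show ?thesis unfolding eqb[OF s] .
        next
          case False
          then have "p' i (s\<^sup>2) = 0" using supp(2)[of "s\<^sup>2" i] pin(2)[of "s\<^sup>2" i] by force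
          then show ?thesis unfolding eqb[OF s] by simp
        qed
      qed auto
      also have "\<dots> = (LINT x:?H|lborel. ?G x)" by (rule half_ball_polar[OF bG, symmetric]) auto
      finally show ?thesis .
    qed
    ultimately show ?thesis by linarith
  qed
  have "(\<lambda>i. LINT x:?H|lborel. p i (x \<bullet> x) * ?E x) \<longlonglongrightarrow> (LINT x:?H|lborel. indicator (half_ball r) x * ?E x)"
  proof (rule ray_set_integral_tendsto[OF _ _ _ _ bounded_half_ball half_ball_borel])
    have mE: "(\<lambda>x. indicator ?H x *\<^sub>R ?E x) \<in> borel_measurable borel" using iE by (auto simp: set_integrable_def)
    have "(\<lambda>x. indicator (half_ball r) x * (indicator ?H x *\<^sub>R ?E x)) \<in> borel_measurable borel"
      using mE by measurable
    then show "set_borel_measurable lborel ?H (\<lambda>x. indicator (half_ball r) x * ?E x)"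
      by (simp add: set_borel_measurable_def mult_ac)
    show "set_borel_measurable lborel ?H (\<lambda>x. p i (x \<bullet> x) * ?E x)" for i
    proof -
      have [measurable]: "p i \<in> borel_measurable borel" using borel_measurable_continuous_onI[OF cp] .
      have "(\<lambda>x. p i (x \<bullet> x) * (indicator ?H x *\<^sub>R ?E x)) \<in> borel_measurable borel"
        using mE by measurable
      then show ?thesis by (simp add: set_borel_measurable_def mult_ac)
    qed
    fix x assume x: "x \<in> ?H"
    show "(\<lambda>i. p i (x \<bullet> x) * ?E x) \<longlonglongrightarrow> indicator (half_ball r) x * ?E x"
    proof (cases "norm x < r")
      case True
      then have "x \<bullet> x < r\<^sup>2" using r by (simp add: dot_square_norm power_strict_mono)
      then have "eventually (\<lambda>i. D i < r\<^sup>2 - x \<bullet> x) sequentially" by (intro order_tendstoD(2)[OF D0]) simp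
      then have "eventually (\<lambda>i. p i (x \<bullet> x) * ?E x = indicator (half_ball r) x * ?E x) sequentially"
        by eventually_elim (use True x in \<open>simp add: pin mem_half_ball\<close>)
      then show ?thesis by (rule tendsto_eventually)
    next
      case False
      then have "r\<^sup>2 \<le> x \<bullet> x" using r by (simp add: dot_square_norm power_mono)
      then show ?thesis using False supp by (simp add: mem_half_ball)
    qed
    have "\<bar>F x * w x\<bar> \<le> KF * Kw" using F(2)[OF x] Kw(2)[OF x] unfolding abs_mult by (intro mult_mono) auto
    then have "\<bar>?E x\<bar> \<le> KV + KF * Kw" using KV(2)[OF x] by simp
    then have "\<bar>p i (x \<bullet> x)\<bar> * \<bar>?E x\<bar> \<le> 1 * (KV + KF * Kw)" for i using p01[of i] by (intro mult_mono) auto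
    then show "\<bar>p i (x \<bullet> x) * ?E x\<bar> \<le> KV + KF * Kw" for i by (simp add: abs_mult)
  qed
  then have "(LINT x:?H|lborel. indicator (half_ball r) x * ?E x) \<le> ?a r + e + 4 * c * ?L"
    by (rule LIMSEQ_le_const2) (use step in auto)
  moreover have "(LINT x:?H|lborel. indicator (half_ball r) x * ?E x) = (LINT x:half_ball r|lborel. ?E x)"
    using half_ball_mono[of r 1, where 'a='b] r unfolding set_lebesgue_integral_def
    by (intro Bochner_Integration.integral_cong) (auto simp: indicator_def)
  ultimately show "(LINT x:half_ball r|lborel. ?E x) \<le> ?a r + 4 * c * ?L + e" by simp
qed

end

section \<open>Energy and Rellich identities\<close>

lemma lborel_integral_affine:
  fixes g :: "'a::euclidean_space \<Rightarrow> real" and c :: real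
  assumes [measurable]: "g \<in> borel_measurable borel" and c: "c \<noteq> 0"
  shows "(LINT x|lborel. g x) = \<bar>c\<bar> ^ DIM('a) * (LINT x|lborel. g (t + c *\<^sub>R x))"
  by (subst lborel_affine[OF c, of t]) (simp add: integral_density integral_distr)

lemma has_derivative_grad:
  fixes u :: "'a::euclidean_space \<Rightarrow> real"
  assumes "u differentiable (at x)"
  shows "(u has_derivative (\<lambda>h. grad u x \<bullet> h)) (at x)"
proof -
  obtain u' where u': "(u has_derivative u') (at x)" using assms by (auto simp: differentiable_def)
  then interpret bounded_linear u' by (rule has_derivative_bounded_linear)
  define g where "g = (\<Sum>b\<in>Basis. u' b *\<^sub>R b)"
  have "u' h = g \<bullet> h" for h
  proof -
    have "u' h = u' (\<Sum>b\<in>Basis. (h \<bullet> b) *\<^sub>R b)" by (simp add: euclidean_representation)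
    also have "\<dots> = (\<Sum>b\<in>Basis. (h \<bullet> b) * u' b)" by (simp add: sum scaleR)
    also have "\<dots> = g \<bullet> h" unfolding g_def by (simp add: inner_sum_left inner_commute[of h] mult.commute)
    finally show ?thesis .
  qed
  then have "u' = (\<lambda>h. g \<bullet> h)" by (rule ext)
  with u' have d: "(u has_derivative (\<lambda>h. g \<bullet> h)) (at x)" by simp
  show ?thesis unfolding grad_eqI[OF d] by (rule d)
qed

lemma C1_test_function_facts:
  fixes \<phi> :: "'a::euclidean_space \<Rightarrow> real"
  assumes "C1_test_function \<phi> S"
  obtains K where "compact K" "K \<subseteq> S" "\<And>x. x \<notin> K \<Longrightarrow> \<phi> x = 0" "\<And>x. x \<notin> K \<Longrightarrow> grad \<phi> x = 0"
    "\<And>x. (\<phi> has_derivative (\<lambda>h. grad \<phi> x \<bullet> h)) (at x)" "bounded_continuous_on UNIV \<phi>" "bounded_continuous_on UNIV (grad \<phi>)"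
proof
  let ?K = "closure {x. \<phi> x \<noteq> 0}"
  show K: "compact ?K" "?K \<subseteq> S" using assms by (auto simp: C1_test_function_def)
  show d: "(\<phi> has_derivative (\<lambda>h. grad \<phi> x \<bullet> h)) (at x)" for x
    using assms by (intro has_derivative_grad) (auto simp: C1_test_function_def)
  show z: "\<phi> x = 0" if "x \<notin> ?K" for x using that closure_subset[of "{x. \<phi> x \<noteq> 0}"] by auto
  show zg: "grad \<phi> x = 0" if "x \<notin> ?K" for x
  proof (rule grad_eqI)
    have "((\<lambda>_. 0) has_derivative (\<lambda>h. 0 \<bullet> h)) (at x)" unfolding inner_zero_left by (rule has_derivative_const)
    moreover have "open (- ?K)" by (simp add: open_Compl)
    moreover have "x \<in> - ?K" using that by simp
    moreover have "0 = \<phi> y" if "y \<in> - ?K" for y using z[of y] that by simp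
    ultimately show "(\<phi> has_derivative (\<lambda>h. 0 \<bullet> h)) (at x)"
      by (rule has_derivative_transform_within_open)
  qed
  have bc: "bounded_continuous_on UNIV g" if "continuous_on UNIV g" "\<And>x. x \<notin> ?K \<Longrightarrow> g x = 0" for g :: "'a \<Rightarrow> 'c::real_normed_vector"
  proof -
    have "bounded (g ` ?K)"
      by (rule compact_imp_bounded[OF compact_continuous_image[OF continuous_on_subset[OF that(1) subset_UNIV] K(1)]])
    then obtain L where L: "\<And>x. x \<in> ?K \<Longrightarrow> norm (g x) \<le> L" by (auto simp: bounded_iff)
    show ?thesis
    proof (rule bounded_continuous_onI[OF that(1), where K="max L 0"])
      show "norm (g x) \<le> max L 0" for x using L[of x] that(2)[of x] by (cases "x \<in> ?K") auto
    qed
  qed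
  have "continuous_on UNIV \<phi>" by (intro continuous_at_imp_continuous_on ballI) (rule has_derivative_continuous[OF d])
  then show "bounded_continuous_on UNIV \<phi>" using bc z by blast
  show "bounded_continuous_on UNIV (grad \<phi>)" using bc[OF _ zg] assms by (auto simp: C1_test_function_def)
qed

definition upper_ball :: "('b::euclidean_space \<times> real) set" where
  "upper_ball = {x. norm x < 1 \<and> 0 \<le> snd x}"

lemma half_ball_subset_upper_ball: "half_ball 1 \<subseteq> upper_ball"
  by (auto simp: upper_ball_def mem_half_ball)

lemma convex_half_ball: "convex (half_ball r :: ('b::euclidean_space \<times> real) set)"
proof -
  have "half_ball r = ball 0 r \<inter> {x::'b \<times> real. 0 < (0, 1) \<bullet> x}" by (auto simp: half_ball_def)
  then show ?thesis by (simp add: convex_Int convex_halfspace_gt del: inner_Pair)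
qed

text \<open>The points of the closed half ball of radius \<open>r\<close> where
  \<open>b \<le> - c\<close> form a compact set that misses the flat part. Its lowest point has
  positive height, which serves as \<open>t0\<close>.\<close>

lemma lower_bound_near_flat:
  fixes b :: "'b::euclidean_space \<times> real \<Rightarrow> real"
  assumes cont: "continuous_on upper_ball b" and r: "r < 1"
    and flat: "\<And>x. norm x \<le> r \<Longrightarrow> snd x = 0 \<Longrightarrow> - c < b x"
  shows "\<exists>t0>0. \<forall>x\<in>half_ball 1. norm x \<le> r \<longrightarrow> snd x < t0 \<longrightarrow> - c \<le> b x"
proof -
  define K where "K = cball 0 r \<inter> {x::'b \<times> real. 0 \<le> snd x}"
  have K: "compact K" unfolding K_def by (intro compact_Int_closed compact_cball closed_Collect_le continuous_intros)
  have Ku: "K \<subseteq> upper_ball" using r by (auto simp: K_def upper_ball_def)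
  define B where "B = K \<inter> b -` {..-c}"
  have "closed B" unfolding B_def
    using K Ku cont by (intro continuous_closed_preimage compact_imp_closed closed_atMost) (auto intro: continuous_on_subset)
  then have B: "compact B" using K by (metis B_def compact_Int_closed inf.absorb_iff2 inf_le1)
  show ?thesis
  proof (cases "B = {}")
    case True
    then have "- c \<le> b x" if "x \<in> half_ball 1" "norm x \<le> r" for x
      using that by (force simp: B_def K_def mem_half_ball)
    then show ?thesis by (intro exI[of _ 1]) auto
  next
    case False
    have "continuous_on B snd" by (intro continuous_intros)
    then obtain y where y: "y \<in> B" "\<And>x. x \<in> B \<Longrightarrow> snd y \<le> snd x"
      using continuous_attains_inf[OF B False] by blast
    have "snd y \<noteq> 0" using flat[of y] y(1) by (force simp: B_def K_def)
    then have "snd y > 0" using y(1) by (auto simp: B_def K_def less_le)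
    moreover have "- c \<le> b x" if "x \<in> half_ball 1" "norm x \<le> r" "snd x < snd y" for x
      using that y(2)[of x] by (force simp: B_def K_def mem_half_ball)
    ultimately show ?thesis by blast
  qed
qed

lemma le_if_le_add_small_multiple:
  fixes a b L :: real
  assumes "\<And>c. 0 < c \<Longrightarrow> a \<le> b + 4 * c * L" and L: "0 \<le> L"
  shows "a \<le> b"
proof (rule field_le_epsilon)
  fix e :: real assume e: "0 < e"
  define X where "X = L + 1"
  define c where "c = e / (4 * X)"
  have "0 < X" using L by (simp add: X_def)
  then have c: "0 < c" "4 * c * X = e" using e by (auto simp: c_def)
  have "4 * c * L \<le> e" using c by (simp add: X_def algebra_simps)
  then show "a \<le> b + e" using assms(1)[OF c(1)] by linarith
qed

text \<open>The flux through the flat part is bounded below by \<open>- c\<close> for every positive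
  \<open>c\<close>, so the error \<open>4 * c\<close> times the measure of the base ball
  disappears.\<close>

lemma (in weak_pair) half_ball_divergence_le:
  assumes r: "0 < r" "r < 1"
    and near: "\<And>c. 0 < c \<Longrightarrow> \<exists>t0>0. \<forall>x\<in>half_ball 1. norm x \<le> r \<longrightarrow> snd x < t0 \<longrightarrow> - c \<le> w x * snd (V x)"
  shows "(LINT x:half_ball r|lborel. V x \<bullet> Gw x + F x * w x)
     \<le> r ^ DIM('b) * half_sphere_integral (\<lambda>x. w x * (V x \<bullet> (x /\<^sub>R norm x))) r"
proof (rule le_if_le_add_small_multiple)
  fix c :: real assume c: "0 < c"
  obtain t0 where "t0 > 0" "\<And>x. x \<in> half_ball 1 \<Longrightarrow> norm x \<le> r \<Longrightarrow> snd x < t0 \<Longrightarrow> - c \<le> w x * snd (V x)"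
    using near[OF c] by blast
  from half_ball_divergence[OF r less_imp_le[OF c] this]
  show "(LINT x:half_ball r|lborel. V x \<bullet> Gw x + F x * w x) \<le> r ^ DIM('b) * half_sphere_integral (\<lambda>x. w x * (V x \<bullet> (x /\<^sub>R norm x))) r
     + 4 * c * measure lborel (ball (0::'b) 1)" .
qed simp

lemma half_sphere_integral_tendsto:
  fixes q :: "nat \<Rightarrow> 'b::euclidean_space \<times> real \<Rightarrow> real"
  assumes "\<And>i. bounded_continuous_on (half_ball 1) (q i)" "bounded_continuous_on (half_ball 1) Q"
    and "\<And>x. x \<in> half_ball 1 \<Longrightarrow> (\<lambda>i. q i x) \<longlonglongrightarrow> Q x" and "\<And>i x. x \<in> half_ball 1 \<Longrightarrow> \<bar>q i x\<bar> \<le> K"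
    and s: "0 < s" "s < 1"
  shows "(\<lambda>i. half_sphere_integral (q i) s) \<longlonglongrightarrow> half_sphere_integral Q s"
  unfolding half_sphere_integral_def
proof (rule tendsto_mult_left, rule ray_set_integral_tendsto[OF _ _ _ _ bounded_half_ball half_ball_borel])
  show "set_borel_measurable lborel (half_ball 1) (\<lambda>z. q i ((s / norm z) *\<^sub>R z))" for i
    by (intro bounded_continuous_on_set_borel_measurable ray_bounded_continuous assms) simp
  show "set_borel_measurable lborel (half_ball 1) (\<lambda>z. Q ((s / norm z) *\<^sub>R z))"
    by (intro bounded_continuous_on_set_borel_measurable ray_bounded_continuous assms) simp
  fix z :: "'b \<times> real" assume z: "z \<in> half_ball 1"
  from ray_in_half_ball[OF this s]
  show "(\<lambda>i. q i ((s / norm z) *\<^sub>R z)) \<longlonglongrightarrow> Q ((s / norm z) *\<^sub>R z)" "\<bar>q i ((s / norm z) *\<^sub>R z)\<bar> \<le> K" for i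
    using assms(3,4) by blast+
qed

text \<open>Pointwise data extracted from the class. \<open>G\<close> is the gradient extended
  continuously to the flat part, where \<open>snd (G x)\<close> is the normal derivative, and the
  bound for \<open>f\<close> holds everywhere instead of almost everywhere. The free boundary point
  at the origin enters as \<open>u 0 = 0\<close>.\<close>

locale signorini_solution =
  fixes u :: "'b::euclidean_space \<times> real \<Rightarrow> real" and G :: "'b \<times> real \<Rightarrow> 'b \<times> real" and f :: "'b \<times> real \<Rightarrow> real"
    and M :: real and k :: nat
  assumes M: "0 < M"
    and der: "\<And>x. x \<in> upper_ball \<Longrightarrow> (u has_derivative (\<lambda>h. G x \<bullet> h)) (at x within upper_ball)"
    and contG: "continuous_on upper_ball G"
    and bound_u: "\<And>x. x \<in> half_ball 1 \<Longrightarrow> \<bar>u x\<bar> \<le> M" and bound_G: "\<And>x. x \<in> half_ball 1 \<Longrightarrow> norm (G x) \<le> M"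
    and weak: "weak_divergence G f"
    and f: "f \<in> borel_measurable borel" and bound_f: "\<And>x. x \<in> half_ball 1 \<Longrightarrow> \<bar>f x\<bar> \<le> M * norm (fst x) ^ (k - 1)"
    and flat: "\<And>x. norm x < 1 \<Longrightarrow> snd x = 0 \<Longrightarrow> 0 \<le> u x" "\<And>x. norm x < 1 \<Longrightarrow> snd x = 0 \<Longrightarrow> snd (G x) \<le> 0"
      "\<And>x. norm x < 1 \<Longrightarrow> snd x = 0 \<Longrightarrow> u x * snd (G x) = 0"
    and u0: "u 0 = 0"
begin

abbreviation "H \<equiv> half_ball 1 :: ('b \<times> real) set"

definition D :: "real \<Rightarrow> real" where "D r = (LINT x:half_ball r|lborel. G x \<bullet> G x)"

lemma cont_u: "continuous_on upper_ball u"
  by (rule has_derivative_continuous_on) (rule der)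

lemma der_at:
  assumes x: "x \<in> H"
  shows "(u has_derivative (\<lambda>h. G x \<bullet> h)) (at x)"
proof -
  have "x \<in> upper_ball" using x half_ball_subset_upper_ball by blast
  from has_derivative_subset[OF der[OF this] half_ball_subset_upper_ball]
  show ?thesis by (simp add: at_within_open[OF x open_half_ball])
qed

lemma bc_u: "bounded_continuous_on H u" and bc_G: "bounded_continuous_on H G"
  using cont_u contG half_ball_subset_upper_ball bound_u bound_G
  by (auto intro!: bounded_continuous_onI[where K=M] intro: continuous_on_subset)

lemma bound_f': "x \<in> half_ball r \<Longrightarrow> r \<le> 1 \<Longrightarrow> \<bar>f x\<bar> \<le> M * r ^ (k - 1)"
proof -
  assume x: "x \<in> half_ball r" and r: "r \<le> 1"
  then have "x \<in> H" by (auto simp: mem_half_ball)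
  have "norm (fst x) \<le> r" using norm_fst_le[of "fst x" "snd x"] x by (simp add: mem_half_ball)
  then have "M * norm (fst x) ^ (k - 1) \<le> M * r ^ (k - 1)" using M by (intro mult_left_mono power_mono) auto
  then show ?thesis using bound_f[OF \<open>x \<in> H\<close>] by linarith
qed

lemma bound_f1: "x \<in> H \<Longrightarrow> \<bar>f x\<bar> \<le> M" using bound_f'[of x 1] by simp

text \<open>On the flat part \<open>u\<close> is nonnegative, so a zero is a minimum along every
  tangential line and the derivative in that direction vanishes.\<close>

lemma flat_tangential_grad:
  assumes x: "norm x < 1" "snd x = 0" and u: "u x = 0" and v: "snd v = 0"
  shows "G x \<bullet> v = 0"
proof -
  define e where "e = (1 - norm x) / (1 + norm v)"
  have n1: "0 < 1 + norm v" using norm_ge_zero[of v] by linarith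
  then have e: "0 < e" using x by (simp add: e_def)
  have ball: "norm (x + t *\<^sub>R v) < 1" if "\<bar>t\<bar> < e" for t
  proof -
    have "\<bar>t\<bar> * norm v \<le> \<bar>t\<bar> * (1 + norm v)" by (intro mult_left_mono) auto
    also have "\<dots> < e * (1 + norm v)" using that n1 by (intro mult_strict_right_mono) auto
    also have "\<dots> = 1 - norm x" using n1 by (simp add: e_def)
    finally show ?thesis using norm_triangle_ineq[of x "t *\<^sub>R v"] by simp
  qed
  have m: "x + t *\<^sub>R v \<in> upper_ball" if "\<bar>t\<bar> < e" for t using ball[OF that] x v by (simp add: upper_ball_def)
  let ?I = "{-e<..<e}"
  have "((\<lambda>t. x + t *\<^sub>R v) has_derivative (\<lambda>t. t *\<^sub>R v)) (at 0 within ?I)"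
    by (auto intro!: derivative_eq_intros)
  then have "((\<lambda>t. u (x + t *\<^sub>R v)) has_derivative (\<lambda>t. G x \<bullet> (t *\<^sub>R v))) (at 0 within ?I)"
    using has_derivative_in_compose2[where g=u and g'="\<lambda>y h. G y \<bullet> h" and t=upper_ball and f="\<lambda>t. x + t *\<^sub>R v" and s="?I" and x=0 and f'="\<lambda>t. t *\<^sub>R v"]
      der m[unfolded abs_less_iff] e \<open>((\<lambda>t. x + t *\<^sub>R v) has_derivative (\<lambda>t. t *\<^sub>R v)) (at 0 within ?I)\<close>
    by (simp add: image_subset_iff minus_less_iff)
  then have "((\<lambda>t. u (x + t *\<^sub>R v)) has_real_derivative G x \<bullet> v) (at 0 within ?I)"
    by (simp add: has_field_derivative_def mult_commute_abs)
  moreover have "at 0 within ?I = at 0" using e by (intro at_within_open) auto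
  ultimately have "((\<lambda>t. u (x + t *\<^sub>R v)) has_real_derivative G x \<bullet> v) (at 0)" by simp
  then show ?thesis
  proof (rule DERIV_local_min[OF _ e])
    show "\<forall>y. \<bar>0 - y\<bar> < e \<longrightarrow> u (x + 0 *\<^sub>R v) \<le> u (x + y *\<^sub>R v)"
      using u flat(1) ball x v by auto
  qed
qed

lemma weak_pair_u: "weak_pair G f u G M"
  by unfold_locales (use weak bc_G f bound_f1 bc_u der_at in auto)

text \<open>Complementarity makes \<open>u x * snd (G x)\<close> vanish on the flat part, so the
  divergence inequality applies to the multiplier \<open>u\<close> as well as to \<open>- u\<close>.
  Together they give equality.\<close>

lemma energy_identity:
  assumes r: "0 < r" "r < 1"
  shows "r ^ DIM('b) * half_sphere_integral (\<lambda>x. u x * (G x \<bullet> (x /\<^sub>R norm x))) r = D r + (LINT x:half_ball r|lborel. f x * u x)"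
proof -
  interpret p: weak_pair G f u G M by (rule weak_pair_u)
  interpret q: weak_pair G f "\<lambda>x. - u x" "\<lambda>x. - G x" M
    by unfold_locales (use weak bc_G f bound_f1 bc_u der_at has_derivative_minus[OF der_at] in \<open>auto intro: bounded_continuous_on_minus\<close>)
  have c: "continuous_on upper_ball (\<lambda>x. u x * snd (G x))" by (intro continuous_intros cont_u contG)
  then have c': "continuous_on upper_ball (\<lambda>x. - u x * snd (G x))" by (simp add: continuous_on_minus)
  have flat3: "u x * snd (G x) = 0" if "norm x \<le> r" "snd x = 0" for x using flat(3)[of x] that r by simp
  have *: "(LINT x:half_ball r|lborel. G x \<bullet> G x + f x * u x) = D r + (LINT x:half_ball r|lborel. f x * u x)"
    unfolding D_def using r
    by (intro set_integral_add half_ball_integrable bounded_measurable_mult_integrable[OF f bound_f1 bc_u] bounded_continuous_on_inner bc_G) auto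
  have "(LINT x:half_ball r|lborel. G x \<bullet> G x + f x * u x) \<le> r ^ DIM('b) * half_sphere_integral (\<lambda>x. u x * (G x \<bullet> (x /\<^sub>R norm x))) r"
    by (rule p.half_ball_divergence_le[OF r lower_bound_near_flat[OF c r(2)]]) (simp add: flat3)
  moreover have "(LINT x:half_ball r|lborel. G x \<bullet> - G x + f x * - u x) \<le> r ^ DIM('b) * half_sphere_integral (\<lambda>x. - u x * (G x \<bullet> (x /\<^sub>R norm x))) r"
    by (rule q.half_ball_divergence_le[OF r lower_bound_near_flat[OF c' r(2)]]) (simp add: flat3)
  moreover have "(LINT x:half_ball r|lborel. G x \<bullet> - G x + f x * - u x) = - (LINT x:half_ball r|lborel. G x \<bullet> G x + f x * u x)"
    unfolding set_lebesgue_integral_def by (simp add: Bochner_Integration.integral_minus[symmetric] algebra_simps del: Bochner_Integration.integral_minus)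
  moreover have "half_sphere_integral (\<lambda>x. - u x * (G x \<bullet> (x /\<^sub>R norm x))) r = - half_sphere_integral (\<lambda>x. u x * (G x \<bullet> (x /\<^sub>R norm x))) r"
    using half_sphere_integral_cmult[of "-1" "\<lambda>x. u x * (G x \<bullet> (x /\<^sub>R norm x))" r] by simp
  ultimately show ?thesis using * by simp
qed

text \<open>The multiplier -1 is admissible because \<open>snd (G x) \<le> 0\<close> on the flat
  part. The inequality expresses that the even reflection is superharmonic up to the right-hand
  side.\<close>

lemma flux_le:
  assumes r: "0 < r" "r < 1"
  shows "r ^ DIM('b) * half_sphere_integral (\<lambda>x. G x \<bullet> (x /\<^sub>R norm x)) r \<le> (LINT x:half_ball r|lborel. f x)"
proof -
  interpret q: weak_pair G f "\<lambda>x. - 1" "\<lambda>x. 0" M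
    by unfold_locales (use weak bc_G f bound_f1 in \<open>auto intro: bounded_continuous_on_const\<close>)
  have "(LINT x:half_ball r|lborel. G x \<bullet> 0 + f x * - 1) \<le> r ^ DIM('b) * half_sphere_integral (\<lambda>x. - 1 * (G x \<bullet> (x /\<^sub>R norm x))) r"
  proof (rule q.half_ball_divergence_le[OF r lower_bound_near_flat[OF _ r(2)]])
    show "continuous_on upper_ball (\<lambda>x. - 1 * snd (G x))" by (intro continuous_intros contG)
    fix c :: real and x :: "'b \<times> real" assume "0 < c" "norm x \<le> r" "snd x = 0"
    then show "- c < - 1 * snd (G x)" using flat(2)[of x] r by simp
  qed
  moreover have "(LINT x:half_ball r|lborel. G x \<bullet> 0 + f x * - 1) = - (LINT x:half_ball r|lborel. f x)"
    unfolding set_lebesgue_integral_def by (simp add: Bochner_Integration.integral_minus[symmetric] del: Bochner_Integration.integral_minus)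
  ultimately show ?thesis unfolding half_sphere_integral_cmult by simp
qed

section \<open>Dilations and the Rellich identity\<close>

lemma weak_divergence_dilation:
  assumes l: "0 < l" "l < 1"
  shows "weak_divergence (\<lambda>x. l *\<^sub>R G (l *\<^sub>R x)) (\<lambda>x. l\<^sup>2 * f (l *\<^sub>R x))"
  unfolding weak_divergence_def
proof (intro allI impI)
  fix \<phi> assume "C1_test_function \<phi> H"
  then obtain K where K: "compact K" "K \<subseteq> H" "\<And>x. x \<notin> K \<Longrightarrow> \<phi> x = 0" "\<And>x. x \<notin> K \<Longrightarrow> grad \<phi> x = 0"
    and d\<phi>: "\<And>x. (\<phi> has_derivative (\<lambda>h. grad \<phi> x \<bullet> h)) (at x)" and b\<phi>: "bounded_continuous_on UNIV \<phi>" "bounded_continuous_on UNIV (grad \<phi>)"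
    by (rule C1_test_function_facts) blast
  let ?n = "DIM('b \<times> real)"
  have lH: "l *\<^sub>R x \<in> H" if "x \<in> H" for x using scale_mem_half_ball[OF that l] .
  have outK: "x \<notin> K" if "x \<notin> H" for x using that K(2) by blast
  \<comment> \<open>Rescaling the test function instead of the solution keeps the support
    admissible: it becomes \<open>l\<close> times \<open>K\<close>, which stays in the half ball for
    \<open>l < 1\<close>. The change of variables gives the same factor
    \<open>l ^ ?n / l\<^sup>2\<close> on both sides.\<close>
  define \<psi> where "\<psi> y = \<phi> ((1 / l) *\<^sub>R y)" for y
  have "C1_test_function \<psi> H \<and> grad \<psi> = (\<lambda>y. (1 / l) *\<^sub>R grad \<phi> ((1 / l) *\<^sub>R y))"
  proof (rule C1_test_functionI[OF open_half_ball])
    show "compact ((*\<^sub>R) l ` K)" by (rule compact_scaling[OF K(1)])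
    show "(*\<^sub>R) l ` K \<subseteq> H" using K(2) lH by auto
    show "continuous_on H (\<lambda>y. (1 / l) *\<^sub>R grad \<phi> ((1 / l) *\<^sub>R y))"
      by (intro continuous_intros continuous_on_compose2[OF bounded_continuous_onD[OF b\<phi>(2)]]) auto
    have "(1 / l) *\<^sub>R x \<notin> K" if "x \<notin> (*\<^sub>R) l ` K" for x
    proof
      assume "(1 / l) *\<^sub>R x \<in> K"
      then have "l *\<^sub>R ((1 / l) *\<^sub>R x) \<in> (*\<^sub>R) l ` K" by blast
      then show False using that l by simp
    qed
    then show "\<psi> x = 0" "(1 / l) *\<^sub>R grad \<phi> ((1 / l) *\<^sub>R x) = 0" if "x \<notin> (*\<^sub>R) l ` K" for x
      using that K by (auto simp: \<psi>_def)
    show "(\<psi> has_derivative (\<lambda>h. (1 / l) *\<^sub>R grad \<phi> ((1 / l) *\<^sub>R x) \<bullet> h)) (at x)" for x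
    proof -
      have "((\<lambda>y. (1 / l) *\<^sub>R y) has_derivative (\<lambda>h. (1 / l) *\<^sub>R h)) (at x)" by (auto intro!: derivative_eq_intros)
      from has_derivative_compose[OF this d\<phi>] show ?thesis by (simp add: \<psi>_def[abs_def])
    qed
  qed
  then have "(LINT y:H|lborel. G y \<bullet> ((1 / l) *\<^sub>R grad \<phi> ((1 / l) *\<^sub>R y))) = - (LINT y:H|lborel. f y * \<psi> y)"
    using weak unfolding weak_divergence_def by metis
  moreover have "(LINT y:H|lborel. G y \<bullet> ((1 / l) *\<^sub>R grad \<phi> ((1 / l) *\<^sub>R y))) = l ^ ?n * (1 / l\<^sup>2 * (LINT x:H|lborel. (l *\<^sub>R G (l *\<^sub>R x)) \<bullet> grad \<phi> x))"
  proof -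
    let ?g = "\<lambda>y. indicator H y *\<^sub>R (G y \<bullet> ((1 / l) *\<^sub>R grad \<phi> ((1 / l) *\<^sub>R y)))"
    have "bounded_continuous_on H (\<lambda>y. grad \<phi> ((1 / l) *\<^sub>R y))"
      by (rule bounded_continuous_on_compose[OF b\<phi>(2)]) (auto intro!: continuous_intros)
    then have "bounded_continuous_on H (\<lambda>y. G y \<bullet> ((1 / l) *\<^sub>R grad \<phi> ((1 / l) *\<^sub>R y)))"
      by (intro bounded_continuous_on_inner bc_G bounded_continuous_on_scaleR bounded_continuous_on_const)
    from bounded_continuous_on_set_borel_measurable[OF this half_ball_borel]
    have "?g \<in> borel_measurable borel" by (simp add: set_borel_measurable_def)
    then have "(LINT y|lborel. ?g y) = \<bar>l\<bar> ^ ?n * (LINT x|lborel. ?g (0 + l *\<^sub>R x))" using l by (intro lborel_integral_affine) auto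
    also have "(LINT x|lborel. ?g (0 + l *\<^sub>R x)) = (LINT x|lborel. 1 / l\<^sup>2 * (indicator H x *\<^sub>R ((l *\<^sub>R G (l *\<^sub>R x)) \<bullet> grad \<phi> x)))"
    proof (rule Bochner_Integration.integral_cong[OF refl])
      fix x
      have "?g (0 + l *\<^sub>R x) = (if x \<in> H then 1 / l * (G (l *\<^sub>R x) \<bullet> grad \<phi> x) else 0)"
        using lH[of x] l outK[of x] K(4)[of x] by (cases "x \<in> H") (auto simp: indicator_def)
      also have "\<dots> = 1 / l\<^sup>2 * (indicator H x *\<^sub>R ((l *\<^sub>R G (l *\<^sub>R x)) \<bullet> grad \<phi> x))"
        using l by (simp add: indicator_def power2_eq_square)
      finally show "?g (0 + l *\<^sub>R x) = 1 / l\<^sup>2 * (indicator H x *\<^sub>R ((l *\<^sub>R G (l *\<^sub>R x)) \<bullet> grad \<phi> x))" .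
    qed
    also have "\<dots> = 1 / l\<^sup>2 * (LINT x:H|lborel. (l *\<^sub>R G (l *\<^sub>R x)) \<bullet> grad \<phi> x)"
      unfolding set_lebesgue_integral_def by (rule integral_mult_right_zero)
    finally show ?thesis unfolding set_lebesgue_integral_def using l by simp
  qed
  moreover have "(LINT y:H|lborel. f y * \<psi> y) = l ^ ?n * (1 / l\<^sup>2 * (LINT x:H|lborel. (l\<^sup>2 * f (l *\<^sub>R x)) * \<phi> x))"
  proof -
    let ?g = "\<lambda>y. indicator H y *\<^sub>R (f y * \<psi> y)"
    have m\<phi>[measurable]: "\<phi> \<in> borel_measurable borel" using borel_measurable_continuous_onI[OF bounded_continuous_onD[OF b\<phi>(1)]] .
    have "?g \<in> borel_measurable borel" unfolding \<psi>_def using f by measurable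
    then have "(LINT y|lborel. ?g y) = \<bar>l\<bar> ^ ?n * (LINT x|lborel. ?g (0 + l *\<^sub>R x))" using l by (intro lborel_integral_affine) auto
    also have "(LINT x|lborel. ?g (0 + l *\<^sub>R x)) = (LINT x|lborel. 1 / l\<^sup>2 * (indicator H x *\<^sub>R ((l\<^sup>2 * f (l *\<^sub>R x)) * \<phi> x)))"
    proof (rule Bochner_Integration.integral_cong[OF refl])
      fix x
      show "?g (0 + l *\<^sub>R x) = 1 / l\<^sup>2 * (indicator H x *\<^sub>R ((l\<^sup>2 * f (l *\<^sub>R x)) * \<phi> x))"
        using lH[of x] l outK[of x] K(3)[of x] by (cases "x \<in> H") (auto simp: indicator_def \<psi>_def)
    qed
    also have "\<dots> = 1 / l\<^sup>2 * (LINT x:H|lborel. (l\<^sup>2 * f (l *\<^sub>R x)) * \<phi> x)"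
      unfolding set_lebesgue_integral_def by (rule integral_mult_right_zero)
    finally show ?thesis unfolding set_lebesgue_integral_def using l by simp
  qed
  ultimately have "l ^ ?n * (1 / l\<^sup>2 * (LINT x:H|lborel. (l *\<^sub>R G (l *\<^sub>R x)) \<bullet> grad \<phi> x)) =
      - (l ^ ?n * (1 / l\<^sup>2 * (LINT x:H|lborel. (l\<^sup>2 * f (l *\<^sub>R x)) * \<phi> x)))"
    by (simp only:)
  then have "l ^ ?n * (1 / l\<^sup>2) * ((LINT x:H|lborel. (l *\<^sub>R G (l *\<^sub>R x)) \<bullet> grad \<phi> x) + (LINT x:H|lborel. (l\<^sup>2 * f (l *\<^sub>R x)) * \<phi> x)) = 0"
    unfolding distrib_left mult.assoc by linarith
  moreover have "l ^ ?n * (1 / l\<^sup>2) \<noteq> 0" using l by simp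
  ultimately have "(LINT x:H|lborel. (l *\<^sub>R G (l *\<^sub>R x)) \<bullet> grad \<phi> x) + (LINT x:H|lborel. (l\<^sup>2 * f (l *\<^sub>R x)) * \<phi> x) = 0"
    using mult_eq_0_iff by blast
  then show "(LINT x:H|lborel. (l *\<^sub>R G (l *\<^sub>R x)) \<bullet> grad \<phi> x) = - (LINT x:H|lborel. l\<^sup>2 * f (l *\<^sub>R x) * \<phi> x)"
    by linarith
qed

lemma ray_has_derivative:
  assumes x: "x \<in> upper_ball" and t: "t \<in> {0..1}"
  shows "((\<lambda>t. u (t *\<^sub>R x)) has_real_derivative G (t *\<^sub>R x) \<bullet> x) (at t within {0..1})"
proof -
  have m: "t *\<^sub>R x \<in> upper_ball" if "t \<in> {0..1}" for t
  proof -
    have "\<bar>t\<bar> * norm x \<le> 1 * norm x" using that by (intro mult_right_mono) auto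
    then show ?thesis using that x by (auto simp: upper_ball_def)
  qed
  have d: "((\<lambda>t. t *\<^sub>R x) has_derivative (\<lambda>h. h *\<^sub>R x)) (at t within {0..1})"
    by (auto intro!: derivative_eq_intros)
  have "((\<lambda>t. u (t *\<^sub>R x)) has_derivative (\<lambda>h. G (t *\<^sub>R x) \<bullet> (h *\<^sub>R x))) (at t within {0..1})"
    by (rule has_derivative_in_compose2[where t=upper_ball and g'="\<lambda>y h. G y \<bullet> h", OF der _ t d]) (use m in auto)
  then show ?thesis by (simp add: has_field_derivative_def mult_commute_abs)
qed

lemma ray_difference_bound:
  assumes x: "x \<in> upper_ball" and l: "0 \<le> l" "l \<le> 1"
    and b: "\<And>t. l \<le> t \<Longrightarrow> t \<le> 1 \<Longrightarrow> \<bar>G (t *\<^sub>R x) \<bullet> x\<bar> \<le> B"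
  shows "\<bar>u (l *\<^sub>R x) - u x\<bar> \<le> B * (1 - l)"
proof -
  have "norm (u (l *\<^sub>R x) - u (1 *\<^sub>R x)) \<le> B * norm (l - 1)"
  proof (rule field_differentiable_bound[where S="{l..1}"])
    show "((\<lambda>t. u (t *\<^sub>R x)) has_real_derivative G (t *\<^sub>R x) \<bullet> x) (at t within {l..1})" if "t \<in> {l..1}" for t
      by (rule DERIV_subset[OF ray_has_derivative[OF x]]) (use that l in auto)
  qed (use l b in auto)
  then show ?thesis using l by simp
qed

text \<open>On the flat part, complementarity at \<open>x\<close> and at
  \<open>l *\<^sub>R x\<close> reduces the product \<open>(u (l *\<^sub>R x) - u x) * snd (G x + l
  *\<^sub>R G (l *\<^sub>R x))\<close> to two cross terms. The one with \<open>u x\<close> is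
  nonnegative. The other matters only where \<open>snd (G x) \<noteq> 0\<close>; there
  \<open>u x = 0\<close>, so the gradient along \<open>x\<close> vanishes at \<open>x\<close>, and
  uniform continuity of \<open>G\<close> makes \<open>u (l *\<^sub>R x)\<close> small compared with
  \<open>1 - l\<close>, uniformly in \<open>x\<close>.\<close>

lemma dilation_flat_bound:
  assumes r: "0 < r" "r < 1" and c: "0 < c"
  shows "\<exists>d>0. \<forall>l. 1 - d < l \<longrightarrow> 0 < l \<longrightarrow> l < 1 \<longrightarrow> (\<exists>t0>0. \<forall>x\<in>H. norm x \<le> r \<longrightarrow> snd x < t0 \<longrightarrow>
     - c \<le> ((u (l *\<^sub>R x) - u x) / (1 - l)) * snd (G x + l *\<^sub>R G (l *\<^sub>R x)))"
proof -
  define K where "K = cball 0 r \<inter> {x::'b \<times> real. 0 \<le> snd x}"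
  have K: "compact K" unfolding K_def by (intro compact_Int_closed compact_cball closed_Collect_le continuous_intros)
  have Ku: "K \<subseteq> upper_ball" using r by (auto simp: K_def upper_ball_def)
  have cG: "continuous_on K G" using contG Ku by (rule continuous_on_subset)
  have "bounded (G ` K)" using K cG by (intro compact_imp_bounded compact_continuous_image)
  then obtain B where B: "0 < B" "\<And>x. x \<in> K \<Longrightarrow> norm (G x) \<le> B" by (auto simp: bounded_pos)
  define e where "e = c / (2 * B)"
  have e: "0 < e" using c B by (simp add: e_def)
  obtain d where d: "d > 0" "\<And>x y. x \<in> K \<Longrightarrow> y \<in> K \<Longrightarrow> dist y x < d \<Longrightarrow> dist (G y) (G x) < e"
    using compact_uniformly_continuous[OF cG K] e unfolding uniformly_continuous_on_def by metis
  show ?thesis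
  proof (rule exI[of _ d], intro conjI allI impI d(1))
    fix l :: real assume l: "1 - d < l" "0 < l" "l < 1"
    have tK: "t *\<^sub>R x \<in> K" if "x \<in> K" "0 \<le> t" "t \<le> 1" for t x
    proof -
      have "t * norm x \<le> 1 * norm x" using that by (intro mult_right_mono) auto
      then show ?thesis using that by (auto simp: K_def)
    qed
    have lu: "l *\<^sub>R x \<in> upper_ball" if "x \<in> upper_ball" for x :: "'b \<times> real"
    proof -
      have "l * norm x \<le> 1 * norm x" using l by (intro mult_right_mono) auto
      then show ?thesis using that l by (auto simp: upper_ball_def)
    qed
    let ?b = "\<lambda>x. ((u (l *\<^sub>R x) - u x) / (1 - l)) * snd (G x + l *\<^sub>R G (l *\<^sub>R x))"
    have "continuous_on upper_ball ?b"
      using l lu by (intro continuous_intros cont_u contG continuous_on_compose2[OF cont_u] continuous_on_compose2[OF contG]) auto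
    then show "\<exists>t0>0. \<forall>x\<in>H. norm x \<le> r \<longrightarrow> snd x < t0 \<longrightarrow> - c \<le> ?b x"
    proof (rule lower_bound_near_flat[where b="?b", OF _ r(2)])
      fix x :: "'b \<times> real" assume x: "norm x \<le> r" "snd x = 0"
      then have xK: "x \<in> K" and x1: "norm x < 1" using r by (auto simp: K_def)
      have "l * norm x \<le> 1 * norm x" using l by (intro mult_right_mono) auto
      then have lx: "norm (l *\<^sub>R x) < 1" "snd (l *\<^sub>R x) = 0" using l x x1 by auto
      note fx = flat[OF x1 x(2)] and flx = flat[OF lx]
      have lb: "- ((c / 2) * (1 - l)) \<le> u (l *\<^sub>R x) * snd (G x)"
      proof (cases "snd (G x) = 0")
        case True then show ?thesis using c l by simp
      next
        case False
        then have ux: "u x = 0" using fx(3) by simp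
        have gx: "G x \<bullet> x = 0" using flat_tangential_grad[OF x1 x(2) ux x(2)] .
        have "\<bar>u (l *\<^sub>R x) - u x\<bar> \<le> e * (1 - l)"
        proof (rule ray_difference_bound)
          show "x \<in> upper_ball" using xK Ku by auto
          fix t assume t: "l \<le> t" "t \<le> 1"
          have "dist (t *\<^sub>R x) x = norm ((t - 1) *\<^sub>R x)" by (simp add: dist_norm algebra_simps)
          also have "\<dots> = (1 - t) * norm x" using t by simp
          also have "\<dots> \<le> (1 - l) * 1" using t x1 l by (intro mult_mono) auto
          also have "\<dots> < d" using l by simp
          finally have "dist (G (t *\<^sub>R x)) (G x) < e" using d(2)[OF xK tK[OF xK, of t]] t l by simp
          then have "norm (G (t *\<^sub>R x) - G x) * norm x \<le> e * 1" using x1 e by (intro mult_mono) (auto simp: dist_norm)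
          then have "\<bar>(G (t *\<^sub>R x) - G x) \<bullet> x\<bar> \<le> e" using Cauchy_Schwarz_ineq2[of "G (t *\<^sub>R x) - G x" x] by linarith
          then show "\<bar>G (t *\<^sub>R x) \<bullet> x\<bar> \<le> e" using gx by (simp add: inner_diff_left)
        qed (use l in auto)
        then have "u (l *\<^sub>R x) \<le> e * (1 - l)" using ux by simp
        moreover have "- snd (G x) \<le> B" using norm_snd_le[of "snd (G x)" "fst (G x)"] B(2)[OF xK] by simp
        ultimately have "u (l *\<^sub>R x) * - snd (G x) \<le> (e * (1 - l)) * B"
          using fx(2) flx(1) e l by (intro mult_mono) auto
        also have "\<dots> = (c / 2) * (1 - l)" using B(1) by (simp add: e_def)
        finally show ?thesis by simp
      qed
      have "0 \<le> u x * (l * - snd (G (l *\<^sub>R x)))" using fx(1) flx(2) l by (intro mult_nonneg_nonneg) auto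
      moreover have "(u (l *\<^sub>R x) - u x) * snd (G x + l *\<^sub>R G (l *\<^sub>R x)) = u (l *\<^sub>R x) * snd (G x) + u x * (l * - snd (G (l *\<^sub>R x)))"
        using fx(3) flx(3) by (auto simp: algebra_simps)
      ultimately have "- ((c / 2) * (1 - l)) \<le> (u (l *\<^sub>R x) - u x) * snd (G x + l *\<^sub>R G (l *\<^sub>R x))" using lb by linarith
      then have "- (c / 2) \<le> ?b x" using l by (simp add: pos_le_divide_eq)
      then show "- c < ?b x" using c by linarith
    qed
  qed
qed

text \<open>The sum of the two equations is tested with the difference of the two functions, so
  \<open>V \<bullet> Gw\<close> becomes the difference of the squared gradients divided by
  \<open>1 - l\<close>. No mixed term survives, and the limit is a derivative of the energy under
  dilation.\<close>

lemma dilation_weak_pair: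
  assumes l: "0 < l" "l < 1"
  shows "weak_pair (\<lambda>x. G x + l *\<^sub>R G (l *\<^sub>R x)) (\<lambda>x. f x + l\<^sup>2 * f (l *\<^sub>R x))
    (\<lambda>x. (u (l *\<^sub>R x) - u x) / (1 - l)) (\<lambda>x. (1 / (1 - l)) *\<^sub>R (l *\<^sub>R G (l *\<^sub>R x) - G x)) (2 * M)"
proof
  have lH: "l *\<^sub>R x \<in> H" if "x \<in> H" for x using scale_mem_half_ball[OF that l] .
  have bGl: "bounded_continuous_on H (\<lambda>x. G (l *\<^sub>R x))"
    by (rule bounded_continuous_on_compose[OF bc_G]) (use lH in \<open>auto intro!: continuous_intros\<close>)
  have bul: "bounded_continuous_on H (\<lambda>x. u (l *\<^sub>R x))"
    by (rule bounded_continuous_on_compose[OF bc_u]) (use lH in \<open>auto intro!: continuous_intros\<close>)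
  note bc = bounded_continuous_on_add bounded_continuous_on_diff bounded_continuous_on_scaleR bounded_continuous_on_const
    bounded_continuous_on_mult bc_G bc_u bGl bul
  show "bounded_continuous_on H (\<lambda>x. G x + l *\<^sub>R G (l *\<^sub>R x))"
    and "bounded_continuous_on H (\<lambda>x. (1 / (1 - l)) *\<^sub>R (l *\<^sub>R G (l *\<^sub>R x) - G x))" by (intro bc)+
  have "bounded_continuous_on H (\<lambda>x. (1 / (1 - l)) * (u (l *\<^sub>R x) - u x))" by (intro bc)
  then show "bounded_continuous_on H (\<lambda>x. (u (l *\<^sub>R x) - u x) / (1 - l))" by simp
  show fm: "(\<lambda>x. f x + l\<^sup>2 * f (l *\<^sub>R x)) \<in> borel_measurable borel" using f by measurable
  have fl: "\<bar>l\<^sup>2 * f (l *\<^sub>R x)\<bar> \<le> M" if "x \<in> H" for x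
  proof -
    have "l\<^sup>2 * \<bar>f (l *\<^sub>R x)\<bar> \<le> 1 * M" using l bound_f1[OF lH[OF that]] by (intro mult_mono) (auto intro!: power_le_one)
    then show ?thesis by (simp add: abs_mult)
  qed
  show "\<bar>f x + l\<^sup>2 * f (l *\<^sub>R x)\<bar> \<le> 2 * M" if "x \<in> H" for x
    using fl[OF that] bound_f1[OF that] by linarith
  show "weak_divergence (\<lambda>x. G x + l *\<^sub>R G (l *\<^sub>R x)) (\<lambda>x. f x + l\<^sup>2 * f (l *\<^sub>R x))"
    unfolding weak_divergence_def
  proof (intro allI impI)
    fix \<phi> assume t: "C1_test_function \<phi> H"
    then have "bounded_continuous_on UNIV \<phi> \<and> bounded_continuous_on UNIV (grad \<phi>)"
      by (rule C1_test_function_facts) blast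
    then have b: "bounded_continuous_on H \<phi>" "bounded_continuous_on H (grad \<phi>)"
      using bounded_continuous_on_subset[OF _ subset_UNIV] by blast+
    have i: "set_integrable lborel H (\<lambda>x. G x \<bullet> grad \<phi> x)" "set_integrable lborel H (\<lambda>x. (l *\<^sub>R G (l *\<^sub>R x)) \<bullet> grad \<phi> x)"
      by (intro half_ball_integrable[OF bounded_continuous_on_inner] bc b order_refl)+
    have fml: "(\<lambda>x. l\<^sup>2 * f (l *\<^sub>R x)) \<in> borel_measurable borel" using f by measurable
    have j: "set_integrable lborel H (\<lambda>x. f x * \<phi> x)" "set_integrable lborel H (\<lambda>x. (l\<^sup>2 * f (l *\<^sub>R x)) * \<phi> x)"
      by (rule bounded_measurable_mult_integrable[OF f bound_f1 b(1) order_refl] bounded_measurable_mult_integrable[OF fml fl b(1) order_refl]; assumption)+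
    have "(LINT x:H|lborel. (G x + l *\<^sub>R G (l *\<^sub>R x)) \<bullet> grad \<phi> x) = (LINT x:H|lborel. G x \<bullet> grad \<phi> x) + (LINT x:H|lborel. (l *\<^sub>R G (l *\<^sub>R x)) \<bullet> grad \<phi> x)"
      unfolding inner_add_left by (rule set_integral_add(2)[OF i])
    also have "\<dots> = - (LINT x:H|lborel. f x * \<phi> x) + - (LINT x:H|lborel. (l\<^sup>2 * f (l *\<^sub>R x)) * \<phi> x)"
      using weak[unfolded weak_divergence_def, rule_format, OF t]
        weak_divergence_dilation[OF l, unfolded weak_divergence_def, rule_format, OF t] by simp
    also have "\<dots> = - ((LINT x:H|lborel. f x * \<phi> x) + (LINT x:H|lborel. (l\<^sup>2 * f (l *\<^sub>R x)) * \<phi> x))" by simp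
    also have "(LINT x:H|lborel. f x * \<phi> x) + (LINT x:H|lborel. (l\<^sup>2 * f (l *\<^sub>R x)) * \<phi> x) = (LINT x:H|lborel. (f x + l\<^sup>2 * f (l *\<^sub>R x)) * \<phi> x)"
      unfolding distrib_right by (rule set_integral_add(2)[OF j, symmetric])
    finally show "(LINT x:H|lborel. (G x + l *\<^sub>R G (l *\<^sub>R x)) \<bullet> grad \<phi> x) = - (LINT x:H|lborel. (f x + l\<^sup>2 * f (l *\<^sub>R x)) * \<phi> x)" .
  qed
  fix x assume x: "x \<in> H"
  have "((\<lambda>y. l *\<^sub>R y) has_derivative (\<lambda>h. l *\<^sub>R h)) (at x)" by (auto intro!: derivative_eq_intros)
  from has_derivative_compose[OF this der_at[OF lH[OF x]]]
  have "((\<lambda>y. u (l *\<^sub>R y)) has_derivative (\<lambda>h. G (l *\<^sub>R x) \<bullet> (l *\<^sub>R h))) (at x)" .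
  from has_derivative_mult_right[OF has_derivative_diff[OF this der_at[OF x]], of "1 / (1 - l)"]
  show "((\<lambda>x. (u (l *\<^sub>R x) - u x) / (1 - l)) has_derivative (\<lambda>h. ((1 / (1 - l)) *\<^sub>R (l *\<^sub>R G (l *\<^sub>R x) - G x)) \<bullet> h)) (at x)"
    by (simp add: inner_diff_left inner_scaleR_left)
qed

lemma dilated_energy:
  assumes l: "0 < l" "l < 1" and r: "0 < r" "r < 1"
  shows "(LINT x:half_ball r|lborel. G (l *\<^sub>R x) \<bullet> G (l *\<^sub>R x)) = D (l * r) / l ^ DIM('b \<times> real)"
proof -
  let ?g = "\<lambda>y. indicator (half_ball (l * r)) y *\<^sub>R (G y \<bullet> G y)"
  have lr: "l * r \<le> 1" using l r by (simp add: mult_le_one)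
  have "bounded_continuous_on (half_ball (l * r)) (\<lambda>y. G y \<bullet> G y)"
    by (rule bounded_continuous_on_subset[OF bounded_continuous_on_inner[OF bc_G bc_G] half_ball_mono[OF lr]])
  from bounded_continuous_on_set_borel_measurable[OF this half_ball_borel]
  have "?g \<in> borel_measurable borel" by (simp add: set_borel_measurable_def)
  then have "(LINT y|lborel. ?g y) = \<bar>l\<bar> ^ DIM('b \<times> real) * (LINT x|lborel. ?g (0 + l *\<^sub>R x))"
    using l by (intro lborel_integral_affine) auto
  moreover have "(\<lambda>x. ?g (0 + l *\<^sub>R x)) = (\<lambda>x. indicator (half_ball r) x *\<^sub>R (G (l *\<^sub>R x) \<bullet> G (l *\<^sub>R x)))"
    using l by (auto simp: fun_eq_iff indicator_def mem_half_ball zero_less_mult_iff)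
  ultimately have "D (l * r) = l ^ DIM('b \<times> real) * (LINT x:half_ball r|lborel. G (l *\<^sub>R x) \<bullet> G (l *\<^sub>R x))"
    using l by (simp only: D_def set_lebesgue_integral_def abs_of_pos)
  then show ?thesis using l by simp
qed

text \<open>The Rellich identity, up to the term with the right-hand side, obtained without second derivatives
  by testing the equations of \<open>u\<close> and of its dilation \<open>x \<mapsto> u (l x)\<close> with their difference
  quotient and letting \<open>l\<close> tend to 1.\<close>

lemma rellich:
  assumes r: "0 < r" "r < 1"
  shows "(real DIM('b) - 1) * D r + 2 * r ^ Suc DIM('b) * half_sphere_integral (\<lambda>x. (G x \<bullet> (x /\<^sub>R norm x))\<^sup>2) r
      - 2 * M * r ^ (k - 1) * (LINT x:half_ball r|lborel. \<bar>G x \<bullet> x\<bar>)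
    \<le> r ^ Suc DIM('b) * half_sphere_integral (\<lambda>x. G x \<bullet> G x) r"
proof -
  let ?N = "DIM('b)"
  let ?n = "DIM('b \<times> real)"
  let ?nu = "\<lambda>x::'b \<times> real. x /\<^sub>R norm x"
  \<comment> \<open>The shift by two makes \<open>l 0 = 1/2\<close>, so all dilation factors lie
    strictly between 0 and 1.\<close>
  define l where "l i = 1 - inverse (real (Suc (Suc i)))" for i
  have l: "0 < l i" "l i < 1" for i by (auto simp: l_def field_simps)
  have l1: "l \<longlonglongrightarrow> 1"
    using LIMSEQ_ignore_initial_segment[OF LIMSEQ_inverse_real_of_nat, of 1] tendsto_diff[OF tendsto_const, of _ 0 _ 1]
    by (fastforce simp: l_def[abs_def])
  have l_at: "filterlim l (at 1) sequentially"
    unfolding filterlim_at using l1 l by (auto simp: less_imp_neq intro!: always_eventually)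
  define w where "w i x = (u (l i *\<^sub>R x) - u x) / (1 - l i)" for i x
  define V where "V i x = G x + l i *\<^sub>R G (l i *\<^sub>R x)" for i x
  have lH: "l i *\<^sub>R x \<in> H" if "x \<in> H" for x i using scale_mem_half_ball[OF that l] .
  have wp: "weak_pair (V i) (\<lambda>x. f x + (l i)\<^sup>2 * f (l i *\<^sub>R x)) (w i) (\<lambda>x. (1 / (1 - l i)) *\<^sub>R (l i *\<^sub>R G (l i *\<^sub>R x) - G x)) (2 * M)" for i
    using dilation_weak_pair[OF l] unfolding w_def[abs_def] V_def[abs_def] .
  have bw: "bounded_continuous_on H (w i)" and bV: "bounded_continuous_on H (V i)" for i
    using wp[of i] by (auto simp: weak_pair_def)
  have bGl: "bounded_continuous_on H (\<lambda>x. G (l i *\<^sub>R x))" for i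
    by (rule bounded_continuous_on_compose[OF bc_G]) (use lH in \<open>auto intro!: continuous_intros\<close>)
  have bx: "bounded_continuous_on H (\<lambda>x. x)" by (rule bounded_continuous_on_id[OF bounded_half_ball])
  have bnu: "bounded_continuous_on H ?nu" by (rule bounded_continuous_on_sgn) (simp add: mem_half_ball)
  have Gx: "\<bar>G (t *\<^sub>R x) \<bullet> x\<bar> \<le> M" if "x \<in> H" "0 < t" "t \<le> 1" for t x
  proof -
    have "t * norm x \<le> 1 * norm x" using that by (intro mult_right_mono) auto
    then have "t *\<^sub>R x \<in> H" using that by (auto simp: mem_half_ball)
    then have "norm (G (t *\<^sub>R x)) * norm x \<le> M * 1" using bound_G that M by (intro mult_mono) (auto simp: mem_half_ball)
    then show ?thesis using Cauchy_Schwarz_ineq2[of "G (t *\<^sub>R x)" x] by linarith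
  qed
  have w_bound: "\<bar>w i x\<bar> \<le> M" if "x \<in> H" for i x
  proof -
    have "\<bar>u (l i *\<^sub>R x) - u x\<bar> \<le> M * (1 - l i)"
      using that half_ball_subset_upper_ball l[of i] Gx[OF that] by (intro ray_difference_bound) auto
    then show ?thesis using l[of i] by (simp add: w_def abs_divide divide_le_eq)
  qed
  have w_lim: "(\<lambda>i. w i x) \<longlonglongrightarrow> - (G x \<bullet> x)" if "x \<in> H" for x
  proof -
    have "((\<lambda>t. u (t *\<^sub>R x)) has_real_derivative G (1 *\<^sub>R x) \<bullet> x) (at 1 within {0..1})"
      using that half_ball_subset_upper_ball by (intro ray_has_derivative) auto
    then have "(\<lambda>i. (u (l i *\<^sub>R x) - u x) / (l i - 1)) \<longlonglongrightarrow> G x \<bullet> x"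
      unfolding has_field_derivative_iff tendsto_at_iff_sequentially comp_def using l l1 by (auto simp: less_imp_le less_imp_neq)
    then have "(\<lambda>i. - ((u (l i *\<^sub>R x) - u x) / (l i - 1))) \<longlonglongrightarrow> - (G x \<bullet> x)" by (rule tendsto_minus)
    moreover have "- ((u (l i *\<^sub>R x) - u x) / (l i - 1)) = w i x" for i
      unfolding w_def using l[of i] by (simp add: field_simps)
    ultimately show ?thesis by simp
  qed
  have V_lim: "(\<lambda>i. V i x) \<longlonglongrightarrow> G x + 1 *\<^sub>R G (1 *\<^sub>R x)" if x: "x \<in> H" for x
  proof -
    have "(\<lambda>i. l i *\<^sub>R x) \<longlonglongrightarrow> 1 *\<^sub>R x" by (intro tendsto_intros l1)
    then have "(\<lambda>i. G (l i *\<^sub>R x)) \<longlonglongrightarrow> G (1 *\<^sub>R x)"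
      using x lH by (intro continuous_on_tendsto_compose[OF bounded_continuous_onD[OF bc_G]]) auto
    then show ?thesis unfolding V_def by (intro tendsto_intros l1)
  qed
  \<comment> \<open>\<open>m t\<close> is the Dirichlet energy on the half ball of radius
    \<open>r\<close> of the dilation \<open>x \<mapsto> u (t x)\<close>. Its derivative at 1
    produces the dimensional term \<open>(2 - n) * D r\<close> and the boundary term of the Rellich
    identity.\<close>
  define m where "m t = (t\<^sup>2 / t ^ ?n) * D (t * r)" for t
  let ?D' = "r ^ ?N * half_sphere_integral (\<lambda>x. G x \<bullet> G x) r"
  have bGG: "bounded_continuous_on H (\<lambda>x. G x \<bullet> G x)" by (rule bounded_continuous_on_inner[OF bc_G bc_G])
  have dm: "(m has_real_derivative (2 - real ?n) * D r + r * ?D') (at 1)"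
  proof -
    have "((\<lambda>t::real. t\<^sup>2 / t ^ ?n) has_real_derivative ((2 * 1) * 1 ^ ?n - 1\<^sup>2 * (real ?n * 1 ^ (?n - Suc 0))) / (1 ^ ?n * 1 ^ ?n)) (at 1)"
      using DERIV_pow[of 2 "1::real"] by (intro DERIV_divide DERIV_pow) auto
    moreover have "((\<lambda>t. D (t * r)) has_real_derivative ?D' * r) (at 1)"
    proof -
      have "((\<lambda>t. t * r) has_real_derivative r) (at 1)" by (auto intro!: derivative_eq_intros)
      moreover have "(D has_real_derivative ?D') (at (1 * r))"
        using half_ball_integral_has_derivative[OF bGG r] unfolding D_def[abs_def] by simp
      ultimately show ?thesis using DERIV_chain2[of D ?D' "\<lambda>t. t * r" 1 r UNIV] by blast
    qed
    ultimately have "(m has_real_derivative ((2 * 1) * 1 ^ ?n - 1\<^sup>2 * (real ?n * 1 ^ (?n - Suc 0))) / (1 ^ ?n * 1 ^ ?n) * D (1 * r) + ?D' * r * (1\<^sup>2 / 1 ^ ?n)) (at 1)"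
      unfolding m_def[abs_def] by (rule DERIV_mult)
    then show ?thesis by (simp add: mult.commute)
  qed
  have m_lim: "(\<lambda>i. (m (l i) - m 1) / (l i - 1)) \<longlonglongrightarrow> (2 - real ?n) * D r + r * ?D'"
    using dm unfolding has_field_derivative_iff by (rule filterlim_compose[OF _ l_at])
  have W_lim: "(\<lambda>i. LINT x:half_ball r|lborel. \<bar>w i x\<bar>) \<longlonglongrightarrow> (LINT x:half_ball r|lborel. \<bar>G x \<bullet> x\<bar>)"
  proof (rule ray_set_integral_tendsto[OF _ _ _ _ bounded_half_ball half_ball_borel])
    have sub: "half_ball r \<subseteq> H" using r by (intro half_ball_mono) auto
    show "set_borel_measurable lborel (half_ball r) (\<lambda>x. \<bar>w i x\<bar>)" for i
      by (intro bounded_continuous_on_set_borel_measurable bounded_continuous_on_abs bounded_continuous_on_subset[OF bw sub]) simp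
    show "set_borel_measurable lborel (half_ball r) (\<lambda>x. \<bar>G x \<bullet> x\<bar>)"
      by (intro bounded_continuous_on_set_borel_measurable bounded_continuous_on_abs bounded_continuous_on_subset[OF bounded_continuous_on_inner[OF bc_G bx] sub]) simp
    fix x :: "'b \<times> real" assume "x \<in> half_ball r"
    then have x: "x \<in> H" using sub by auto
    show "(\<lambda>i. \<bar>w i x\<bar>) \<longlonglongrightarrow> \<bar>G x \<bullet> x\<bar>" using tendsto_rabs[OF w_lim[OF x]] by simp
    show "\<bar>\<bar>w i x\<bar>\<bar> \<le> M" for i using w_bound[OF x] by simp
  qed
  have S_lim: "(\<lambda>i. half_sphere_integral (\<lambda>x. w i x * (V i x \<bullet> ?nu x)) r) \<longlonglongrightarrow>
      half_sphere_integral (\<lambda>x. - (G x \<bullet> x) * ((G x + 1 *\<^sub>R G (1 *\<^sub>R x)) \<bullet> ?nu x)) r"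
  proof (rule half_sphere_integral_tendsto[OF _ _ _ _ r])
    show "bounded_continuous_on H (\<lambda>x. w i x * (V i x \<bullet> ?nu x))" for i
      by (intro bounded_continuous_on_mult bounded_continuous_on_inner bw bV bnu)
    have "bounded_continuous_on H (\<lambda>x. G x + 1 *\<^sub>R G (1 *\<^sub>R x))" using bounded_continuous_on_add[OF bc_G bc_G] by simp
    then show "bounded_continuous_on H (\<lambda>x. - (G x \<bullet> x) * ((G x + 1 *\<^sub>R G (1 *\<^sub>R x)) \<bullet> ?nu x))"
      by (intro bounded_continuous_on_mult bounded_continuous_on_inner bounded_continuous_on_minus bnu bc_G bx)
    fix x :: "'b \<times> real" assume x: "x \<in> H"
    show "(\<lambda>i. w i x * (V i x \<bullet> ?nu x)) \<longlonglongrightarrow> - (G x \<bullet> x) * ((G x + 1 *\<^sub>R G (1 *\<^sub>R x)) \<bullet> ?nu x)"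
      by (intro tendsto_mult tendsto_inner tendsto_const w_lim V_lim x)
    fix i
    have "norm (V i x) \<le> norm (G x) + l i * norm (G (l i *\<^sub>R x))"
      using norm_triangle_ineq[of "G x" "l i *\<^sub>R G (l i *\<^sub>R x)"] l[of i] by (simp add: V_def)
    also have "\<dots> \<le> M + 1 * M" using bound_G[OF x] bound_G[OF lH[OF x]] l[of i] M by (intro add_mono mult_mono) auto
    finally have "norm (V i x) * norm (?nu x) \<le> 2 * M" using half_ball_nonzero[OF x] by simp
    then have "\<bar>V i x \<bullet> ?nu x\<bar> \<le> 2 * M" using Cauchy_Schwarz_ineq2[of "V i x" "?nu x"] by linarith
    then show "\<bar>w i x * (V i x \<bullet> ?nu x)\<bar> \<le> M * (2 * M)" unfolding abs_mult
      using w_bound[OF x] M by (intro mult_mono) auto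
  qed
  have S_eq: "half_sphere_integral (\<lambda>x. - (G x \<bullet> x) * ((G x + 1 *\<^sub>R G (1 *\<^sub>R x)) \<bullet> ?nu x)) r = - 2 * r * half_sphere_integral (\<lambda>x. (G x \<bullet> ?nu x)\<^sup>2) r"
    unfolding half_sphere_integral_cmult[symmetric]
    using r by (intro half_sphere_integral_cong) (auto simp: power2_eq_square inner_add_left field_simps)
  let ?L = "measure lborel (ball (0::'b) 1)"
  \<comment> \<open>The flat bound holds only for dilations close to 1, with closeness depending on
    \<open>c\<close>. Hence the limit in \<open>i\<close> is taken for fixed \<open>c\<close>, and
    \<open>c\<close> tends to 0 afterwards.\<close>
  have main: "- ((2 - real ?n) * D r + r * ?D') - 2 * M * r ^ (k - 1) * (LINT x:half_ball r|lborel. \<bar>G x \<bullet> x\<bar>)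
      \<le> r ^ ?N * (- 2 * r * half_sphere_integral (\<lambda>x. (G x \<bullet> ?nu x)\<^sup>2) r) + 4 * c * ?L" if c: "0 < c" for c
  proof -
    obtain d where d: "d > 0" "\<And>l. 1 - d < l \<Longrightarrow> 0 < l \<Longrightarrow> l < 1 \<Longrightarrow> \<exists>t0>0. \<forall>x\<in>H. norm x \<le> r \<longrightarrow> snd x < t0 \<longrightarrow>
       - c \<le> ((u (l *\<^sub>R x) - u x) / (1 - l)) * snd (G x + l *\<^sub>R G (l *\<^sub>R x))"
      using dilation_flat_bound[OF r c] by blast
    have ev: "eventually (\<lambda>i. 1 - d < l i) sequentially" using d(1) by (intro order_tendstoD(1)[OF l1]) simp
    have step: "- ((m (l i) - m 1) / (l i - 1)) - 2 * M * r ^ (k - 1) * (LINT x:half_ball r|lborel. \<bar>w i x\<bar>)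
       \<le> r ^ ?N * half_sphere_integral (\<lambda>x. w i x * (V i x \<bullet> ?nu x)) r + 4 * c * ?L" if i: "1 - d < l i" for i
    proof -
      interpret p: weak_pair "V i" "\<lambda>x. f x + (l i)\<^sup>2 * f (l i *\<^sub>R x)" "w i" "\<lambda>x. (1 / (1 - l i)) *\<^sub>R (l i *\<^sub>R G (l i *\<^sub>R x) - G x)" "2 * M"
        by (rule wp)
      let ?F = "\<lambda>x. f x + (l i)\<^sup>2 * f (l i *\<^sub>R x)"
      let ?GG = "\<lambda>x. G (l i *\<^sub>R x) \<bullet> G (l i *\<^sub>R x)"
      let ?q = "1 / (1 - l i)"
      obtain t0 where t0: "t0 > 0" "\<And>x. x\<in>H \<Longrightarrow> norm x \<le> r \<Longrightarrow> snd x < t0 \<Longrightarrow> - c \<le> w i x * snd (V i x)"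
        using d(2)[OF i l] unfolding w_def V_def by blast
      have A: "(LINT x:half_ball r|lborel. V i x \<bullet> (?q *\<^sub>R (l i *\<^sub>R G (l i *\<^sub>R x) - G x)) + ?F x * w i x)
         \<le> r ^ ?N * half_sphere_integral (\<lambda>x. w i x * (V i x \<bullet> ?nu x)) r + 4 * c * ?L"
        by (rule p.half_ball_divergence[OF r less_imp_le[OF c] t0]) auto
      have bGGl: "bounded_continuous_on H ?GG" by (rule bounded_continuous_on_inner[OF bGl bGl])
      have i1: "set_integrable lborel (half_ball r) (\<lambda>x. G x \<bullet> G x)" "set_integrable lborel (half_ball r) ?GG"
        using r by (auto intro!: half_ball_integrable bGG bGGl)
      have i2: "set_integrable lborel (half_ball r) (\<lambda>x. \<bar>w i x\<bar>)"
        using r by (intro half_ball_integrable bounded_continuous_on_abs bw) auto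
      have i3: "set_integrable lborel (half_ball r) (\<lambda>x. ?F x * w i x)"
        using r by (intro bounded_measurable_mult_integrable[OF p.F bw]) auto
      have "(LINT x:half_ball r|lborel. ?q * ((l i)\<^sup>2 * ?GG x - G x \<bullet> G x)) = ?q * ((l i)\<^sup>2 * (D (l i * r) / l i ^ ?n) - D r)"
        using i1 dilated_energy[OF l r, of i] by (simp add: set_integral_diff D_def)
      also have "\<dots> = ?q * (m (l i) - m 1)" by (simp add: m_def)
      also have "\<dots> = - ((m (l i) - m 1) / (l i - 1))" using l[of i] by (simp add: divide_simps) (simp add: algebra_simps)
      finally have B: "(LINT x:half_ball r|lborel. ?q * ((l i)\<^sup>2 * ?GG x - G x \<bullet> G x)) = - ((m (l i) - m 1) / (l i - 1))" .
      have ib: "set_integrable lborel (half_ball r) (\<lambda>x. ?q * ((l i)\<^sup>2 * ?GG x - G x \<bullet> G x))"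
        using i1 by (intro set_integrable_mult_right set_integral_diff) auto
      have "- ((m (l i) - m 1) / (l i - 1)) - 2 * M * r ^ (k - 1) * (LINT x:half_ball r|lborel. \<bar>w i x\<bar>)
         = (LINT x:half_ball r|lborel. ?q * ((l i)\<^sup>2 * ?GG x - G x \<bullet> G x) - 2 * M * r ^ (k - 1) * \<bar>w i x\<bar>)"
        using set_integral_diff(2)[OF ib set_integrable_mult_right[OF i2]] B by simp
      also have "\<dots> \<le> (LINT x:half_ball r|lborel. V i x \<bullet> (?q *\<^sub>R (l i *\<^sub>R G (l i *\<^sub>R x) - G x)) + ?F x * w i x)"
      proof (rule set_integral_mono)
        show "set_integrable lborel (half_ball r) (\<lambda>x. ?q * ((l i)\<^sup>2 * ?GG x - G x \<bullet> G x) - 2 * M * r ^ (k - 1) * \<bar>w i x\<bar>)"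
          by (intro set_integral_diff ib set_integrable_mult_right i2)
        have VG: "V i x \<bullet> (?q *\<^sub>R (l i *\<^sub>R G (l i *\<^sub>R x) - G x)) = ?q * ((l i)\<^sup>2 * ?GG x - G x \<bullet> G x)" for x
          unfolding V_def by (simp add: inner_add_left inner_diff_right inner_commute[of "G x" "G (l i *\<^sub>R x)"] power2_eq_square distrib_left)
        show "set_integrable lborel (half_ball r) (\<lambda>x. V i x \<bullet> (?q *\<^sub>R (l i *\<^sub>R G (l i *\<^sub>R x) - G x)) + ?F x * w i x)"
          unfolding VG by (rule set_integral_add(1)[OF ib i3])
        fix x :: "'b \<times> real" assume x: "x \<in> half_ball r"
        have lx: "l i *\<^sub>R x \<in> half_ball r" using scale_mem_half_ball[OF x l] .
        have "(l i)\<^sup>2 * \<bar>f (l i *\<^sub>R x)\<bar> \<le> 1 * (M * r ^ (k - 1))"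
          using bound_f'[OF lx] r l[of i] by (intro mult_mono) (auto intro!: power_le_one simp: less_imp_le)
        then have "\<bar>?F x\<bar> \<le> 2 * M * r ^ (k - 1)"
          using bound_f'[OF x] r abs_triangle_ineq[of "f x" "(l i)\<^sup>2 * f (l i *\<^sub>R x)"] by (simp add: abs_mult)
        then have "\<bar>?F x\<bar> * \<bar>w i x\<bar> \<le> 2 * M * r ^ (k - 1) * \<bar>w i x\<bar>" by (rule mult_right_mono) simp
        then have "- (2 * M * r ^ (k - 1) * \<bar>w i x\<bar>) \<le> ?F x * w i x" unfolding abs_mult[symmetric] by linarith
        then show "?q * ((l i)\<^sup>2 * ?GG x - G x \<bullet> G x) - 2 * M * r ^ (k - 1) * \<bar>w i x\<bar> \<le> V i x \<bullet> (?q *\<^sub>R (l i *\<^sub>R G (l i *\<^sub>R x) - G x)) + ?F x * w i x"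
          unfolding VG by linarith
      qed
      also note A
      finally show ?thesis .
    qed
    show ?thesis unfolding S_eq[symmetric]
    proof (rule tendsto_le[OF sequentially_bot])
      show "(\<lambda>i. r ^ ?N * half_sphere_integral (\<lambda>x. w i x * (V i x \<bullet> ?nu x)) r + 4 * c * ?L) \<longlonglongrightarrow>
        r ^ ?N * half_sphere_integral (\<lambda>x. - (G x \<bullet> x) * ((G x + 1 *\<^sub>R G (1 *\<^sub>R x)) \<bullet> ?nu x)) r + 4 * c * ?L"
        by (intro tendsto_add tendsto_mult tendsto_const S_lim)
      show "(\<lambda>i. - ((m (l i) - m 1) / (l i - 1)) - 2 * M * r ^ (k - 1) * (LINT x:half_ball r|lborel. \<bar>w i x\<bar>)) \<longlonglongrightarrow>
        - ((2 - real ?n) * D r + r * ?D') - 2 * M * r ^ (k - 1) * (LINT x:half_ball r|lborel. \<bar>G x \<bullet> x\<bar>)"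
        by (intro tendsto_diff tendsto_minus tendsto_mult tendsto_const m_lim W_lim)
      show "\<forall>\<^sub>F i in sequentially. - ((m (l i) - m 1) / (l i - 1)) - 2 * M * r ^ (k - 1) * (LINT x:half_ball r|lborel. \<bar>w i x\<bar>)
        \<le> r ^ ?N * half_sphere_integral (\<lambda>x. w i x * (V i x \<bullet> ?nu x)) r + 4 * c * ?L"
        using ev by eventually_elim (rule step)
    qed
  qed
  have "- ((2 - real ?n) * D r + r * ?D') - 2 * M * r ^ (k - 1) * (LINT x:half_ball r|lborel. \<bar>G x \<bullet> x\<bar>)
      \<le> r ^ ?N * (- 2 * r * half_sphere_integral (\<lambda>x. (G x \<bullet> ?nu x)\<^sup>2) r)"
  proof (rule le_if_le_add_small_multiple)
    show "0 \<le> ?L" by simp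
  qed (rule main)
  then show ?thesis by (simp add: algebra_simps)
qed

end

section \<open>Poincare and trace estimates\<close>

text \<open>For \<open>1/2 \<le> t\<close> the point on the segment is used as a new variable in
  place of \<open>y\<close>, for \<open>t < 1/2\<close> in place of \<open>x\<close>. The Jacobian
  is then at most \<open>2 ^ DIM('a)\<close>, and the other endpoint contributes the measure of
  \<open>A\<close>.\<close>

lemma nn_integral_segments_le:
  fixes g :: "'a::euclidean_space \<Rightarrow> ennreal"
  assumes g[measurable]: "g \<in> borel_measurable borel" and A[measurable]: "A \<in> sets borel"
  shows "(\<integral>\<^sup>+p. \<integral>\<^sup>+t. indicator {0..1::real} t * (indicator A (fst p) * indicator A (snd p) * g ((1 - t) *\<^sub>R fst p + t *\<^sub>R snd p)) \<partial>lborel \<partial>lborel)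
    \<le> 2 ^ DIM('a) * emeasure lborel A * (\<integral>\<^sup>+x. g x \<partial>lborel)"
proof -
  let ?I = "\<integral>\<^sup>+x. g x \<partial>lborel"
  let ?h = "\<lambda>t (p :: 'a \<times> 'a). indicator A (fst p) * indicator A (snd p) * g ((1 - t) *\<^sub>R fst p + t *\<^sub>R snd p)"
  have scale: "(\<integral>\<^sup>+x. g (y + c *\<^sub>R x) \<partial>lborel) \<le> 2 ^ DIM('a) * ?I" if c: "1 / 2 \<le> c" for y :: 'a and c :: real
  proof -
    have "1 \<le> ennreal (2 ^ DIM('a) * c ^ DIM('a))"
    proof -
      have "1 \<le> (2 * c) ^ DIM('a)" using c by (intro one_le_power) auto
      then show ?thesis by (simp add: power_mult_distrib)
    qed
    then have "1 * (\<integral>\<^sup>+x. g (y + c *\<^sub>R x) \<partial>lborel) \<le> ennreal (2 ^ DIM('a) * c ^ DIM('a)) * (\<integral>\<^sup>+x. g (y + c *\<^sub>R x) \<partial>lborel)"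
      by (rule mult_right_mono) simp
    also have "\<dots> = 2 ^ DIM('a) * (ennreal (\<bar>c\<bar> ^ DIM('a)) * (\<integral>\<^sup>+x. g (y + c *\<^sub>R x) \<partial>lborel))"
      using c by (simp add: ennreal_mult ennreal_power[symmetric] mult.assoc)
    also have "ennreal (\<bar>c\<bar> ^ DIM('a)) * (\<integral>\<^sup>+x. g (y + c *\<^sub>R x) \<partial>lborel) = ?I"
      using c by (intro nn_integral_lborel_affine[symmetric]) auto
    finally show ?thesis by simp
  qed
  have [measurable]: "(fst :: 'a \<times> 'a \<Rightarrow> 'a) \<in> borel_measurable borel" "(snd :: 'a \<times> 'a \<Rightarrow> 'a) \<in> borel_measurable borel"
    by (intro borel_measurable_continuous_onI continuous_intros)+
  have slice: "(\<integral>\<^sup>+p. ?h t p \<partial>lborel) \<le> 2 ^ DIM('a) * emeasure lborel A * ?I" if t: "t \<in> {0..1}" for t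
  proof -
    have mm: "(\<lambda>p. ?h t p) \<in> borel_measurable (lborel \<Otimes>\<^sub>M lborel)" by measurable
    have eq: "(\<integral>\<^sup>+p. ?h t p \<partial>lborel) = (\<integral>\<^sup>+x. \<integral>\<^sup>+y. ?h t (x, y) \<partial>lborel \<partial>lborel)"
      unfolding lborel_prod[symmetric] by (rule lborel.nn_integral_fst[symmetric, OF mm])
    show ?thesis
    proof (cases "1 / 2 \<le> t")
      case True
      have "(\<integral>\<^sup>+x. \<integral>\<^sup>+y. ?h t (x, y) \<partial>lborel \<partial>lborel) \<le> (\<integral>\<^sup>+x. indicator A x * (2 ^ DIM('a) * ?I) \<partial>lborel)"
      proof (rule nn_integral_mono)
        fix x
        have "(\<integral>\<^sup>+y. ?h t (x, y) \<partial>lborel) \<le> (\<integral>\<^sup>+y. indicator A x * g ((1 - t) *\<^sub>R x + t *\<^sub>R y) \<partial>lborel)"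
          by (rule nn_integral_mono) (auto simp: indicator_def)
        also have "\<dots> = indicator A x * (\<integral>\<^sup>+y. g ((1 - t) *\<^sub>R x + t *\<^sub>R y) \<partial>lborel)" by (rule nn_integral_cmult) measurable
        also have "\<dots> \<le> indicator A x * (2 ^ DIM('a) * ?I)" by (intro mult_left_mono scale True) simp
        finally show "(\<integral>\<^sup>+y. ?h t (x, y) \<partial>lborel) \<le> indicator A x * (2 ^ DIM('a) * ?I)" .
      qed
      also have "\<dots> = emeasure lborel A * (2 ^ DIM('a) * ?I)" by (subst nn_integral_multc) auto
      finally show ?thesis unfolding eq by (simp add: mult_ac)
    next
      case False
      have "(\<integral>\<^sup>+x. \<integral>\<^sup>+y. ?h t (x, y) \<partial>lborel \<partial>lborel) = (\<integral>\<^sup>+y. \<integral>\<^sup>+x. ?h t (x, y) \<partial>lborel \<partial>lborel)"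
        by (rule lborel_pair.Fubini') (simp add: case_prod_beta, measurable)
      also have "\<dots> \<le> (\<integral>\<^sup>+y. indicator A y * (2 ^ DIM('a) * ?I) \<partial>lborel)"
      proof (rule nn_integral_mono)
        fix y
        have "(\<integral>\<^sup>+x. ?h t (x, y) \<partial>lborel) \<le> (\<integral>\<^sup>+x. indicator A y * g (t *\<^sub>R y + (1 - t) *\<^sub>R x) \<partial>lborel)"
          by (rule nn_integral_mono) (auto simp: indicator_def add.commute)
        also have "\<dots> = indicator A y * (\<integral>\<^sup>+x. g (t *\<^sub>R y + (1 - t) *\<^sub>R x) \<partial>lborel)" by (rule nn_integral_cmult) measurable
        also have "\<dots> \<le> indicator A y * (2 ^ DIM('a) * ?I)" using False by (intro mult_left_mono scale) auto
        finally show "(\<integral>\<^sup>+x. ?h t (x, y) \<partial>lborel) \<le> indicator A y * (2 ^ DIM('a) * ?I)" .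
      qed
      also have "\<dots> = emeasure lborel A * (2 ^ DIM('a) * ?I)" by (subst nn_integral_multc) auto
      finally show ?thesis unfolding eq by (simp add: mult_ac)
    qed
  qed
  have "(\<integral>\<^sup>+p. \<integral>\<^sup>+t. indicator {0..1::real} t * ?h t p \<partial>lborel \<partial>lborel) = (\<integral>\<^sup>+t. \<integral>\<^sup>+p. indicator {0..1::real} t * ?h t p \<partial>lborel \<partial>lborel)"
    by (rule lborel_pair.Fubini') (simp add: case_prod_beta, measurable)
  also have "\<dots> \<le> (\<integral>\<^sup>+t. indicator {0..1::real} t * (2 ^ DIM('a) * emeasure lborel A * ?I) \<partial>lborel)"
  proof (rule nn_integral_mono)
    fix t :: real
    have "(\<integral>\<^sup>+p. indicator {0..1::real} t * ?h t p \<partial>lborel) = indicator {0..1} t * (\<integral>\<^sup>+p. ?h t p \<partial>lborel)"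
      by (rule nn_integral_cmult) measurable
    also have "\<dots> \<le> indicator {0..1} t * (2 ^ DIM('a) * emeasure lborel A * ?I)"
      using slice[of t] by (cases "t \<in> {0..1}") (auto simp: indicator_def)
    finally show "(\<integral>\<^sup>+p. indicator {0..1::real} t * ?h t p \<partial>lborel) \<le> indicator {0..1} t * (2 ^ DIM('a) * emeasure lborel A * ?I)" .
  qed
  also have "\<dots> = 2 ^ DIM('a) * emeasure lborel A * ?I" by (subst nn_integral_multc) auto
  finally show ?thesis .
qed

lemma nn_integral_segments_iterated:
  fixes g :: "'a::euclidean_space \<Rightarrow> ennreal"
  assumes g[measurable]: "g \<in> borel_measurable borel" and A[measurable]: "A \<in> sets borel"
  shows "(\<integral>\<^sup>+x. \<integral>\<^sup>+y. c * (\<integral>\<^sup>+t. indicator {0..1::real} t * (indicator A x * indicator A y * g ((1 - t) *\<^sub>R x + t *\<^sub>R y)) \<partial>lborel) \<partial>lborel \<partial>lborel)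
    = c * (\<integral>\<^sup>+p. \<integral>\<^sup>+t. indicator {0..1::real} t * (indicator A (fst p) * indicator A (snd p) * g ((1 - t) *\<^sub>R fst p + t *\<^sub>R snd p)) \<partial>lborel \<partial>lborel)"
proof -
  have [measurable]: "(fst :: 'a \<times> 'a \<Rightarrow> 'a) \<in> borel_measurable borel" "(snd :: 'a \<times> 'a \<Rightarrow> 'a) \<in> borel_measurable borel"
    by (intro borel_measurable_continuous_onI continuous_intros)+
  let ?T = "\<lambda>p. \<integral>\<^sup>+t. indicator {0..1::real} t * (indicator A (fst p) * indicator A (snd p) * g ((1 - t) *\<^sub>R fst p + t *\<^sub>R snd p)) \<partial>lborel"
  have Tm: "(\<lambda>p. c * ?T p) \<in> borel_measurable (lborel \<Otimes>\<^sub>M lborel)" by measurable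
  have "(\<integral>\<^sup>+x. \<integral>\<^sup>+y. c * ?T (x, y) \<partial>lborel \<partial>lborel) = (\<integral>\<^sup>+p. c * ?T p \<partial>lborel)"
    unfolding lborel_prod[symmetric] by (rule lborel.nn_integral_fst[OF Tm])
  also have "\<dots> = c * (\<integral>\<^sup>+p. ?T p \<partial>lborel)" by (rule nn_integral_cmult) measurable
  finally show ?thesis by simp
qed

text \<open>Cauchy-Schwarz for the increment written as an integral. The extended nonnegative form
  can be inserted into iterated integrals without integrability conditions on slices.\<close>

lemma square_increment_le:
  fixes g :: "real \<Rightarrow> real"
  assumes ab: "a \<le> b" and der: "\<And>t. t \<in> {a..b} \<Longrightarrow> (v has_real_derivative g t) (at t within {a..b})"
    and cont: "continuous_on {a..b} g"
  shows "ennreal ((v b - v a)\<^sup>2) \<le> ennreal (b - a) * (\<integral>\<^sup>+t. indicator {a..b} t * ennreal ((g t)\<^sup>2) \<partial>lborel)"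
proof -
  have i: "set_integrable lborel {a..b} (\<lambda>t. g t * 1)" "set_integrable lborel {a..b} (\<lambda>t. (g t)\<^sup>2)"
      "set_integrable lborel {a..b} (\<lambda>t. (1::real)\<^sup>2)"
    by (intro borel_integrable_atLeastAtMost' continuous_intros cont)+
  have "(g has_integral v b - v a) {a..b}"
    using der ab by (intro fundamental_theorem_of_calculus) (auto simp: has_real_derivative_iff_has_vector_derivative[symmetric])
  then have "v b - v a = (LINT t:{a..b}|lborel. g t * 1)"
    using set_borel_integral_eq_integral(2)[OF i(1)] by (simp add: integral_unique)
  then have "(v b - v a)\<^sup>2 \<le> (LINT t:{a..b}|lborel. (g t)\<^sup>2) * (LINT t:{a..b}|lborel. (1::real)\<^sup>2)"
    using set_integral_Cauchy_Schwarz[OF i(2) i(3) i(1)] by simp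
  also have "(LINT t:{a..b}|lborel. (1::real)\<^sup>2) = b - a" using ab by (simp add: set_lebesgue_integral_def)
  finally have "ennreal ((v b - v a)\<^sup>2) \<le> ennreal ((b - a) * (LINT t:{a..b}|lborel. (g t)\<^sup>2))"
    by (intro ennreal_leI) (simp add: mult.commute)
  also have "\<dots> = ennreal (b - a) * ennreal (LINT t:{a..b}|lborel. (g t)\<^sup>2)"
    using ab by (intro ennreal_mult) (auto simp: set_lebesgue_integral_def intro!: Bochner_Integration.integral_nonneg)
  also have "ennreal (LINT t:{a..b}|lborel. (g t)\<^sup>2) = (\<integral>\<^sup>+t. ennreal (indicator {a..b} t *\<^sub>R (g t)\<^sup>2) \<partial>lborel)"
    unfolding set_lebesgue_integral_def
    using i(2) by (intro nn_integral_eq_integral[symmetric] AE_I2) (auto simp: set_integrable_def)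
  also have "(\<lambda>t. ennreal (indicator {a..b} t *\<^sub>R (g t)\<^sup>2)) = (\<lambda>t. indicator {a..b} t * ennreal ((g t)\<^sup>2))"
    by (auto simp: fun_eq_iff indicator_def)
  finally show ?thesis .
qed

lemma nn_set_integral_half_ball:
  fixes F :: "'b::euclidean_space \<times> real \<Rightarrow> real"
  assumes "bounded_continuous_on (half_ball 1) F" "r \<le> 1" "\<And>x. x \<in> half_ball r \<Longrightarrow> 0 \<le> F x"
  shows "(\<integral>\<^sup>+x. indicator (half_ball r) x * ennreal (F x) \<partial>lborel) = ennreal (LINT x:half_ball r|lborel. F x)"
proof -
  have "(\<integral>\<^sup>+x. ennreal (indicator (half_ball r) x *\<^sub>R F x) \<partial>lborel) = ennreal (LINT x:half_ball r|lborel. F x)"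
    unfolding set_lebesgue_integral_def
    using half_ball_integrable[OF assms(1,2)] assms(3)
    by (intro nn_integral_eq_integral AE_I2) (auto simp: set_integrable_def indicator_def)
  also have "(\<lambda>x. ennreal (indicator (half_ball r) x *\<^sub>R F x)) = (\<lambda>x. indicator (half_ball r) x * ennreal (F x))"
    by (auto simp: fun_eq_iff indicator_def)
  finally show ?thesis .
qed

lemma borel_measurable_half_ball_mult:
  fixes F :: "'b::euclidean_space \<times> real \<Rightarrow> real"
  assumes "bounded_continuous_on (half_ball 1) F" "r \<le> 1"
  shows "(\<lambda>x. indicator (half_ball r) x * ennreal (F x)) \<in> borel_measurable borel"
proof -
  have "(\<lambda>x. indicator (half_ball r) x *\<^sub>R F x) \<in> borel_measurable borel"
    using half_ball_integrable[OF assms] by (auto simp: set_integrable_def)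
  then have "(\<lambda>x. ennreal (indicator (half_ball r) x *\<^sub>R F x)) \<in> borel_measurable borel" by measurable
  also have "(\<lambda>x. ennreal (indicator (half_ball r) x *\<^sub>R F x)) = (\<lambda>x. indicator (half_ball r) x * ennreal (F x))"
    by (auto simp: fun_eq_iff indicator_def)
  finally show ?thesis .
qed

context signorini_solution begin

definition U :: "real \<Rightarrow> real" where "U r = (LINT x:half_ball r|lborel. (u x)\<^sup>2)"

lemma bc_GG: "bounded_continuous_on H (\<lambda>x. G x \<bullet> G x)" by (rule bounded_continuous_on_inner[OF bc_G bc_G])
lemma bc_uu: "bounded_continuous_on H (\<lambda>x. (u x)\<^sup>2)" by (rule bounded_continuous_on_power[OF bc_u])
lemma bc_x: "bounded_continuous_on H (\<lambda>x. x)" by (rule bounded_continuous_on_id[OF bounded_half_ball])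
lemma bc_nu: "bounded_continuous_on H (\<lambda>x. x /\<^sub>R norm x)" by (rule bounded_continuous_on_sgn) (simp add: mem_half_ball)

lemma D_nonneg: "0 \<le> D r"
  unfolding D_def set_lebesgue_integral_def by (intro Bochner_Integration.integral_nonneg) simp

lemma bc_negative_part: "bounded_continuous_on H (\<lambda>x. max 0 (- u x))"
proof (rule bounded_continuous_onI[where K=M])
  show "continuous_on H (\<lambda>x. max 0 (- u x))" by (intro continuous_intros bounded_continuous_onD[OF bc_u])
  show "norm (max 0 (- u x)) \<le> M" if "x \<in> H" for x using bound_u[OF that] M by (auto simp: max_def)
qed

text \<open>On each vertical line \<open>u\<close> starts with a nonnegative value at the flat part.
  A negative value at height \<open>s\<close> is thus bounded by the vertical increment, whose
  square is at most \<open>r\<close> times the integral of the squared gradient on that line.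
  Integrating over the height gives the second factor \<open>r\<close>.\<close>

lemma negative_part_le:
  assumes r: "0 < r" "r < 1"
  shows "(LINT x:half_ball r|lborel. (max 0 (- u x))\<^sup>2) \<le> r\<^sup>2 * D r"
proof -
  let ?v = "\<lambda>x. (max 0 (- u x))\<^sup>2"
  have bv: "bounded_continuous_on H ?v" by (rule bounded_continuous_on_power[OF bc_negative_part])
  let ?g = "\<lambda>x. indicator (half_ball r) x * ennreal (G x \<bullet> G x)"
  let ?f = "\<lambda>x. indicator (half_ball r) x * ennreal (?v x)"
  have gm: "?g \<in> borel_measurable (lborel \<Otimes>\<^sub>M lborel)" and fm: "?f \<in> borel_measurable (lborel \<Otimes>\<^sub>M lborel)"
    using borel_measurable_half_ball_mult[OF bc_GG] borel_measurable_half_ball_mult[OF bv] r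
    by (simp_all add: lborel_prod)
  let ?P = "\<lambda>y. \<integral>\<^sup>+t. ?g (y, t) \<partial>lborel"
  have Pm: "?P \<in> borel_measurable lborel" using gm by measurable
  have pt: "?f (y, s) \<le> indicator {0..r} s * (ennreal r * ?P y)" for y s
  proof (cases "(y, s) \<in> half_ball r \<and> u (y, s) < 0")
    case False
    then show ?thesis by (auto simp: indicator_def max_def not_less)
  next
    case True
    then have ys: "norm (y, s) < r" "0 < s" and un: "u (y, s) < 0" by (auto simp: mem_half_ball)
    \<comment> \<open>Moving down to the flat part decreases the norm, so the whole vertical segment
      below a point of the half ball is available.\<close>
    have nt: "norm (y, t) \<le> norm (y, s)" if "0 \<le> t" "t \<le> s" for t
      using that by (simp add: norm_Pair power_mono)
    have mu: "(y, t) \<in> upper_ball" if "t \<in> {0..s}" for t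
      using nt[of t] that ys r by (auto simp: upper_ball_def)
    have sr: "s < r" using norm_snd_le[of s y] ys by simp
    have "ennreal ((u (y, s) - u (y, 0))\<^sup>2) \<le> ennreal (s - 0) * (\<integral>\<^sup>+t. indicator {0..s} t * ennreal ((snd (G (y, t)))\<^sup>2) \<partial>lborel)"
    proof (rule square_increment_le)
      show "continuous_on {0..s} (\<lambda>t. snd (G (y, t)))"
        by (intro continuous_on_snd continuous_on_compose2[OF contG] continuous_intros) (use mu in auto)
      fix t assume t: "t \<in> {0..s}"
      have d: "((\<lambda>t. (y, t)) has_derivative (\<lambda>h. (0, h))) (at t within {0..s})"
        by (auto intro!: derivative_eq_intros)
      have "((\<lambda>t. u (y, t)) has_derivative (\<lambda>h. G (y, t) \<bullet> (0, h))) (at t within {0..s})"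
        by (rule has_derivative_in_compose2[where t=upper_ball and g'="\<lambda>y h. G y \<bullet> h", OF der _ t d]) (use mu in auto)
      moreover have "(\<lambda>h. G (y, t) \<bullet> (0, h)) = (*) (snd (G (y, t)))" by (auto simp: inner_prod_def)
      ultimately show "((\<lambda>t. u (y, t)) has_real_derivative snd (G (y, t))) (at t within {0..s})"
        by (simp add: has_field_derivative_def)
    qed (use ys in simp)
    also have "\<dots> \<le> ennreal r * ?P y"
    proof (intro mult_mono ennreal_leI nn_integral_mono_AE)
      have "AE t in lborel. t \<noteq> (0::real)" by (simp add: AE_lborel_singleton)
      then show "AE t in lborel. indicator {0..s} t * ennreal ((snd (G (y, t)))\<^sup>2) \<le> ?g (y, t)"
      proof eventually_elim
        fix t :: real assume t0: "t \<noteq> 0"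
        show "indicator {0..s} t * ennreal ((snd (G (y, t)))\<^sup>2) \<le> ?g (y, t)"
        proof (cases "t \<in> {0..s}")
          case True
          then have "(y, t) \<in> half_ball r" using nt[of t] ys t0 by (auto simp: mem_half_ball)
          moreover have "(snd (G (y, t)))\<^sup>2 \<le> G (y, t) \<bullet> G (y, t)" by (simp add: inner_prod_def power2_eq_square)
          ultimately show ?thesis using True by (simp add: ennreal_leI)
        qed simp
      qed
    qed (use sr in auto)
    finally have "ennreal ((u (y, s) - u (y, 0))\<^sup>2) \<le> ennreal r * ?P y" .
    moreover have "0 \<le> u (y, 0)" using mu[of 0] ys by (intro flat(1)) (auto simp: upper_ball_def)
    then have "(max 0 (- u (y, s)))\<^sup>2 \<le> (u (y, s) - u (y, 0))\<^sup>2"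
      using un power_mono[of "- u (y, s)" "u (y, 0) - u (y, s)" 2] by (simp add: power2_commute)
    ultimately have "ennreal (?v (y, s)) \<le> ennreal r * ?P y" using ennreal_leI order_trans by blast
    then show ?thesis using True ys sr by (simp add: mem_half_ball)
  qed
  have "(\<integral>\<^sup>+x. ?f x \<partial>lborel) = (\<integral>\<^sup>+y. \<integral>\<^sup>+s. ?f (y, s) \<partial>lborel \<partial>lborel)"
    unfolding lborel_prod[symmetric] by (rule lborel.nn_integral_fst[symmetric, OF fm])
  also have "\<dots> \<le> (\<integral>\<^sup>+y. \<integral>\<^sup>+s. indicator {0..r} s * (ennreal r * ?P y) \<partial>lborel \<partial>lborel)"
    by (intro nn_integral_mono pt)
  also have "\<dots> = (\<integral>\<^sup>+y. ennreal r * (ennreal r * ?P y) \<partial>lborel)"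
    using r by (subst nn_integral_multc) auto
  also have "\<dots> = ennreal r * (ennreal r * (\<integral>\<^sup>+y. ?P y \<partial>lborel))"
    using Pm by (simp add: nn_integral_cmult)
  also have "(\<integral>\<^sup>+y. ?P y \<partial>lborel) = (\<integral>\<^sup>+x. ?g x \<partial>lborel)"
    unfolding lborel_prod[symmetric] by (rule lborel.nn_integral_fst[OF gm])
  also have "\<dots> = ennreal (D r)" unfolding D_def using r by (intro nn_set_integral_half_ball bc_GG) auto
  also have "(\<integral>\<^sup>+x. ?f x \<partial>lborel) = ennreal (LINT x:half_ball r|lborel. ?v x)"
    using r by (intro nn_set_integral_half_ball bv) auto
  finally have "ennreal (LINT x:half_ball r|lborel. ?v x) \<le> ennreal (r\<^sup>2 * D r)"
    using r D_nonneg by (simp add: ennreal_mult[symmetric] power2_eq_square mult.assoc)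
  then show ?thesis using r D_nonneg by (subst (asm) ennreal_le_iff) auto
qed

text \<open>With \<open>m\<close> the integral of \<open>u\<close>, the double integral of
  \<open>(u x - u y)\<^sup>2\<close> over the half ball equals
  \<open>2 * \<mu> * U r - 2 * m\<^sup>2\<close>. By convexity each difference is controlled by the
  gradient on the segment, of length at most \<open>2 * r\<close>, and the average over segments is
  the preceding estimate. Halving \<open>4 * 2 ^ n\<close> gives the constant. The mean is kept on
  the right, to be estimated separately.\<close>

lemma poincare:
  assumes r: "0 < r" "r < 1"
  shows "measure lborel (half_ball r :: ('b \<times> real) set) * U r \<le> (LINT x:half_ball r|lborel. u x)\<^sup>2
      + 2 ^ Suc DIM('b \<times> real) * r\<^sup>2 * measure lborel (half_ball r :: ('b \<times> real) set) * D r"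
proof -
  let ?A = "half_ball r :: ('b \<times> real) set"
  let ?\<mu> = "measure lborel ?A"
  let ?m = "LINT x:?A|lborel. u x"
  have fin: "emeasure lborel ?A < \<infinity>" by (rule emeasure_bounded_finite[OF bounded_half_ball])
  then have e\<mu>: "emeasure lborel ?A = ennreal ?\<mu>" by (simp add: emeasure_eq_ennreal_measure)
  have sub: "?A \<subseteq> H" using r by (intro half_ball_mono) auto
  let ?g = "\<lambda>x. indicator ?A x * ennreal (G x \<bullet> G x)"
  have gm: "?g \<in> borel_measurable borel" using borel_measurable_half_ball_mult[OF bc_GG] r by simp
  have gI: "(\<integral>\<^sup>+x. ?g x \<partial>lborel) = ennreal (D r)" unfolding D_def using r by (intro nn_set_integral_half_ball bc_GG) auto
  have iu: "set_integrable lborel ?A u" "set_integrable lborel ?A (\<lambda>x. (u x)\<^sup>2)"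
    using r by (auto intro!: half_ball_integrable bc_u bc_uu)
  let ?q = "\<lambda>x y. (u x - u y)\<^sup>2"
  have pt: "indicator ?A x * (indicator ?A y * ennreal (?q x y)) \<le> ennreal (4 * r\<^sup>2) *
      (\<integral>\<^sup>+t. indicator {0..1} t * (indicator ?A x * indicator ?A y * ?g ((1 - t) *\<^sub>R x + t *\<^sub>R y)) \<partial>lborel)" for x y
  proof (cases "x \<in> ?A \<and> y \<in> ?A")
    case False then show ?thesis by auto
  next
    case True
    let ?p = "\<lambda>t. (1 - t) *\<^sub>R x + t *\<^sub>R y"
    have pA: "?p t \<in> ?A" if "t \<in> {0..1}" for t
      using convexD_alt[OF convex_half_ball, of x r y t] True that by auto
    have n: "norm (y - x) \<le> 2 * r"
      using True norm_triangle_ineq4[of y x] by (auto simp: mem_half_ball)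
    have "ennreal ((u (?p 1) - u (?p 0))\<^sup>2) \<le> ennreal (1 - 0) * (\<integral>\<^sup>+t. indicator {0..1} t * ennreal ((G (?p t) \<bullet> (y - x))\<^sup>2) \<partial>lborel)"
    proof (rule square_increment_le)
      have "continuous_on {0..1} (\<lambda>t. G (?p t))"
        by (intro continuous_on_compose2[OF bounded_continuous_onD[OF bc_G]] continuous_intros) (use pA sub in blast)
      then show "continuous_on {0..1} (\<lambda>t. G (?p t) \<bullet> (y - x))" by (intro continuous_intros)
      fix t :: real assume t: "t \<in> {0..1}"
      have "((\<lambda>t. ?p t) has_derivative (\<lambda>h. h *\<^sub>R (y - x))) (at t within {0..1})"
        by (auto intro!: derivative_eq_intros simp: algebra_simps)
      from has_derivative_compose[OF this der_at[OF subsetD[OF sub pA[OF t]]]]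
      show "((\<lambda>t. u (?p t)) has_real_derivative G (?p t) \<bullet> (y - x)) (at t within {0..1})"
        by (simp add: has_field_derivative_def mult_commute_abs)
    qed simp
    also have "\<dots> = (\<integral>\<^sup>+t. indicator {0..1} t * ennreal ((G (?p t) \<bullet> (y - x))\<^sup>2) \<partial>lborel)" by simp
    also have "\<dots> \<le> (\<integral>\<^sup>+t. ennreal (4 * r\<^sup>2) * (indicator {0..1} t * (indicator ?A x * indicator ?A y * ?g (?p t))) \<partial>lborel)"
    proof (rule nn_integral_mono)
      fix t :: real
      show "indicator {0..1} t * ennreal ((G (?p t) \<bullet> (y - x))\<^sup>2) \<le> ennreal (4 * r\<^sup>2) * (indicator {0..1} t * (indicator ?A x * indicator ?A y * ?g (?p t)))"
      proof (cases "t \<in> {0..1}")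
        case t: True
        have "(G (?p t) \<bullet> (y - x))\<^sup>2 \<le> (G (?p t) \<bullet> G (?p t)) * ((y - x) \<bullet> (y - x))" by (rule Cauchy_Schwarz_ineq)
        also have "\<dots> \<le> (G (?p t) \<bullet> G (?p t)) * (2 * r)\<^sup>2"
          using power_mono[OF n norm_ge_zero, of 2] by (intro mult_left_mono[OF _ inner_ge_zero]) (simp only: dot_square_norm)
        finally have "ennreal ((G (?p t) \<bullet> (y - x))\<^sup>2) \<le> ennreal (4 * r\<^sup>2) * ennreal (G (?p t) \<bullet> G (?p t))"
          by (subst ennreal_mult[symmetric]) (auto intro!: ennreal_leI simp: power_mult_distrib mult.commute)
        then show ?thesis using t True pA[OF t] by simp
      qed simp
    qed
    also have "\<dots> = ennreal (4 * r\<^sup>2) * (\<integral>\<^sup>+t. indicator {0..1} t * (indicator ?A x * indicator ?A y * ?g (?p t)) \<partial>lborel)"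
    proof (rule nn_integral_cmult)
      have pm: "(\<lambda>t. ?g (?p t)) \<in> borel_measurable lborel" by (rule measurable_compose[OF _ gm]) measurable
      show "(\<lambda>t. indicator {0..1} t * (indicator ?A x * indicator ?A y * ?g (?p t))) \<in> borel_measurable lborel"
        by (intro borel_measurable_times_ennreal borel_measurable_const borel_measurable_indicator pm) simp
    qed
    finally show ?thesis using True by (simp add: power2_commute)
  qed
  have Ly: "(LINT y:?A|lborel. ?q x y) = ?\<mu> * (u x)\<^sup>2 - 2 * ?m * u x + U r" for x
  proof -
    have ic: "set_integrable lborel ?A (\<lambda>y. (u x)\<^sup>2)" using r by (intro half_ball_integrable bounded_continuous_on_const) auto
    have i1: "set_integrable lborel ?A (\<lambda>y. (- 2 * u x) * u y)" by (rule set_integrable_mult_right[OF iu(1)])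
    have "(LINT y:?A|lborel. ?q x y) = (LINT y:?A|lborel. (u x)\<^sup>2 + (- 2 * u x) * u y + (u y)\<^sup>2)"
      by (simp add: power2_diff algebra_simps)
    also have "\<dots> = (LINT y:?A|lborel. (u x)\<^sup>2) + (- 2 * u x) * ?m + U r"
      unfolding U_def set_integral_add(2)[OF set_integral_add(1)[OF ic i1] iu(2)] set_integral_add(2)[OF ic i1] set_integral_mult_right ..
    also have "(LINT y:?A|lborel. (u x)\<^sup>2) = ?\<mu> * (u x)\<^sup>2" using fin by (simp add: set_lebesgue_integral_def)
    finally show ?thesis by (simp add: mult_ac)
  qed
  have real_x: "(\<integral>\<^sup>+y. indicator ?A x * (indicator ?A y * ennreal (?q x y)) \<partial>lborel) = indicator ?A x * ennreal (?\<mu> * (u x)\<^sup>2 - 2 * ?m * u x + U r)" for x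
  proof -
    have bq: "bounded_continuous_on H (\<lambda>y. ?q x y)"
      by (intro bounded_continuous_on_power bounded_continuous_on_diff bounded_continuous_on_const bc_u)
    have "(\<integral>\<^sup>+y. indicator ?A x * (indicator ?A y * ennreal (?q x y)) \<partial>lborel) = indicator ?A x * (\<integral>\<^sup>+y. indicator ?A y * ennreal (?q x y) \<partial>lborel)"
      using borel_measurable_half_ball_mult[OF bq] r by (intro nn_integral_cmult) auto
    also have "(\<integral>\<^sup>+y. indicator ?A y * ennreal (?q x y) \<partial>lborel) = ennreal (LINT y:?A|lborel. ?q x y)"
      using r by (intro nn_set_integral_half_ball bq) auto
    finally show ?thesis unfolding Ly .
  qed
  have bQ: "bounded_continuous_on H (\<lambda>x. ?\<mu> * (u x)\<^sup>2 - 2 * ?m * u x + U r)"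
    by (intro bounded_continuous_on_add bounded_continuous_on_diff bounded_continuous_on_mult bounded_continuous_on_const bc_u bc_uu)
  have Q0: "0 \<le> ?\<mu> * (u x)\<^sup>2 - 2 * ?m * u x + U r" for x
  proof -
    have "0 \<le> (LINT y:?A|lborel. ?q x y)" unfolding set_lebesgue_integral_def by (intro Bochner_Integration.integral_nonneg) simp
    then show ?thesis unfolding Ly .
  qed
  have "ennreal (2 * ?\<mu> * U r - 2 * ?m\<^sup>2) = ennreal (LINT x:?A|lborel. ?\<mu> * (u x)\<^sup>2 - 2 * ?m * u x + U r)"
  proof -
    have ic: "set_integrable lborel ?A (\<lambda>y. U r)" using r by (intro half_ball_integrable bounded_continuous_on_const) auto
    have i1: "set_integrable lborel ?A (\<lambda>x. ?\<mu> * (u x)\<^sup>2)" "set_integrable lborel ?A (\<lambda>x. 2 * ?m * u x)"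
      by (intro set_integrable_mult_right iu)+
    have eU: "(LINT x:?A|lborel. (u x)\<^sup>2) = U r" by (simp add: U_def)
    have "(LINT x:?A|lborel. ?\<mu> * (u x)\<^sup>2 - 2 * ?m * u x + U r) = ?\<mu> * U r - 2 * ?m * ?m + (LINT x:?A|lborel. U r)"
      unfolding set_integral_add(2)[OF set_integral_diff(1)[OF i1] ic] set_integral_diff(2)[OF i1] set_integral_mult_right eU ..
    also have "(LINT x:?A|lborel. U r) = ?\<mu> * U r" using fin by (simp add: set_lebesgue_integral_def)
    also have "?\<mu> * U r - 2 * ?m * ?m + ?\<mu> * U r = 2 * ?\<mu> * U r - 2 * ?m\<^sup>2" by (simp add: power2_eq_square)
    finally show ?thesis by (simp only:)
  qed
  also have "\<dots> = (\<integral>\<^sup>+x. indicator ?A x * ennreal (?\<mu> * (u x)\<^sup>2 - 2 * ?m * u x + U r) \<partial>lborel)"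
    using r Q0 by (intro nn_set_integral_half_ball[symmetric] bQ) auto
  also have "\<dots> = (\<integral>\<^sup>+x. \<integral>\<^sup>+y. indicator ?A x * (indicator ?A y * ennreal (?q x y)) \<partial>lborel \<partial>lborel)"
    unfolding real_x ..
  also have "\<dots> \<le> (\<integral>\<^sup>+x. \<integral>\<^sup>+y. ennreal (4 * r\<^sup>2) * (\<integral>\<^sup>+t. indicator {0..1} t * (indicator ?A x * indicator ?A y * ?g ((1 - t) *\<^sub>R x + t *\<^sub>R y)) \<partial>lborel) \<partial>lborel \<partial>lborel)"
    by (intro nn_integral_mono pt)
  also have "\<dots> = ennreal (4 * r\<^sup>2) * (\<integral>\<^sup>+p. \<integral>\<^sup>+t. indicator {0..1::real} t * (indicator ?A (fst p) * indicator ?A (snd p) * ?g ((1 - t) *\<^sub>R fst p + t *\<^sub>R snd p)) \<partial>lborel \<partial>lborel)"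
    by (rule nn_integral_segments_iterated[OF gm]) simp
  also have "\<dots> \<le> ennreal (4 * r\<^sup>2) * (2 ^ DIM('b \<times> real) * emeasure lborel ?A * (\<integral>\<^sup>+x. ?g x \<partial>lborel))"
    by (intro mult_left_mono nn_integral_segments_le gm) auto
  also have "\<dots> = ennreal (4 * r\<^sup>2 * (2 ^ DIM('b \<times> real) * ?\<mu> * D r))"
  proof -
    have "(2::ennreal) ^ DIM('b \<times> real) = ennreal (2 ^ DIM('b \<times> real))"
      by (metis ennreal_numeral ennreal_power zero_le_numeral)
    moreover have "ennreal a * (ennreal b * ennreal c * ennreal d) = ennreal (a * (b * c * d))"
      if "0 \<le> a" "0 \<le> b" "0 \<le> c" "0 \<le> d" for a b c d using that by (simp add: ennreal_mult)
    ultimately show ?thesis unfolding gI e\<mu> using D_nonneg by (simp only:) simp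
  qed
  finally have "2 * ?\<mu> * U r - 2 * ?m\<^sup>2 \<le> 4 * r\<^sup>2 * (2 ^ DIM('b \<times> real) * ?\<mu> * D r)"
    using D_nonneg by (subst (asm) ennreal_le_iff) auto
  then show ?thesis by (simp add: algebra_simps)
qed

lemma half_ball_finite: "emeasure lborel (half_ball r :: ('b \<times> real) set) < \<infinity>"
  by (rule emeasure_bounded_finite[OF bounded_half_ball])

lemma measure_half_ball:
  "0 < r \<Longrightarrow> measure lborel (half_ball r :: ('b \<times> real) set) = measure lborel H * r ^ Suc DIM('b)"
  using measure_half_ball_scale[of r, where 'b='b] by simp

lemma vol_pos: "0 < measure lborel H" by (rule measure_half_ball_pos)

lemma half_ball_integral_le_const:
  fixes F :: "'b \<times> real \<Rightarrow> real"
  assumes F: "set_integrable lborel (half_ball r) F" and r: "0 < r" "r \<le> 1"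
    and b: "\<And>x. x \<in> half_ball r \<Longrightarrow> F x \<le> (K::real)"
  shows "(LINT x:half_ball r|lborel. F x) \<le> K * (measure lborel H * r ^ Suc DIM('b))"
proof -
  have "(LINT x:half_ball r|lborel. F x) \<le> (LINT x:(half_ball r :: ('b \<times> real) set)|lborel. K)"
    using r b by (intro set_integral_mono F half_ball_integrable bounded_continuous_on_const) auto
  also have "\<dots> = measure lborel (half_ball r :: ('b \<times> real) set) * K"
    using half_ball_finite[of r] by (simp add: set_lebesgue_integral_def)
  also have "\<dots> = K * (measure lborel H * r ^ Suc DIM('b))" using measure_half_ball[OF r(1)] by simp
  finally show ?thesis .
qed

lemma f_integrable: "r \<le> 1 \<Longrightarrow> set_integrable lborel (half_ball r) f"
  using bounded_measurable_mult_integrable[OF f bound_f1 bounded_continuous_on_const[of _ "1::real"]] by simp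

lemma mean_derivative_le:
  assumes r: "0 < r" "r < 1" and k: "1 \<le> k"
  shows "half_sphere_integral (\<lambda>x. G x \<bullet> (x /\<^sub>R norm x)) r \<le> M * measure lborel H * r ^ k"
proof -
  have "r ^ DIM('b) * half_sphere_integral (\<lambda>x. G x \<bullet> (x /\<^sub>R norm x)) r \<le> (LINT x:half_ball r|lborel. f x)"
    by (rule flux_le[OF r])
  also have "\<dots> \<le> (M * r ^ (k - 1)) * (measure lborel H * r ^ Suc DIM('b))"
    using r bound_f' by (intro half_ball_integral_le_const f_integrable) (auto simp: abs_le_iff)
  also have "\<dots> = r ^ DIM('b) * (M * measure lborel H * r ^ k)"
    using k by (cases k) (auto simp: mult_ac)
  finally show ?thesis using r by simp
qed

text \<open>The radial derivative of the spherical integral is bounded above by the flux inequality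
  and the bound for \<open>f\<close>, and its limit at radius 0 is zero since
  \<open>u 0 = 0\<close>. The bound is one-sided, as befits a superharmonic function.\<close>

lemma mean_le:
  assumes r: "0 < r" "r < 1" and k: "1 \<le> k"
  shows "half_sphere_integral u r \<le> M * measure lborel H * r ^ Suc k"
proof (rule field_le_epsilon)
  fix e :: real assume e: "0 < e"
  let ?c = "half_sphere_integral (\<lambda>_::'b \<times> real. 1) 1"
  have c: "half_sphere_integral (\<lambda>_::'b \<times> real. 1) s = ?c" for s unfolding half_sphere_integral_const ..
  have c0: "0 < ?c" unfolding half_sphere_integral_const using vol_pos by simp
  have "(0::'b \<times> real) \<in> upper_ball" by (simp add: upper_ball_def)
  \<comment> \<open>Continuity at the origin makes the spherical integral small on a sphere of
    radius \<open>s < r\<close>, from which the mean value theorem starts. Dividing by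
    \<open>?c\<close>, the integral of 1, makes the resulting bound exactly
    \<open>e\<close>.\<close>
  then obtain d where d: "d > 0" "\<And>x. x \<in> upper_ball \<Longrightarrow> dist x 0 < d \<Longrightarrow> dist (u x) (u 0) < e / ?c"
    using cont_u c0 e unfolding continuous_on_iff by (metis divide_pos_pos)
  obtain s where s: "0 < s" "s < d" "s < r" using field_lbound_gt_zero[OF d(1) r(1)] by blast
  have s1: "s < 1" using s r by simp
  have us: "\<bar>half_sphere_integral u s\<bar> \<le> (e / ?c) * half_sphere_integral (\<lambda>_::'b \<times> real. 1) s"
  proof (rule half_sphere_integral_bound[OF bc_u s(1) s1])
    fix x :: "'b \<times> real" assume "norm x = s" "0 < snd x"
    then have "x \<in> upper_ball" "dist x 0 < d" using s s1 by (auto simp: upper_ball_def)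
    from d(2)[OF this] show "\<bar>u x\<bar> \<le> e / ?c" by (simp add: u0 dist_real_def)
  qed
  then have us: "half_sphere_integral u s \<le> e" using c0 unfolding c[of s] by simp
  let ?S = "half_sphere_integral (\<lambda>x. G x \<bullet> (x /\<^sub>R norm x))"
  have dS: "(half_sphere_integral u has_real_derivative ?S x) (at x)" if "s \<le> x" "x \<le> r" for x
    by (rule half_sphere_integral_has_derivative[OF bc_u bc_G der_at]) (use s r that in auto)
  obtain z where z: "s < z" "z < r" "half_sphere_integral u r - half_sphere_integral u s = (r - s) * ?S z"
    using MVT2[OF s(3), of "half_sphere_integral u" ?S] dS by blast
  have "?S z \<le> M * measure lborel H * z ^ k" using z s r k by (intro mean_derivative_le) auto
  also have "\<dots> \<le> M * measure lborel H * r ^ k" using z s r M by (intro mult_left_mono power_mono) auto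
  finally have "(r - s) * ?S z \<le> (r - s) * (M * measure lborel H * r ^ k)" using s by (intro mult_left_mono) auto
  also have "\<dots> \<le> r * (M * measure lborel H * r ^ k)" using s r M by (intro mult_right_mono) auto
  finally have "half_sphere_integral u r \<le> half_sphere_integral u s + r * (M * measure lborel H * r ^ k)" using z(3) by linarith
  then show "half_sphere_integral u r \<le> M * measure lborel H * r ^ Suc k + e" using us by (simp add: mult_ac)
qed

lemma integral_u_le:
  assumes r: "0 < r" "r < 1" and k: "1 \<le> k"
  shows "(LINT x:half_ball r|lborel. u x) \<le> M * measure lborel H * r ^ (DIM('b) + k + 2)"
proof -
  let ?K = "M * measure lborel H * r ^ (DIM('b) + k + 1)"
  have "(LINT x:half_ball r|lborel. u x) = (LINT s:{0<..<r}|lborel. s ^ DIM('b) * half_sphere_integral u s)"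
    using r by (intro half_ball_polar bc_u) auto
  also have "\<dots> \<le> (LINT s:{0<..<r}|lborel. ?K)"
  proof (rule set_integral_mono)
    show "set_integrable lborel {0<..<r} (\<lambda>s. s ^ DIM('b) * half_sphere_integral u s)"
      using r by (intro half_sphere_integral_set_integrable bc_u) auto
    show "set_integrable lborel {0<..<r} (\<lambda>s. ?K)"
      unfolding set_integrable_def using r by (intro integrable_scaleR_left integrable_real_indicator) auto
    fix s assume s: "s \<in> {0<..<r}"
    have "s ^ DIM('b) * half_sphere_integral u s \<le> s ^ DIM('b) * (M * measure lborel H * s ^ Suc k)"
      using s r k by (intro mult_left_mono mean_le) auto
    also have "\<dots> = M * measure lborel H * s ^ (DIM('b) + k + 1)" by (simp add: power_add mult_ac)
    also have "\<dots> \<le> ?K" using s M by (intro mult_left_mono power_mono) auto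
    finally show "s ^ DIM('b) * half_sphere_integral u s \<le> ?K" .
  qed
  also have "\<dots> = r * ?K" using r by (simp add: set_lebesgue_integral_def)
  finally show ?thesis by (simp add: mult_ac)
qed

lemma abs_integral_square_le:
  assumes F: "bounded_continuous_on H F" and r: "0 < r" "r < 1"
  shows "(LINT x:half_ball r|lborel. F x)\<^sup>2 \<le> measure lborel H * r ^ Suc DIM('b) * (LINT x:half_ball r|lborel. (F x)\<^sup>2)"
proof -
  have "(LINT x:half_ball r|lborel. F x * 1)\<^sup>2 \<le> (LINT x:half_ball r|lborel. (F x)\<^sup>2) * (LINT x:(half_ball r :: ('b \<times> real) set)|lborel. 1\<^sup>2)"
    using r F by (intro set_integral_Cauchy_Schwarz half_ball_integrable bounded_continuous_on_power bounded_continuous_on_mult bounded_continuous_on_const) auto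
  also have "(LINT x:(half_ball r :: ('b \<times> real) set)|lborel. (1::real)\<^sup>2) = measure lborel H * r ^ Suc DIM('b)"
    using half_ball_finite[of r] measure_half_ball[OF r(1)]
    by (simp add: set_lebesgue_integral_def)
  finally show ?thesis by (simp add: mult.commute)
qed

text \<open>The mean in the Poincare inequality needs two arguments. If the integral of
  \<open>u\<close> is nonnegative, the bound from superharmonicity applies; if it is negative, it is
  dominated by the negative part, which is controlled by the energy because \<open>u \<ge> 0\<close>
  on the flat part.\<close>

lemma U_le:
  assumes r: "0 < r" "r < 1" and k: "1 \<le> k"
  shows "U r \<le> (M\<^sup>2 * measure lborel H + 1 + 2 ^ (DIM('b) + 2)) * (r ^ (DIM('b) + 2 * k + 3) + r\<^sup>2 * D r)"
proof -
  let ?\<mu> = "measure lborel H * r ^ Suc DIM('b)"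
  let ?m = "LINT x:half_ball r|lborel. u x"
  have \<mu>: "0 < ?\<mu>" using vol_pos r by simp
  have \<mu>_eq: "measure lborel (half_ball r :: ('b \<times> real) set) = ?\<mu>" using measure_half_ball[OF r(1)] by simp
  have m2: "?m\<^sup>2 \<le> ?\<mu> * (M\<^sup>2 * measure lborel H * r ^ (DIM('b) + 2 * k + 3) + r\<^sup>2 * D r)"
  proof (cases "0 \<le> ?m")
    case True
    have "?m\<^sup>2 \<le> (M * measure lborel H * r ^ (DIM('b) + k + 2))\<^sup>2" using integral_u_le[OF r k] True by (rule power_mono)
    also have "\<dots> = ?\<mu> * (M\<^sup>2 * measure lborel H * r ^ (DIM('b) + 2 * k + 3))"
    proof -
      have "(r ^ (DIM('b) + k + 2))\<^sup>2 = r ^ Suc DIM('b) * r ^ (DIM('b) + 2 * k + 3)"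
        unfolding power_mult[symmetric] power_add[symmetric] by (rule arg_cong[where f="\<lambda>i. r ^ i"]) simp
      then show ?thesis unfolding power_mult_distrib by (simp only: power2_eq_square mult_ac)
    qed
    also have "\<dots> \<le> ?\<mu> * (M\<^sup>2 * measure lborel H * r ^ (DIM('b) + 2 * k + 3) + r\<^sup>2 * D r)"
      using \<mu> D_nonneg by (intro mult_left_mono) auto
    finally show ?thesis .
  next
    case False
    let ?v = "\<lambda>x. max 0 (- u x)"
    note bv = bc_negative_part
    have "(LINT x:half_ball r|lborel. (-1) * u x) \<le> (LINT x:half_ball r|lborel. ?v x)"
      using r by (intro set_integral_mono half_ball_integrable bounded_continuous_on_mult bounded_continuous_on_const bc_u bv) auto
    moreover have "(LINT x:half_ball r|lborel. (-1) * u x) = (-1) * ?m" by (rule set_integral_mult_right)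
    ultimately have "- ?m \<le> (LINT x:half_ball r|lborel. ?v x)" by linarith
    then have "(- ?m)\<^sup>2 \<le> (LINT x:half_ball r|lborel. ?v x)\<^sup>2" using False by (intro power_mono) auto
    also have "\<dots> \<le> ?\<mu> * (LINT x:half_ball r|lborel. (?v x)\<^sup>2)" by (rule abs_integral_square_le[OF bv r])
    also have "\<dots> \<le> ?\<mu> * (r\<^sup>2 * D r)" using \<mu> by (intro mult_left_mono negative_part_le r) auto
    also have "\<dots> \<le> ?\<mu> * (M\<^sup>2 * measure lborel H * r ^ (DIM('b) + 2 * k + 3) + r\<^sup>2 * D r)"
      using \<mu> r vol_pos by (intro mult_left_mono) auto
    finally show ?thesis by simp
  qed
  have "?\<mu> * U r \<le> ?m\<^sup>2 + 2 ^ (DIM('b) + 2) * r\<^sup>2 * ?\<mu> * D r"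
    using poincare[OF r] unfolding \<mu>_eq by simp
  also have "\<dots> \<le> ?\<mu> * (M\<^sup>2 * measure lborel H * r ^ (DIM('b) + 2 * k + 3) + r\<^sup>2 * D r) + 2 ^ (DIM('b) + 2) * r\<^sup>2 * ?\<mu> * D r"
    using m2 by simp
  also have "\<dots> = ?\<mu> * (M\<^sup>2 * measure lborel H * r ^ (DIM('b) + 2 * k + 3) + (1 + 2 ^ (DIM('b) + 2)) * (r\<^sup>2 * D r))"
    by (simp add: algebra_simps)
  finally have "U r \<le> M\<^sup>2 * measure lborel H * r ^ (DIM('b) + 2 * k + 3) + (1 + 2 ^ (DIM('b) + 2)) * (r\<^sup>2 * D r)"
    using \<mu> by (simp only: mult_le_cancel_left_pos)
  also have "\<dots> \<le> (M\<^sup>2 * measure lborel H + 1 + 2 ^ (DIM('b) + 2)) * r ^ (DIM('b) + 2 * k + 3) + (M\<^sup>2 * measure lborel H + 1 + 2 ^ (DIM('b) + 2)) * (r\<^sup>2 * D r)"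
    using r D_nonneg vol_pos by (intro add_mono mult_right_mono) auto
  finally show ?thesis by (simp only: distrib_left)
qed

text \<open>Formally the divergence theorem for \<open>u^2 x\<close>, whose normal component
  vanishes on the flat part. Both sides have the same derivative in the radius, and their difference
  is \<open>O(s)\<close> at radius \<open>s\<close>; being constant, it is zero.\<close>

lemma trace_identity:
  assumes r: "0 < r" "r < 1"
  shows "r ^ Suc DIM('b) * half_sphere_integral (\<lambda>x. (u x)\<^sup>2) r = (LINT x:half_ball r|lborel. (real DIM('b) + 1) * (u x)\<^sup>2 + 2 * (u x * (G x \<bullet> x)))"
proof -
  let ?N = "DIM('b)"
  let ?F = "\<lambda>x. (real ?N + 1) * (u x)\<^sup>2 + 2 * (u x * (G x \<bullet> x))"
  let ?T = "\<lambda>s. s ^ Suc ?N * half_sphere_integral (\<lambda>x. (u x)\<^sup>2) s"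
  let ?P = "\<lambda>s. LINT x:half_ball s|lborel. ?F x"
  have bF: "bounded_continuous_on H ?F"
    by (intro bounded_continuous_on_add bounded_continuous_on_mult bounded_continuous_on_const bc_uu bc_u bounded_continuous_on_inner bc_G bc_x)
  have du: "((\<lambda>x. (u x)\<^sup>2) has_derivative (\<lambda>h. ((2 * u x) *\<^sub>R G x) \<bullet> h)) (at x)" if "x \<in> H" for x
    using has_derivative_power[OF der_at[OF that], of 2] by (simp add: mult_ac)
  have b2: "bounded_continuous_on H (\<lambda>x. (2 * u x) *\<^sub>R G x)"
    by (intro bounded_continuous_on_scaleR bounded_continuous_on_mult bounded_continuous_on_const bc_u bc_G)
  have d0: "((\<lambda>s. ?T s - ?P s) has_real_derivative 0) (at s)" if s: "0 < s" "s < 1" for s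
  proof -
    let ?S2 = "half_sphere_integral (\<lambda>x. ((2 * u x) *\<^sub>R G x) \<bullet> (x /\<^sub>R norm x)) s"
    have 1: "(half_sphere_integral (\<lambda>x. (u x)\<^sup>2) has_real_derivative ?S2) (at s)"
      by (rule half_sphere_integral_has_derivative[OF bc_uu b2 du s])
    have 2: "(?P has_real_derivative s ^ ?N * half_sphere_integral ?F s) (at s)"
      by (rule half_ball_integral_has_derivative[OF bF s])
    have 3: "((\<lambda>s. s ^ Suc ?N) has_real_derivative real (Suc ?N) * s ^ ?N) (at s)"
      using DERIV_pow[of "Suc ?N" s] by simp
    have "half_sphere_integral ?F s = half_sphere_integral (\<lambda>x. (real ?N + 1) * (u x)\<^sup>2 + s * (((2 * u x) *\<^sub>R G x) \<bullet> (x /\<^sub>R norm x))) s"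
      using s by (intro half_sphere_integral_cong) (auto simp: field_simps)
    also have "\<dots> = half_sphere_integral (\<lambda>x. (real ?N + 1) * (u x)\<^sup>2) s + half_sphere_integral (\<lambda>x. s * (((2 * u x) *\<^sub>R G x) \<bullet> (x /\<^sub>R norm x))) s"
      by (intro half_sphere_integral_add s bounded_continuous_on_mult bounded_continuous_on_const bc_uu bounded_continuous_on_inner b2 bc_nu)
    also have "\<dots> = (real ?N + 1) * half_sphere_integral (\<lambda>x. (u x)\<^sup>2) s + s * ?S2" unfolding half_sphere_integral_cmult ..
    finally have F: "half_sphere_integral ?F s = (real ?N + 1) * half_sphere_integral (\<lambda>x. (u x)\<^sup>2) s + s * ?S2" .
    have "real (Suc ?N) * s ^ ?N * half_sphere_integral (\<lambda>x. (u x)\<^sup>2) s + ?S2 * s ^ Suc ?N - s ^ ?N * half_sphere_integral ?F s = 0"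
      unfolding F by (simp add: algebra_simps)
    with DERIV_diff[OF DERIV_mult[OF 3 1] 2] show ?thesis by simp
  qed
  obtain K where K: "0 < K" "\<And>x. x \<in> H \<Longrightarrow> norm (?F x) \<le> K" using bounded_continuous_onE[OF bF] by blast
  let ?c = "half_sphere_integral (\<lambda>_::'b \<times> real. 1) 1"
  have c: "half_sphere_integral (\<lambda>_::'b \<times> real. 1) s = ?c" for s unfolding half_sphere_integral_const ..
  have small: "\<bar>?T s - ?P s\<bar> \<le> (M\<^sup>2 * ?c + K * measure lborel H) * s" if s: "0 < s" "s < 1" for s
  proof -
    have "\<bar>half_sphere_integral (\<lambda>x. (u x)\<^sup>2) s\<bar> \<le> M\<^sup>2 * half_sphere_integral (\<lambda>_::'b \<times> real. 1) s"
    proof (rule half_sphere_integral_bound[OF bc_uu s])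
      fix x :: "'b \<times> real" assume "norm x = s" "0 < snd x"
      then have "x \<in> H" using s by (simp add: mem_half_ball)
      then show "\<bar>(u x)\<^sup>2\<bar> \<le> M\<^sup>2" using bound_u[of x] M by (simp add: abs_le_square_iff[symmetric])
    qed
    then have "\<bar>?T s\<bar> \<le> s ^ Suc ?N * (M\<^sup>2 * ?c)" unfolding c[of s] abs_mult using s by (simp add: mult_left_mono)
    moreover have "\<bar>?P s\<bar> \<le> K * (measure lborel H * s ^ Suc ?N)"
    proof -
      have x: "x \<in> half_ball s \<Longrightarrow> \<bar>?F x\<bar> \<le> K" for x using K(2)[of x] s by (simp add: mem_half_ball)
      have "?P s \<le> K * (measure lborel H * s ^ Suc ?N)"
        using s x by (intro half_ball_integral_le_const half_ball_integrable bF) (auto simp: abs_le_iff)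
      moreover have "(LINT x:half_ball s|lborel. (-1) * ?F x) \<le> K * (measure lborel H * s ^ Suc ?N)"
        using s x by (intro half_ball_integral_le_const half_ball_integrable bounded_continuous_on_mult bounded_continuous_on_const bF) (auto simp: abs_le_iff)
      ultimately show ?thesis unfolding set_integral_mult_right by linarith
    qed
    ultimately have "\<bar>?T s - ?P s\<bar> \<le> s ^ Suc ?N * (M\<^sup>2 * ?c + K * measure lborel H)" by (simp add: algebra_simps)
    also have "\<dots> \<le> s * (M\<^sup>2 * ?c + K * measure lborel H)"
    proof (rule mult_right_mono)
      show "s ^ Suc ?N \<le> s" using s power_decreasing[of 1 "Suc ?N" s] by simp
      show "0 \<le> M\<^sup>2 * ?c + K * measure lborel H" unfolding half_sphere_integral_const using K by simp
    qed
    finally show ?thesis by (simp add: mult.commute)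
  qed
  have const: "?T s - ?P s = ?T r - ?P r" if s: "0 < s" "s < 1" for s
    using DERIV_isconst3[of 0 1 s r "\<lambda>s. ?T s - ?P s"] d0 s r by auto
  have "\<bar>?T r - ?P r\<bar> \<le> 0 + e" if e: "0 < e" for e
  proof -
    let ?C = "M\<^sup>2 * ?c + K * measure lborel H"
    have C: "0 < ?C" unfolding half_sphere_integral_const using K vol_pos by (intro add_nonneg_pos) auto
    obtain s where s: "0 < s" "s < 1" "s < e / ?C" using field_lbound_gt_zero[of 1 "e / ?C"] e C by auto
    have "\<bar>?T r - ?P r\<bar> \<le> ?C * s" using small[OF s(1,2)] const[OF s(1,2)] by simp
    also have "\<dots> \<le> e" using s(3) C by (simp add: field_simps)
    finally show ?thesis by simp
  qed
  then have "\<bar>?T r - ?P r\<bar> \<le> 0" by (rule field_le_epsilon)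
  then show ?thesis by simp
qed

text \<open>In the trace identity, \<open>2 * (u x * (G x \<bullet> x))\<close> is split into
  squares; the square of \<open>u\<close> raises the coefficient to \<open>DIM('b) + 2\<close>, the
  other gives \<open>r\<^sup>2 * D r\<close>.\<close>

lemma height_le:
  assumes r: "0 < r" "r < 1"
  shows "r ^ Suc DIM('b) * half_sphere_integral (\<lambda>x. (u x)\<^sup>2) r \<le> (real DIM('b) + 2) * U r + r\<^sup>2 * D r"
proof -
  let ?N = "DIM('b)"
  have i: "set_integrable lborel (half_ball r) (\<lambda>x. (real ?N + 2) * (u x)\<^sup>2)" "set_integrable lborel (half_ball r) (\<lambda>x. r\<^sup>2 * (G x \<bullet> G x))"
    using r by (auto intro!: half_ball_integrable bounded_continuous_on_mult bounded_continuous_on_const bc_uu bc_GG)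
  have "(LINT x:half_ball r|lborel. (real ?N + 1) * (u x)\<^sup>2 + 2 * (u x * (G x \<bullet> x))) \<le> (LINT x:half_ball r|lborel. (real ?N + 2) * (u x)\<^sup>2 + r\<^sup>2 * (G x \<bullet> G x))"
  proof (rule set_integral_mono)
    show "set_integrable lborel (half_ball r) (\<lambda>x. (real ?N + 1) * (u x)\<^sup>2 + 2 * (u x * (G x \<bullet> x)))"
      using r by (intro half_ball_integrable bounded_continuous_on_add bounded_continuous_on_mult bounded_continuous_on_const bc_uu bc_u bounded_continuous_on_inner bc_G bc_x) auto
    show "set_integrable lborel (half_ball r) (\<lambda>x. (real ?N + 2) * (u x)\<^sup>2 + r\<^sup>2 * (G x \<bullet> G x))" by (intro set_integral_add i)
    fix x :: "'b \<times> real" assume "x \<in> half_ball r"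
    then have x: "norm x \<le> r" by (simp add: mem_half_ball)
    have "2 * (u x * (G x \<bullet> x)) \<le> (u x)\<^sup>2 + (G x \<bullet> x)\<^sup>2"
      using sum_squares_bound[of "u x" "G x \<bullet> x"] by (simp add: mult_ac)
    also have "(G x \<bullet> x)\<^sup>2 \<le> (G x \<bullet> G x) * (x \<bullet> x)" by (rule Cauchy_Schwarz_ineq)
    also have "(G x \<bullet> G x) * (x \<bullet> x) \<le> (G x \<bullet> G x) * r\<^sup>2"
      using power_mono[OF x norm_ge_zero, of 2] by (intro mult_left_mono[OF _ inner_ge_zero]) (simp only: dot_square_norm)
    finally show "(real ?N + 1) * (u x)\<^sup>2 + 2 * (u x * (G x \<bullet> x)) \<le> (real ?N + 2) * (u x)\<^sup>2 + r\<^sup>2 * (G x \<bullet> G x)"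
      by (simp add: algebra_simps)
  qed
  also have "\<dots> = (real ?N + 2) * U r + r\<^sup>2 * D r"
    unfolding U_def D_def set_integral_add(2)[OF i] set_integral_mult_right ..
  finally show ?thesis unfolding trace_identity[OF r] .
qed

end

section \<open>Monotonicity of the truncated frequency\<close>

context signorini_solution begin

text \<open>The even reflection makes the height \<open>2 h\<close>.\<close>

definition h :: "real \<Rightarrow> real" where "h r = r ^ DIM('b) * half_sphere_integral (\<lambda>x. (u x)\<^sup>2) r"
definition I :: "real \<Rightarrow> real" where "I r = r ^ DIM('b) * half_sphere_integral (\<lambda>x. u x * (G x \<bullet> (x /\<^sub>R norm x))) r"

lemma h_has_derivative:
  assumes r: "0 < r" "r < 1"
  shows "(h has_real_derivative real DIM('b) / r * h r + 2 * I r) (at r)"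
proof -
  have du: "((\<lambda>x. (u x)\<^sup>2) has_derivative (\<lambda>h. ((2 * u x) *\<^sub>R G x) \<bullet> h)) (at x)" if "x \<in> H" for x
    using has_derivative_power[OF der_at[OF that], of 2] by (simp add: mult_ac)
  have b2: "bounded_continuous_on H (\<lambda>x. (2 * u x) *\<^sub>R G x)"
    by (intro bounded_continuous_on_scaleR bounded_continuous_on_mult bounded_continuous_on_const bc_u bc_G)
  let ?S2 = "half_sphere_integral (\<lambda>x. ((2 * u x) *\<^sub>R G x) \<bullet> (x /\<^sub>R norm x)) r"
  have 1: "(half_sphere_integral (\<lambda>x. (u x)\<^sup>2) has_real_derivative ?S2) (at r)"
    by (rule half_sphere_integral_has_derivative[OF bc_uu b2 du r])
  have 3: "((\<lambda>s. s ^ DIM('b)) has_real_derivative real DIM('b) * r ^ (DIM('b) - Suc 0)) (at r)" by (rule DERIV_pow)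
  have "?S2 = half_sphere_integral (\<lambda>x. 2 * (u x * (G x \<bullet> (x /\<^sub>R norm x)))) r"
    using r by (intro half_sphere_integral_cong) auto
  then have S2: "?S2 = 2 * half_sphere_integral (\<lambda>x. u x * (G x \<bullet> (x /\<^sub>R norm x))) r" unfolding half_sphere_integral_cmult .
  have N: "real DIM('b) * r ^ (DIM('b) - Suc 0) = real DIM('b) / r * r ^ DIM('b)"
    using r DIM_positive[where 'a='b] by (cases "DIM('b)") auto
  have "real DIM('b) * r ^ (DIM('b) - Suc 0) * half_sphere_integral (\<lambda>x. (u x)\<^sup>2) r + ?S2 * r ^ DIM('b) = real DIM('b) / r * h r + 2 * I r"
    unfolding S2 N by (simp add: h_def I_def)
  with DERIV_mult[OF 3 1] show ?thesis unfolding h_def[abs_def] by simp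
qed

lemma I_continuous: "continuous_on {0<..<1} I"
  unfolding I_def[abs_def]
  by (intro continuous_intros half_sphere_integral_continuous bounded_continuous_on_mult bc_u bounded_continuous_on_inner bc_G bc_nu)

lemma h_le:
  assumes r: "0 < r" "r < 1" and k: "1 \<le> k" and C1: "C1 = M\<^sup>2 * measure lborel H + 1 + 2 ^ (DIM('b) + 2)"
  shows "h r \<le> ((real DIM('b) + 2) * C1 + 1) * (r ^ (DIM('b) + 2 * k + 2) + r * D r)"
proof -
  let ?A = "r ^ (DIM('b) + 2 * k + 2)"
  have c: "0 \<le> C1" using vol_pos by (simp add: C1)
  have "r * h r \<le> (real DIM('b) + 2) * U r + r\<^sup>2 * D r" using height_le[OF r] by (simp add: h_def)
  also have "\<dots> \<le> (real DIM('b) + 2) * (C1 * (r ^ (DIM('b) + 2 * k + 3) + r\<^sup>2 * D r)) + r\<^sup>2 * D r"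
    using U_le[OF r k] by (intro add_right_mono mult_left_mono) (auto simp: C1)
  also have "\<dots> = r * ((real DIM('b) + 2) * C1 * (?A + r * D r) + r * D r)"
    by (simp add: power2_eq_square algebra_simps power_add numeral_3_eq_3)
  finally have "h r \<le> (real DIM('b) + 2) * C1 * (?A + r * D r) + r * D r" using r by simp
  also have "\<dots> \<le> (real DIM('b) + 2) * C1 * (?A + r * D r) + 1 * (?A + r * D r)"
    using r by simp
  finally show ?thesis by (simp add: distrib_right)
qed

end

text \<open>The expression is the numerator of the derivative of
  \<open>(s + C * s\<^sup>2) / h * A\<close> at \<open>r\<close>. Cauchy-Schwarz cancels the terms
  with \<open>I\<^sup>2\<close> and \<open>h * b\<close>. Replacing \<open>(N - 1) * D\<close> by
  \<open>(N - 1) * I\<close> cancels the remaining leading terms up to the gain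
  \<open>C * r * I\<close>. This is at least \<open>C * r * D / 2\<close>, whereas the errors are at
  most \<open>2 * r * D * ((N - 1) * C6 + K)\<close>, which explains the condition on
  \<open>C\<close>.\<close>

lemma frequency_increment_positive:
  fixes C :: real
  assumes r: "0 < r" and N: "1 \<le> (N::real)" and h: "0 < h" and D: "0 < D" and Cr: "C * r \<le> 1" and C: "0 < C"
    and Dh: "\<bar>E\<bar> \<le> C6 * r * D" "C6 * r \<le> 1 / 2" and I: "I = D + E" and cs: "I\<^sup>2 \<le> h * b"
    and A': "(N - 1) * D + 2 * r * b - K * r * D \<le> r * A'" and CK: "4 * ((N - 1) * C6 + K) < C" "0 \<le> K" "0 \<le> C6"
  shows "0 < ((1 + 2 * C * r) * h - (r + C * r\<^sup>2) * (N / r * h + 2 * I)) * I + (r + C * r\<^sup>2) * h * A'"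
proof -
  let ?c = "1 + C * r"
  have c: "1 \<le> ?c" "?c \<le> 2" using C r Cr by auto
  have I2: "D / 2 \<le> I"
  proof -
    have "C6 * r * D \<le> 1 / 2 * D" using Dh(2) D by (intro mult_right_mono) auto
    then show ?thesis using Dh(1) I by linarith
  qed
  have "I * (C * r) - ?c * r * D * ((N - 1) * C6 + K) \<le> I * ((1 + 2 * C * r) - ?c * N) + ?c * ((N - 1) * D - K * r * D)"
  proof -
    have "(N - 1) * (I - C6 * r * D) \<le> (N - 1) * D" using Dh(1) I N by (intro mult_left_mono) auto
    then have "?c * ((N - 1) * (I - C6 * r * D)) \<le> ?c * ((N - 1) * D)" by (rule mult_left_mono) (use c in simp)
    then show ?thesis by (simp add: algebra_simps)
  qed
  moreover have "0 < I * (C * r) - ?c * r * D * ((N - 1) * C6 + K)"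
  proof -
    have "?c * (r * D * ((N - 1) * C6 + K)) \<le> 2 * (r * D * ((N - 1) * C6 + K))"
      using c r D N CK by (intro mult_right_mono mult_nonneg_nonneg add_nonneg_nonneg) auto
    also have "\<dots> = (r * D / 2) * (4 * ((N - 1) * C6 + K))" by simp
    also have "\<dots> < (r * D / 2) * C" using r D CK by (intro mult_strict_left_mono) auto
    also have "\<dots> = (D / 2) * (C * r)" by simp
    also have "\<dots> \<le> I * (C * r)" using I2 C r by (intro mult_right_mono) auto
    finally show ?thesis by (simp add: mult.assoc)
  qed
  ultimately have pos: "0 < h * (I * ((1 + 2 * C * r) - ?c * N) + ?c * ((N - 1) * D - K * r * D))"
    using h by (intro mult_pos_pos) auto
  have "?c * h * ((N - 1) * D + 2 * r * b - K * r * D) \<le> ?c * h * (r * A')"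
    using A' c h by (intro mult_left_mono) auto
  moreover have "2 * r * ?c * I\<^sup>2 \<le> 2 * r * ?c * (h * b)" using cs r c by (intro mult_left_mono) auto
  moreover have "((1 + 2 * C * r) * h - (r + C * r\<^sup>2) * (N / r * h + 2 * I)) * I + (r + C * r\<^sup>2) * h * A'
     = h * I * ((1 + 2 * C * r) - ?c * N) - 2 * r * ?c * I\<^sup>2 + ?c * h * (r * A')"
    using r by (simp add: field_simps power2_eq_square)
  ultimately show ?thesis using pos by (simp add: algebra_simps)
qed

context signorini_solution begin

text \<open>Each constant bounds one quantity by the energy where the truncation is inactive:
  \<open>C3\<close> the power \<open>r ^ (n - 2 + 2 * k)\<close>, \<open>C4\<close> the height,
  \<open>C5\<close> the integral of \<open>u^2\<close>, \<open>C6\<close> the integral of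
  \<open>f * u\<close>, \<open>C7\<close> the error in the Rellich identity, \<open>C8\<close> the
  derivative of the integral of \<open>|u|\<close>. The final \<open>+ 1\<close> in \<open>C\<close>
  supplies the strict inequality in the increment lemma.\<close>

lemma frequency_locally_increasing:
  fixes C1 C2 C3 C5 C6 C7 C8 C r :: real
  defines "w0 \<equiv> measure lborel H" and "c1 \<equiv> half_sphere_integral (\<lambda>_::'b \<times> real. 1) 1"
  assumes k: "1 \<le> k"
    and C1: "C1 = M\<^sup>2 * w0 + 1 + 2 ^ (DIM('b) + 2)"
    and C2: "C2 = (real DIM('b) + 2) * C1 + 1" and C3: "C3 = 4 * C2"
    and C4: "C4 = C2 * (C3 + 1)" and C5: "C5 = C1 * (C3 + 1)"
    and C6: "C6 = M\<^sup>2 * w0 * C5 * C3 + 1" and C7: "C7 = M\<^sup>2 * w0 * C3 + 1" and C8: "C8 = M\<^sup>2 * c1 * C4 * C3 + 1"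
    and C: "C = 4 * ((real DIM('b) - 1) * C6 + (2 * C7 + C8)) + 1"
    and r: "0 < r" "r < R" and R: "R \<le> 1" "4 * C2 * R \<le> 1" "2 * C6 * R \<le> 1" "C * R \<le> 1"
    and large: "r ^ (DIM('b) + 2 * k) < 2 * h r"
  shows "\<exists>d>0. \<forall>s\<in>{r<..<r+d}. s < R \<longrightarrow>
    (r + C * r\<^sup>2) * ((real DIM('b) / r * h r + 2 * I r) / h r) \<le> (s + C * s\<^sup>2) * ((real DIM('b) / s * h s + 2 * I s) / h s)"
proof -
  let ?N = "DIM('b)"
  have N: "1 \<le> ?N" using DIM_positive[where 'a='b] by linarith
  have r1: "r < 1" using r R by simp
  have w0: "0 < w0" using vol_pos by (simp add: w0_def)
  have c1: "0 < c1" unfolding c1_def half_sphere_integral_const using vol_pos by simp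
  have C1p: "1 \<le> C1" using w0 by (simp add: C1)
  have C2p: "1 \<le> C2" using C1p by (simp add: C2)
  have C3p: "1 \<le> C3" using C2p by (simp add: C3)
  have C5p: "0 \<le> C5" using C1p C3p by (simp add: C5)
  have C4p: "0 \<le> C4" using C2p C3p by (simp add: C4)
  have C6p: "0 \<le> C6" "0 \<le> C7" "0 \<le> C8" using w0 c1 C3p C4p C5p by (auto simp: C6 C7 C8)
  have Np: "0 \<le> real ?N - 1" using N by simp
  have Cp: "0 < C" using C6p Np by (simp add: C add_nonneg_pos)
  \<comment> \<open>Since \<open>n = ?N + 1\<close>, this is \<open>r ^ (n - 2 + 2 * k)\<close>, the
    truncation power divided by \<open>r\<close>.\<close>
  let ?p = "r ^ (?N + 2 * k - 1)"
  have p: "r ^ (?N + 2 * k) = r * ?p" using N by (metis Suc_diff_1 add_gr_0 less_le_trans power_Suc zero_less_one)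
  have p0: "0 < ?p" using r by simp
  have hpos: "0 < h r"
  proof -
    have "0 < r ^ (?N + 2 * k)" using r by simp
    then show ?thesis using large by linarith
  qed
  have rr: "r * r \<le> r" "r * r * r \<le> 1" using r r1 by (auto simp: mult_le_one mult_left_le)
  \<comment> \<open>The truncation power is below twice \<open>h r\<close>, and the bound for
    \<open>h r\<close> contains that power again with an additional \<open>r\<^sup>2\<close>. As
    \<open>4 * C2 * r\<^sup>2 \<le> 1\<close>, half of the left-hand side absorbs it and only the
    energy remains.\<close>
  have pD: "?p \<le> C3 * D r"
  proof -
    have "4 * C2 * r \<le> 4 * C2 * R" using r C2p by (intro mult_left_mono) auto
    then have "4 * C2 * r \<le> 1" using R by linarith
    then have *: "4 * C2 * (r * r) \<le> 1" using rr C2p by (smt (verit) mult_left_mono)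
    have "r * ?p < 2 * (C2 * (r ^ (?N + 2 * k + 2) + r * D r))" using large h_le[OF r(1) r1 k C1[unfolded w0_def]] unfolding p C2 by linarith
    also have "r ^ (?N + 2 * k + 2) = r * r * (r * ?p)" unfolding power_add[of r "?N + 2 * k" 2] p by (simp only: power2_eq_square mult_ac)
    also have "2 * (C2 * (r * r * (r * ?p) + r * D r)) = (4 * C2 * (r * r)) * (r * ?p) / 2 + 2 * C2 * (r * D r)" by (simp add: algebra_simps)
    also have "\<dots> \<le> 1 * (r * ?p) / 2 + 2 * C2 * (r * D r)"
      using * r p0 by (intro add_right_mono divide_right_mono mult_right_mono) auto
    finally have "r * ?p \<le> r * (C3 * D r)" by (simp add: C3 algebra_simps)
    then show ?thesis using r by simp
  qed
  have Dpos: "0 < D r" using pD p0 C3p by (smt (verit) mult_nonneg_nonpos zero_less_mult_iff)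
  have hD: "h r \<le> C4 * (r * D r)"
  proof -
    have "r ^ (?N + 2 * k + 2) = r * (r * r * ?p)" unfolding power_add[of r "?N + 2 * k" 2] p by (simp only: power2_eq_square mult_ac)
    also have "\<dots> \<le> r * (1 * (C3 * D r))" using r pD p0 rr r1 by (intro mult_left_mono mult_mono) (auto simp: mult_le_one)
    finally have "h r \<le> C2 * (r * (1 * (C3 * D r)) + r * D r)"
      using h_le[OF r(1) r1 k C1[unfolded w0_def]] C2p unfolding C2[symmetric] by (smt (verit) mult_left_mono)
    then show ?thesis by (simp add: C4 algebra_simps)
  qed
  have UD: "U r \<le> C5 * (r\<^sup>2 * D r)"
  proof -
    have "r ^ (?N + 2 * k + 3) = r\<^sup>2 * (r * r * ?p)" unfolding power_add[of r "?N + 2 * k" 3] p by (simp only: power2_eq_square power3_eq_cube mult_ac)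
    also have "\<dots> \<le> r\<^sup>2 * (1 * (C3 * D r))" using r pD p0 rr r1 by (intro mult_left_mono mult_mono) (auto simp: mult_le_one)
    finally have "U r \<le> C1 * (r\<^sup>2 * (1 * (C3 * D r)) + r\<^sup>2 * D r)"
      using U_le[OF r(1) r1 k] C1p unfolding C1[unfolded w0_def, symmetric] by (smt (verit) mult_left_mono)
    then show ?thesis by (simp add: C5 algebra_simps)
  qed
  \<comment> \<open>The square of the weight on \<open>f\<close> times the volume factor is exactly
    \<open>?p\<close>, so each squared error can exchange this product for
    \<open>C3 * D r\<close>.\<close>
  have rk: "(r ^ (k - 1))\<^sup>2 * r ^ Suc ?N = ?p"
  proof -
    have "(r ^ (k - 1))\<^sup>2 * r ^ Suc ?N = r ^ ((k - 1) * 2 + Suc ?N)" by (simp only: power_mult power_add)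
    also have "(k - 1) * 2 + Suc ?N = ?N + 2 * k - 1" using k by simp
    finally show ?thesis .
  qed
  \<comment> \<open>Square roots of constants are avoided by using \<open>Y + 1\<close> as an upper
    bound for the root of \<open>Y\<close>; this is the \<open>+ 1\<close> in \<open>C6\<close>,
    \<open>C7\<close> and \<open>C8\<close>.\<close>
  have sq_bound: "X \<le> (Y + 1) * Z" if "X\<^sup>2 \<le> Y * Z\<^sup>2" "0 \<le> Y" "0 \<le> Z" for X Y Z :: real
  proof (rule power2_le_imp_le)
    have "Y * Z\<^sup>2 \<le> (Y + 1)\<^sup>2 * Z\<^sup>2" using that by (intro mult_right_mono) (auto simp: power2_eq_square algebra_simps)
    then show "X\<^sup>2 \<le> ((Y + 1) * Z)\<^sup>2" using that by (simp add: power_mult_distrib)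
  qed (use that in simp)
  define E where "E s = (LINT x:half_ball s|lborel. f x * u x)" for s
  define Q where "Q s = (LINT x:half_ball s|lborel. \<bar>u x\<bar>)" for s
  define b where "b = r ^ ?N * half_sphere_integral (\<lambda>x. (G x \<bullet> (x /\<^sub>R norm x))\<^sup>2) r"
  define D' where "D' = r ^ ?N * half_sphere_integral (\<lambda>x. G x \<bullet> G x) r"
  define Q' where "Q' = r ^ ?N * half_sphere_integral (\<lambda>x. \<bar>u x\<bar>) r"
  have I_eq: "I s = D s + E s" if "0 < s" "s < 1" for s
    using energy_identity[OF that] by (simp add: I_def E_def)
  have bau: "bounded_continuous_on H (\<lambda>x. \<bar>u x\<bar>)" by (rule bounded_continuous_on_abs[OF bc_u])
  have iau: "set_integrable lborel (half_ball s) (\<lambda>x. \<bar>u x\<bar>)" if "s \<le> 1" for s by (rule half_ball_integrable[OF bau that])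
  have ifu: "set_integrable lborel (half_ball s) (\<lambda>x. f x * u x)" if "s \<le> 1" for s
    by (rule bounded_measurable_mult_integrable[OF f bound_f1 bc_u that])
  have E_le: "\<bar>E r\<bar> \<le> C6 * r * D r"
  proof -
    have "\<bar>E r\<bar> \<le> M * r ^ (k - 1) * Q r"
    proof -
      have b: "\<bar>f x * u x\<bar> \<le> M * r ^ (k - 1) * \<bar>u x\<bar>" if "x \<in> half_ball r" for x
        unfolding abs_mult using bound_f'[OF that] r1 by (intro mult_right_mono) auto
      have "E r \<le> (LINT x:half_ball r|lborel. M * r ^ (k - 1) * \<bar>u x\<bar>)" unfolding E_def
        using r1 b by (intro set_integral_mono ifu set_integrable_mult_right iau) (auto simp: abs_le_iff)
      moreover have "(LINT x:half_ball r|lborel. (- (M * r ^ (k - 1))) * \<bar>u x\<bar>) \<le> E r" unfolding E_def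
        using r1 b by (intro set_integral_mono ifu set_integrable_mult_right iau) (force simp: abs_le_iff)+
      moreover have "(LINT x:half_ball r|lborel. M * r ^ (k - 1) * \<bar>u x\<bar>) = M * r ^ (k - 1) * Q r"
          "(LINT x:half_ball r|lborel. (- (M * r ^ (k - 1))) * \<bar>u x\<bar>) = - (M * r ^ (k - 1) * Q r)"
        unfolding set_integral_mult_right Q_def by (rule refl, rule mult_minus_left)
      ultimately show ?thesis by (intro abs_leI) linarith+
    qed
    moreover have "M * r ^ (k - 1) * Q r \<le> (M\<^sup>2 * w0 * C5 * C3 + 1) * (r * D r)"
    proof (rule sq_bound)
      have "(Q r)\<^sup>2 \<le> w0 * r ^ Suc ?N * U r" unfolding Q_def U_def w0_def
        using abs_integral_square_le[OF bau r(1) r1] by simp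
      also have "\<dots> \<le> w0 * r ^ Suc ?N * (C5 * (r\<^sup>2 * D r))" using w0 r UD by (intro mult_left_mono) auto
      finally have "M\<^sup>2 * (r ^ (k - 1))\<^sup>2 * (Q r)\<^sup>2 \<le> M\<^sup>2 * (r ^ (k - 1))\<^sup>2 * (w0 * r ^ Suc ?N * (C5 * (r\<^sup>2 * D r)))" by (intro mult_left_mono) auto
      also have "\<dots> = (M\<^sup>2 * w0 * C5 * r\<^sup>2 * D r) * ((r ^ (k - 1))\<^sup>2 * r ^ Suc ?N)" by (simp only: mult_ac)
      also have "\<dots> \<le> (M\<^sup>2 * w0 * C5 * r\<^sup>2 * D r) * (C3 * D r)" unfolding rk using pD w0 C5p D_nonneg by (intro mult_left_mono mult_nonneg_nonneg) auto
      finally show "(M * r ^ (k - 1) * Q r)\<^sup>2 \<le> M\<^sup>2 * w0 * C5 * C3 * (r * D r)\<^sup>2"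
        unfolding power_mult_distrib by (simp add: power2_eq_square mult_ac)
    qed (use w0 C5p C3p r Dpos in auto)
    ultimately show ?thesis by (simp add: C6 mult.assoc)
  qed
  have X_le: "M * r ^ (k - 1) * (LINT x:half_ball r|lborel. \<bar>G x \<bullet> x\<bar>) \<le> C7 * (r * D r)"
    unfolding C7
  proof (rule sq_bound)
    let ?X = "LINT x:half_ball r|lborel. \<bar>G x \<bullet> x\<bar>"
    have bX: "bounded_continuous_on H (\<lambda>x. \<bar>G x \<bullet> x\<bar>)" by (intro bounded_continuous_on_abs bounded_continuous_on_inner bc_G bc_x)
    have "?X\<^sup>2 \<le> w0 * r ^ Suc ?N * (LINT x:half_ball r|lborel. \<bar>G x \<bullet> x\<bar>\<^sup>2)"
      unfolding w0_def by (rule abs_integral_square_le[OF bX r(1) r1])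
    also have "(LINT x:half_ball r|lborel. \<bar>G x \<bullet> x\<bar>\<^sup>2) \<le> (LINT x:half_ball r|lborel. r\<^sup>2 * (G x \<bullet> G x))"
    proof (rule set_integral_mono)
      show "set_integrable lborel (half_ball r) (\<lambda>x. \<bar>G x \<bullet> x\<bar>\<^sup>2)" using r1 by (intro half_ball_integrable bounded_continuous_on_power bX) auto
      show "set_integrable lborel (half_ball r) (\<lambda>x. r\<^sup>2 * (G x \<bullet> G x))" using r1 by (intro set_integrable_mult_right half_ball_integrable bc_GG) auto
      fix x :: "'b \<times> real" assume "x \<in> half_ball r"
      then have x: "norm x \<le> r" by (simp add: mem_half_ball)
      have "(G x \<bullet> x)\<^sup>2 \<le> (G x \<bullet> G x) * (x \<bullet> x)" by (rule Cauchy_Schwarz_ineq)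
      also have "(G x \<bullet> G x) * (x \<bullet> x) \<le> (G x \<bullet> G x) * r\<^sup>2"
        using power_mono[OF x norm_ge_zero, of 2] by (intro mult_left_mono[OF _ inner_ge_zero]) (simp only: dot_square_norm)
      finally show "\<bar>G x \<bullet> x\<bar>\<^sup>2 \<le> r\<^sup>2 * (G x \<bullet> G x)" by (simp add: mult.commute)
    qed
    also have "(LINT x:half_ball r|lborel. r\<^sup>2 * (G x \<bullet> G x)) = r\<^sup>2 * D r" unfolding D_def by (rule set_integral_mult_right)
    finally have "?X\<^sup>2 \<le> w0 * r ^ Suc ?N * (r\<^sup>2 * D r)" using w0 r by (simp add: mult_left_mono)
    then have "M\<^sup>2 * (r ^ (k - 1))\<^sup>2 * ?X\<^sup>2 \<le> M\<^sup>2 * (r ^ (k - 1))\<^sup>2 * (w0 * r ^ Suc ?N * (r\<^sup>2 * D r))" by (intro mult_left_mono) auto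
    also have "\<dots> = (M\<^sup>2 * w0 * r\<^sup>2 * D r) * ((r ^ (k - 1))\<^sup>2 * r ^ Suc ?N)" by (simp only: mult_ac)
    also have "\<dots> \<le> (M\<^sup>2 * w0 * r\<^sup>2 * D r) * (C3 * D r)" unfolding rk using pD w0 D_nonneg by (intro mult_left_mono mult_nonneg_nonneg) auto
    finally show "(M * r ^ (k - 1) * ?X)\<^sup>2 \<le> M\<^sup>2 * w0 * C3 * (r * D r)\<^sup>2"
      unfolding power_mult_distrib by (simp add: power2_eq_square mult_ac)
  qed (use w0 C3p r Dpos in auto)
  have Q'_le: "M * r ^ (k - 1) * Q' \<le> C8 * D r"
    unfolding C8
  proof (rule sq_bound)
    have "(half_sphere_integral (\<lambda>x. \<bar>u x\<bar> * 1) r)\<^sup>2 \<le> half_sphere_integral (\<lambda>x. \<bar>u x\<bar>\<^sup>2) r * half_sphere_integral (\<lambda>_::'b \<times> real. 1\<^sup>2) r"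
      by (rule half_sphere_integral_Cauchy_Schwarz[OF bau bounded_continuous_on_const r(1) r1])
    then have "(half_sphere_integral (\<lambda>x. \<bar>u x\<bar>) r)\<^sup>2 \<le> half_sphere_integral (\<lambda>x. (u x)\<^sup>2) r * c1"
      unfolding c1_def half_sphere_integral_const by (simp add: half_sphere_integral_const)
    then have "(r ^ ?N)\<^sup>2 * (half_sphere_integral (\<lambda>x. \<bar>u x\<bar>) r)\<^sup>2 \<le> (r ^ ?N)\<^sup>2 * (half_sphere_integral (\<lambda>x. (u x)\<^sup>2) r * c1)" by (intro mult_left_mono) auto
    then have "Q'\<^sup>2 \<le> r ^ ?N * c1 * h r"
      unfolding Q'_def h_def power_mult_distrib by (simp add: power2_eq_square mult_ac)
    also have "\<dots> \<le> r ^ ?N * c1 * (C4 * (r * D r))" using hD r c1 by (intro mult_left_mono) auto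
    finally have "M\<^sup>2 * (r ^ (k - 1))\<^sup>2 * Q'\<^sup>2 \<le> M\<^sup>2 * (r ^ (k - 1))\<^sup>2 * (r ^ ?N * c1 * (C4 * (r * D r)))" by (intro mult_left_mono) auto
    also have "\<dots> = (M\<^sup>2 * c1 * C4 * D r) * ((r ^ (k - 1))\<^sup>2 * r ^ Suc ?N)" by (simp only: mult_ac power_Suc)
    also have "\<dots> \<le> (M\<^sup>2 * c1 * C4 * D r) * (C3 * D r)" unfolding rk using pD c1 C4p D_nonneg by (intro mult_left_mono mult_nonneg_nonneg) auto
    finally show "(M * r ^ (k - 1) * Q')\<^sup>2 \<le> M\<^sup>2 * c1 * C4 * C3 * (D r)\<^sup>2"
      unfolding power_mult_distrib by (simp add: power2_eq_square mult_ac)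
  qed (use c1 C3p C4p Dpos in auto)
  have cs: "(I r)\<^sup>2 \<le> h r * b"
  proof -
    have "(half_sphere_integral (\<lambda>x. u x * (G x \<bullet> (x /\<^sub>R norm x))) r)\<^sup>2 \<le> half_sphere_integral (\<lambda>x. (u x)\<^sup>2) r * half_sphere_integral (\<lambda>x. (G x \<bullet> (x /\<^sub>R norm x))\<^sup>2) r"
      by (intro half_sphere_integral_Cauchy_Schwarz r(1) r1 bc_u bounded_continuous_on_inner bc_G bc_nu)
    then have "(r ^ ?N)\<^sup>2 * (half_sphere_integral (\<lambda>x. u x * (G x \<bullet> (x /\<^sub>R norm x))) r)\<^sup>2 \<le> (r ^ ?N)\<^sup>2 * (half_sphere_integral (\<lambda>x. (u x)\<^sup>2) r * half_sphere_integral (\<lambda>x. (G x \<bullet> (x /\<^sub>R norm x))\<^sup>2) r)"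
      by (intro mult_left_mono) auto
    then show ?thesis unfolding I_def h_def b_def power_mult_distrib by (simp only: power2_eq_square mult_ac)
  qed
  \<comment> \<open>The lower barrier for \<open>I\<close>. The possibly nondifferentiable increment
    of \<open>E\<close> is replaced by the worst case that the bound for \<open>f\<close> permits,
    which is differentiable because \<open>|u|\<close> is continuous.\<close>
  define A where "A s = D s - M * s ^ (k - 1) * (Q s - Q r) + E r" for s
  define A' where "A' = D' - M * r ^ (k - 1) * Q'"
  have dD: "(D has_real_derivative D') (at r)"
    using half_ball_integral_has_derivative[OF bc_GG r(1) r1] unfolding D_def[abs_def] D'_def .
  have dQ: "(Q has_real_derivative Q') (at r)"
    using half_ball_integral_has_derivative[OF bau r(1) r1] unfolding Q_def[abs_def] Q'_def .
  have dA: "(A has_real_derivative A') (at r)"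
  proof -
    have "((\<lambda>s. M * s ^ (k - 1)) has_real_derivative M * (real (k - 1) * r ^ (k - 1 - Suc 0))) (at r)"
      by (intro DERIV_cmult DERIV_pow)
    moreover have "((\<lambda>s. Q s - Q r) has_real_derivative Q' - 0) (at r)" by (intro DERIV_diff dQ DERIV_const)
    ultimately have "((\<lambda>s. M * s ^ (k - 1) * (Q s - Q r)) has_real_derivative
        M * (real (k - 1) * r ^ (k - 1 - Suc 0)) * (Q r - Q r) + (Q' - 0) * (M * r ^ (k - 1))) (at r)" by (rule DERIV_mult)
    from DERIV_add[OF DERIV_diff[OF dD this] DERIV_const[of "E r"]]
    show ?thesis unfolding A_def[abs_def] A'_def by (simp add: mult_ac)
  qed
  have A'_ge: "(real ?N - 1) * D r + 2 * r * b - (2 * C7 + C8) * r * D r \<le> r * A'"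
  proof -
    have "(real ?N - 1) * D r + 2 * r * b - 2 * (M * r ^ (k - 1) * (LINT x:half_ball r|lborel. \<bar>G x \<bullet> x\<bar>)) \<le> r * D'"
      using rellich[OF r(1) r1] by (simp add: b_def D'_def mult_ac)
    moreover have "r * (M * r ^ (k - 1) * Q') \<le> r * (C8 * D r)" using Q'_le r by (intro mult_left_mono) auto
    ultimately show ?thesis using X_le by (simp add: A'_def algebra_simps)
  qed
  \<comment> \<open>On the shell between the two half balls \<open>f * u\<close> is at least
    \<open>- M * s ^ (k - 1) * \<bar>u\<bar>\<close>, so integration gives exactly the barrier
    term.\<close>
  have I_ge: "A s \<le> I s" if s: "r \<le> s" "s < 1" for s
  proof -
    have eqs: "half_ball s = half_ball r \<union> (half_ball s - half_ball r)" using half_ball_mono[OF s(1)] by blast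
    let ?D = "half_ball s - half_ball r :: ('b \<times> real) set"
    have Dm: "?D \<in> sets borel" by simp
    have i1: "set_integrable lborel ?D (\<lambda>x. f x * u x)" "set_integrable lborel ?D (\<lambda>x. \<bar>u x\<bar>)"
      using set_integrable_subset[OF ifu, of s ?D] set_integrable_subset[OF iau, of s ?D] s Dm by auto
    have ee: "E s = E r + (LINT x:?D|lborel. f x * u x)" "Q s = Q r + (LINT x:?D|lborel. \<bar>u x\<bar>)"
      unfolding E_def Q_def
      by (subst eqs, subst set_integral_Un; use i1 ifu[of r] iau[of r] r1 in auto)+
    have "(LINT x:?D|lborel. (- (M * s ^ (k - 1))) * \<bar>u x\<bar>) \<le> (LINT x:?D|lborel. f x * u x)"
    proof (intro set_integral_mono i1 set_integrable_mult_right)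
      fix x assume "x \<in> ?D"
      then have "\<bar>f x\<bar> * \<bar>u x\<bar> \<le> M * s ^ (k - 1) * \<bar>u x\<bar>" using bound_f'[of x s] s by (intro mult_right_mono) auto
      then show "- (M * s ^ (k - 1)) * \<bar>u x\<bar> \<le> f x * u x"
        unfolding abs_mult[symmetric] mult_minus_left by linarith
    qed
    moreover have "(LINT x:?D|lborel. (- (M * s ^ (k - 1))) * \<bar>u x\<bar>) = - (M * s ^ (k - 1) * (LINT x:?D|lborel. \<bar>u x\<bar>))"
      unfolding set_integral_mult_right by (rule mult_minus_left)
    moreover have "Q s - Q r = (LINT x:?D|lborel. \<bar>u x\<bar>)" using ee(2) by simp
    ultimately show ?thesis unfolding I_eq[OF less_le_trans[OF r(1) s(1)] s(2)] A_def
      using ee(1) by simp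
  qed
  have dh: "(h has_real_derivative real ?N / r * h r + 2 * I r) (at r)" by (rule h_has_derivative[OF r(1) r1])
  \<comment> \<open>The expanded frequency with \<open>I\<close> replaced by the barrier: the
    dimensional part of the derivative of \<open>h\<close> becomes the affine term
    \<open>(1 + C * s) * real ?N\<close>. \<open>B\<close> equals the frequency at \<open>r\<close>
    and lies below it to the right.\<close>
  define B where "B s = (1 + C * s) * real ?N + 2 * ((s + C * s\<^sup>2) / h s * A s)" for s
  let ?h' = "real ?N / r * h r + 2 * I r"
  have dB: "(B has_real_derivative C * real ?N + 2 * ((((1 + 2 * C * r) * h r - (r + C * r\<^sup>2) * ?h') / (h r * h r)) * A r + A' * ((r + C * r\<^sup>2) / h r))) (at r)"
  proof -
    have 1: "((\<lambda>s. s + C * s\<^sup>2) has_real_derivative 1 + 2 * C * r) (at r)" by (auto intro!: derivative_eq_intros)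
    have 2: "((\<lambda>s. (1 + C * s) * real ?N) has_real_derivative C * real ?N) (at r)" by (auto intro!: derivative_eq_intros)
    show ?thesis unfolding B_def[abs_def]
      by (rule DERIV_add[OF 2 DERIV_cmult[OF DERIV_mult[OF DERIV_divide[OF 1 dh] dA]]]) (use hpos in simp)
  qed
  have Ar: "A r = I r" by (simp add: A_def I_eq[OF r(1) r1])
  have Cr: "C * r \<le> 1" using order_trans[OF mult_left_mono[of r R C] R(4)] r Cp by simp
  have C6r: "C6 * r \<le> 1 / 2" using R(3) r C6p(1) order_trans[OF mult_left_mono[of r R C6], of "1/2"] by simp
  have inc: "0 < ((1 + 2 * C * r) * h r - (r + C * r\<^sup>2) * ?h') * I r + (r + C * r\<^sup>2) * h r * A'"
    by (rule frequency_increment_positive[OF r(1) _ hpos Dpos Cr Cp E_le C6r I_eq[OF r(1) r1] cs A'_ge])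
       (use N C C6p in auto)
  have "0 < C * real ?N + 2 * ((((1 + 2 * C * r) * h r - (r + C * r\<^sup>2) * ?h') / (h r * h r)) * A r + A' * ((r + C * r\<^sup>2) / h r))"
  proof -
    have "(((1 + 2 * C * r) * h r - (r + C * r\<^sup>2) * ?h') / (h r * h r)) * A r + A' * ((r + C * r\<^sup>2) / h r)
      = (((1 + 2 * C * r) * h r - (r + C * r\<^sup>2) * ?h') * I r + (r + C * r\<^sup>2) * h r * A') / (h r * h r)"
    proof -
      have "X / (q * q) * y + z * (Y / q) = (X * y + Y * q * z) / (q * q)" if "q \<noteq> 0" for X Y q y z :: real
        using that by (simp add: field_simps)
      then show ?thesis unfolding Ar using hpos by simp
    qed
    also have "\<dots> > 0" using inc hpos by (intro divide_pos_pos) auto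
    finally show ?thesis using Cp by (intro add_nonneg_pos) auto
  qed
  from DERIV_pos_inc_right[OF dB this] obtain d1 where d1: "d1 > 0" "\<And>t. t > 0 \<Longrightarrow> t < d1 \<Longrightarrow> B r < B (r + t)" by blast
  have "isCont h r" using dh by (rule DERIV_isCont)
  then have "eventually (\<lambda>s. 0 < h s) (at r)" using hpos by (auto simp: isCont_def intro: order_tendstoD(1))
  then obtain d2 where d2: "d2 > 0" "\<And>s. s \<noteq> r \<Longrightarrow> dist s r < d2 \<Longrightarrow> 0 < h s" unfolding eventually_at by auto
  have F_eq: "(s + C * s\<^sup>2) * ((real ?N / s * h s + 2 * I s) / h s) = (1 + C * s) * real ?N + 2 * ((s + C * s\<^sup>2) / h s * I s)" if "0 < s" "0 < h s" for s
    using that by (simp add: field_simps power2_eq_square)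
  show ?thesis
  proof (rule exI[of _ "min d1 d2"], intro conjI ballI impI)
    show "0 < min d1 d2" using d1 d2 by simp
    fix s assume s: "s \<in> {r<..<r + min d1 d2}" "s < R"
    have hs: "0 < h s" using s by (intro d2(2)) (auto simp: dist_real_def)
    have s0: "0 < s" "s < 1" using s r R by auto
    have "(r + C * r\<^sup>2) * ((real ?N / r * h r + 2 * I r) / h r) = B r" unfolding F_eq[OF r(1) hpos] B_def Ar ..
    also have "\<dots> \<le> B s" using d1(2)[of "s - r"] s min.cobounded1[of d1 d2] by force
    also have "\<dots> \<le> (1 + C * s) * real ?N + 2 * ((s + C * s\<^sup>2) / h s * I s)"
      unfolding B_def using I_ge[of s] s s0 hs Cp by (intro add_left_mono mult_left_mono divide_nonneg_nonneg) auto
    also have "\<dots> = (s + C * s\<^sup>2) * ((real ?N / s * h s + 2 * I s) / h s)" by (rule F_eq[OF s0(1) hs, symmetric])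
    finally show "(r + C * r\<^sup>2) * ((real ?N / r * h r + 2 * I r) / h r) \<le> (s + C * s\<^sup>2) * ((real ?N / s * h s + 2 * I s) / h s)" .
  qed
qed

end

section \<open>The Signorini class\<close>

lemma integral_scale_measure:
  fixes F :: "'a \<Rightarrow> real"
  assumes [measurable]: "F \<in> borel_measurable M" and c: "0 \<le> c"
  shows "(LINT x|scale_measure (ennreal c) M. F x) = c * (LINT x|M. F x)"
proof -
  have "scale_measure (ennreal c) M = density M (\<lambda>_. ennreal c)"
    by (rule measure_eqI) (auto simp: emeasure_density nn_integral_cmult)
  then show ?thesis using c by (simp add: integral_density)
qed

lemma lborel_reflect:
  "distr lborel borel (\<lambda>x::'b::euclidean_space \<times> real. (fst x, - snd x)) = lborel"
proof -
  let ?c = "\<lambda>j::'b \<times> real. if j = (0, 1) then - 1 else 1 :: real"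
  have T: "0 + (\<Sum>j\<in>Basis. (?c j * (x \<bullet> j)) *\<^sub>R j) = (fst x, - snd x)" for x :: "'b \<times> real"
  proof (rule euclidean_eqI)
    fix i :: "'b \<times> real" assume i: "i \<in> Basis"
    have "(0 + (\<Sum>j\<in>Basis. (?c j * (x \<bullet> j)) *\<^sub>R j)) \<bullet> i = ?c i * (x \<bullet> i)" using i by (simp add: inner_sum_left_Basis)
    also have "\<dots> = (fst x, - snd x) \<bullet> i" using i by (auto simp: Basis_prod_def inner_prod_def)
    finally show "(0 + (\<Sum>j\<in>Basis. (?c j * (x \<bullet> j)) *\<^sub>R j)) \<bullet> i = (fst x, - snd x) \<bullet> i" .
  qed
  have "lborel = density (distr lborel borel (\<lambda>x::'b \<times> real. 0 + (\<Sum>j\<in>Basis. (?c j * (x \<bullet> j)) *\<^sub>R j))) (\<lambda>_. (\<Prod>j\<in>Basis. \<bar>?c j\<bar>))"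
    by (rule lborel_affine_euclidean) auto
  moreover have "(\<Prod>j\<in>(Basis :: ('b \<times> real) set). \<bar>?c j\<bar>) = 1" by (rule prod.neutral) auto
  ultimately show ?thesis unfolding T by (simp add: density_1)
qed

lemma AE_snd_nonzero: "AE x::'b::euclidean_space \<times> real in lborel. snd x \<noteq> 0"
proof (rule AE_I')
  have "emeasure lborel (UNIV \<times> {0} :: ('b \<times> real) set) = emeasure lborel (UNIV :: 'b set) * emeasure lborel {0::real}"
    unfolding lborel_prod[symmetric] by (rule lborel.emeasure_pair_measure_Times) auto
  moreover have "(UNIV \<times> {0} :: ('b \<times> real) set) \<in> sets lborel"
  proof -
    have "(UNIV \<times> {0} :: ('b \<times> real) set) \<in> sets (borel \<Otimes>\<^sub>M borel)" by (intro pair_measureI) auto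
    then show ?thesis unfolding borel_prod by simp
  qed
  ultimately show "(UNIV \<times> {0} :: ('b \<times> real) set) \<in> null_sets lborel" by (intro null_setsI) auto
qed auto

text \<open>The surface measure is a pushforward from the ball of radius \<open>r\<close>. Rescaling
  to the unit ball contributes \<open>r ^ n\<close>, which with the normalisation
  \<open>n / r\<close> gives \<open>n * r ^ (n - 1)\<close>, \<open>n\<close> being the
  dimension.\<close>

lemma height_eq_integral:
  fixes v :: "'a::euclidean_space \<Rightarrow> real" and r :: real
  assumes cont: "continuous_on (sphere 0 r) v" and r: "0 < r"
  shows "height v r = DIM('a) * r ^ (DIM('a) - 1) * (LINT z|lborel. indicator (ball 0 1 - {0}) z *\<^sub>R (v ((r / norm z) *\<^sub>R z))\<^sup>2)"
proof -
  let ?n = "DIM('a)"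
  let ?B = "ball (0::'a) r - {0}"
  let ?T = "\<lambda>x::'a. (r / norm x) *\<^sub>R x"
  let ?F = "\<lambda>x. indicator (sphere 0 r) x *\<^sub>R (v x)\<^sup>2"
  have Fm: "?F \<in> borel_measurable borel"
    by (intro borel_measurable_continuous_on_indicator continuous_intros cont) simp
  have Tm[measurable]: "?T \<in> borel_measurable borel" by measurable
  have Bm: "?B \<in> sets borel" by simp
  have Tr: "?T \<in> measurable (restrict_space lborel ?B) borel" by (rule measurable_restrict_space1) simp
  have FT: "(\<lambda>x. ?F (?T x)) \<in> borel_measurable borel" using measurable_compose[OF Tm Fm] .
  have "height v r = (real ?n / r) * (LINT x|distr (restrict_space lborel ?B) borel ?T. ?F x)"
    unfolding height_def set_lebesgue_integral_def sphere_surface_measure_def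
    using r Fm by (intro integral_scale_measure) auto
  also have "(LINT x|distr (restrict_space lborel ?B) borel ?T. ?F x) = (LINT x|restrict_space lborel ?B. ?F (?T x))"
    by (rule integral_distr[OF Tr Fm])
  also have "\<dots> = (LINT x|lborel. indicator ?B x *\<^sub>R ?F (?T x))"
    by (rule integral_restrict_space) simp
  also have "\<dots> = \<bar>r\<bar> ^ ?n * (LINT z|lborel. indicator ?B (0 + r *\<^sub>R z) *\<^sub>R ?F (?T (0 + r *\<^sub>R z)))"
  proof (rule lborel_integral_affine)
    show "(\<lambda>x. indicator ?B x *\<^sub>R ?F (?T x)) \<in> borel_measurable borel"
      by (intro borel_measurable_scaleR borel_measurable_indicator Bm FT)
  qed (use r in simp)
  also have "(\<lambda>z. indicator ?B (0 + r *\<^sub>R z) *\<^sub>R ?F (?T (0 + r *\<^sub>R z))) = (\<lambda>z. indicator (ball 0 1 - {0}) z *\<^sub>R (v ((r / norm z) *\<^sub>R z))\<^sup>2)"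
    using r by (auto simp: fun_eq_iff indicator_def)
  finally have "height v r = (real ?n / r) * (\<bar>r\<bar> ^ ?n * (LINT z|lborel. indicator (ball 0 1 - {0}) z *\<^sub>R (v ((r / norm z) *\<^sub>R z))\<^sup>2))" .
  moreover have "(real ?n / r) * \<bar>r\<bar> ^ ?n = real ?n * r ^ (?n - 1)"
    using r DIM_positive[where 'a='a] by (cases ?n) auto
  ultimately show ?thesis by (simp only: mult.assoc[symmetric])
qed

text \<open>Apart from the null set \<open>snd z = 0\<close>, the unit ball is the union of the half
  ball and its mirror image. Reflection preserves Lebesgue measure and the even extension, so the
  two halves contribute equally.\<close>

lemma height_even_extension:
  fixes u :: "(real ^ 'm) \<times> real \<Rightarrow> real"
  assumes cont: "continuous_on upper_ball u" and bc: "bounded_continuous_on (half_ball 1) u" and r: "0 < r" "r < 1"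
  shows "height (even_extension u) r = 2 * (r ^ DIM(real ^ 'm) * half_sphere_integral (\<lambda>x. (u x)\<^sup>2) r)"
proof -
  let ?v = "even_extension u"
  let ?R = "\<lambda>x::(real ^ 'm) \<times> real. (fst x, - snd x)"
  let ?w = "\<lambda>z. indicator (half_ball 1) z *\<^sub>R (u ((r / norm z) *\<^sub>R z))\<^sup>2"
  have nv: "norm (fst x, \<bar>snd x\<bar>) = norm x" for x :: "(real ^ 'm) \<times> real"
    by (simp add: norm_Pair norm_prod_def)
  have "continuous_on (sphere 0 r) ?v"
    unfolding even_extension_def[abs_def]
    by (rule continuous_on_compose2[OF cont]) (use r nv in \<open>auto intro!: continuous_intros simp: upper_ball_def\<close>)
  note h = height_eq_integral[OF this r(1)]
  have iw: "integrable lborel ?w"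
    using ray_integrable[OF bounded_continuous_on_power[OF bc, of 2] r] by (simp add: set_integrable_def)
  have Rm: "?R \<in> borel_measurable borel" by (intro borel_measurable_continuous_onI continuous_intros)
  have wm: "?w \<in> borel_measurable borel" using iw by auto
  have iwR: "integrable lborel (\<lambda>z. ?w (?R z))"
    using iw wm Rm by (subst integrable_distr_eq[symmetric, of ?R lborel borel ?w]) (auto simp: lborel_reflect)
  have eR: "(LINT z|lborel. ?w (?R z)) = (LINT z|lborel. ?w z)"
    using integral_distr[of ?R lborel borel ?w] wm Rm by (simp add: lborel_reflect)
  have nR: "norm (?R z) = norm z" for z by (simp add: norm_Pair norm_prod_def)
  have "(LINT z|lborel. indicator (ball 0 1 - {0}) z *\<^sub>R (?v ((r / norm z) *\<^sub>R z))\<^sup>2) = (LINT z|lborel. ?w z + ?w (?R z))"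
  proof (rule integral_cong_AE)
    show "(\<lambda>z. ?w z + ?w (?R z)) \<in> borel_measurable lborel" using iw iwR by simp
    show "AE z in lborel. indicator (ball 0 1 - {0}) z *\<^sub>R (?v ((r / norm z) *\<^sub>R z))\<^sup>2 = ?w z + ?w (?R z)"
      using AE_snd_nonzero
    proof eventually_elim
      fix z :: "(real ^ 'm) \<times> real" assume z: "snd z \<noteq> 0"
      show "indicator (ball 0 1 - {0}) z *\<^sub>R (?v ((r / norm z) *\<^sub>R z))\<^sup>2 = ?w z + ?w (?R z)"
      proof (cases "norm z < 1")
        case False
        then show ?thesis using nR[of z] by (simp add: indicator_def mem_half_ball)
      next
        case True
        have z0: "z \<noteq> 0" using z by auto
        have a: "?v ((r / norm z) *\<^sub>R z) = u ((r / norm z) *\<^sub>R (fst z, \<bar>snd z\<bar>))"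
          using r by (simp add: even_extension_def abs_mult)
        show ?thesis
        proof (cases "0 < snd z")
          case p: True
          then have "(fst z, \<bar>snd z\<bar>) = z" by (simp add: prod_eq_iff)
          then show ?thesis unfolding a using True z0 p by (simp add: indicator_def mem_half_ball)
        next
          case False
          then have n: "snd z < 0" using z by simp
          then have "(fst z, \<bar>snd z\<bar>) = ?R z" by simp
          then show ?thesis unfolding a using True z0 n nR[of z] by (simp add: indicator_def mem_half_ball)
        qed
      qed
    qed
    have vm: "(\<lambda>z. indicator (sphere 0 r) ((r / norm z) *\<^sub>R z) *\<^sub>R (?v ((r / norm z) *\<^sub>R z))\<^sup>2) \<in> borel_measurable borel"
    proof -
      have F: "(\<lambda>x. indicator (sphere 0 r) x *\<^sub>R (?v x)\<^sup>2) \<in> borel_measurable borel"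
        by (intro borel_measurable_continuous_on_indicator continuous_intros \<open>continuous_on (sphere 0 r) ?v\<close>) simp
      have T: "(\<lambda>z::(real ^ 'm) \<times> real. (r / norm z) *\<^sub>R z) \<in> borel_measurable borel" by measurable
      show ?thesis by (rule measurable_compose[OF T F])
    qed
    have "(\<lambda>z. indicator (ball 0 1 - {0}) z *\<^sub>R (indicator (sphere 0 r) ((r / norm z) *\<^sub>R z) *\<^sub>R (?v ((r / norm z) *\<^sub>R z))\<^sup>2)) \<in> borel_measurable borel"
      by (rule borel_measurable_scaleR[OF borel_measurable_indicator vm]) simp
    also have "(\<lambda>z. indicator (ball 0 1 - {0}) z *\<^sub>R (indicator (sphere 0 r) ((r / norm z) *\<^sub>R z) *\<^sub>R (?v ((r / norm z) *\<^sub>R z))\<^sup>2))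
       = (\<lambda>z. indicator (ball 0 1 - {0}) z *\<^sub>R (?v ((r / norm z) *\<^sub>R z))\<^sup>2)"
      using r by (auto simp: fun_eq_iff indicator_def)
    finally show "(\<lambda>z. indicator (ball 0 1 - {0}) z *\<^sub>R (?v ((r / norm z) *\<^sub>R z))\<^sup>2) \<in> borel_measurable lborel" by simp
  qed
  also have "\<dots> = 2 * (LINT z|lborel. ?w z)" using Bochner_Integration.integral_add[OF iw iwR] eR by simp
  finally have "(LINT z|lborel. indicator (ball 0 1 - {0}) z *\<^sub>R (?v ((r / norm z) *\<^sub>R z))\<^sup>2) = 2 * (LINT z|lborel. ?w z)" .
  then show ?thesis unfolding h half_sphere_integral_def set_lebesgue_integral_def by simp
qed

section \<open>From the class definition to pointwise data\<close>

lemma half_ball_eq: "upper_half_ball = half_ball 1"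
  by (auto simp: upper_half_ball_def half_ball_def)

lemma upper_ball_eq: "upper_half_ball \<union> thin_ball = upper_ball"
  by (auto simp: upper_half_ball_def thin_ball_def upper_ball_def)

text \<open>Every point has a compact relative neighbourhood in \<open>upper_ball\<close>: a closed
  ball whose radius is half the distance to the unit sphere, cut by the closed half space. The
  Hoelder estimate there gives continuity since the exponent is positive.\<close>

lemma C1_holder_on_upper_ball_continuous:
  fixes G :: "'b::euclidean_space \<times> real \<Rightarrow> 'b \<times> real"
  assumes \<alpha>: "0 < \<alpha>"
    and hold: "\<And>K. compact K \<Longrightarrow> K \<subseteq> upper_ball \<Longrightarrow> \<exists>C. \<forall>x\<in>K. \<forall>y\<in>K. norm (G x - G y) \<le> C * dist x y powr \<alpha>"
  shows "continuous_on upper_ball G"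
  unfolding continuous_on
proof
  fix x :: "'b \<times> real" assume x: "x \<in> upper_ball"
  define d where "d = (1 - norm x) / 2"
  have d: "0 < d" using x by (simp add: d_def upper_ball_def)
  define K where "K = cball x d \<inter> {y. 0 \<le> snd y}"
  have K: "compact K" unfolding K_def by (intro compact_Int_closed compact_cball closed_Collect_le continuous_intros)
  have "K \<subseteq> upper_ball"
  proof
    fix y assume y: "y \<in> K"
    have "norm y \<le> norm x + dist x y" using norm_triangle_ineq[of x "y - x"] by (simp add: dist_norm norm_minus_commute)
    also have "\<dots> < 1" using y d by (simp add: K_def d_def)
    finally show "y \<in> upper_ball" using y by (simp add: K_def upper_ball_def)
  qed
  then obtain C where C: "\<And>x y. x \<in> K \<Longrightarrow> y \<in> K \<Longrightarrow> norm (G x - G y) \<le> C * dist x y powr \<alpha>" using hold[OF K] by blast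
  have xK: "x \<in> K" using x d by (simp add: K_def upper_ball_def)
  have "((\<lambda>y. G y - G x) \<longlongrightarrow> 0) (at x within upper_ball)"
  proof (rule Lim_null_comparison)
    show "eventually (\<lambda>y. norm (G y - G x) \<le> C * dist y x powr \<alpha>) (at x within upper_ball)"
      unfolding eventually_at
    proof (rule exI[of _ d], intro conjI ballI impI d)
      fix y assume y: "y \<in> upper_ball" "y \<noteq> x \<and> dist y x < d"
      then have "y \<in> K" by (simp add: K_def upper_ball_def dist_commute)
      then show "norm (G y - G x) \<le> C * dist y x powr \<alpha>" using C xK by blast
    qed
    have "((\<lambda>y. dist y x) \<longlongrightarrow> dist x x) (at x within upper_ball)" by (intro tendsto_intros)
    then have "((\<lambda>y. dist y x powr \<alpha>) \<longlongrightarrow> 0) (at x within upper_ball)"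
      using \<alpha> by (intro tendsto_zero_powrI[OF _ tendsto_const]) auto
    then show "((\<lambda>y. C * dist y x powr \<alpha>) \<longlongrightarrow> 0) (at x within upper_ball)" by (rule tendsto_mult_right_zero)
  qed
  then show "(G \<longlongrightarrow> G x) (at x within upper_ball)" by (rule Lim_null[THEN iffD2])
qed

text \<open>Near a flat point the upper half space and the half ball coincide, and there
  \<open>grad u\<close> is the continuous field \<open>G\<close>. A flat point is a limit point of
  the half space, so the limit in the definition is unique.\<close>

lemma normal_deriv_eq:
  fixes u :: "(real ^ 'm) \<times> real \<Rightarrow> real"
  assumes G: "continuous_on upper_ball G" and g: "\<And>y. y \<in> half_ball 1 \<Longrightarrow> grad u y = G y"
    and x: "norm x < 1" "snd x = 0"
  shows "normal_deriv u x = snd (G x)"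
proof -
  let ?P = "{y::(real ^ 'm) \<times> real. 0 < snd y}"
  have xu: "x \<in> upper_ball" using x by (simp add: upper_ball_def)
  have nhd: "at x within ?P = at x within half_ball 1"
    by (rule at_within_nhd[of _ "ball 0 1"]) (use x in \<open>auto simp: mem_half_ball\<close>)
  have "(G \<longlongrightarrow> G x) (at x within upper_ball)" using G xu by (simp add: continuous_on)
  then have "(G \<longlongrightarrow> G x) (at x within half_ball 1)" by (rule tendsto_within_subset) (rule half_ball_subset_upper_ball)
  then have "((\<lambda>y. G y \<bullet> (0, 1)) \<longlongrightarrow> G x \<bullet> (0, 1)) (at x within half_ball 1)" by (intro tendsto_intros)
  moreover have "eventually (\<lambda>y. G y \<bullet> (0, 1) = grad u y \<bullet> (0, 1)) (at x within half_ball 1)"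
    using g by (auto simp: eventually_at intro!: exI[of _ 1])
  ultimately have lim: "((\<lambda>y. grad u y \<bullet> (0, 1)) \<longlongrightarrow> G x \<bullet> (0, 1)) (at x within ?P)"
    unfolding nhd by (rule Lim_transform_eventually)
  have "x islimpt ?P"
    unfolding islimpt_approachable
  proof (intro allI impI)
    fix e :: real assume e: "0 < e"
    have "(fst x, e / 2) \<noteq> x" "dist (fst x, e / 2) x < e" using e x by (auto simp: dist_prod_def prod_eq_iff)
    then show "\<exists>y\<in>?P. y \<noteq> x \<and> dist y x < e" using e by (intro bexI[of _ "(fst x, e / 2)"]) auto
  qed
  then have "\<not> trivial_limit (at x within ?P)" by (simp add: trivial_limit_within)
  from tendsto_Lim[OF this lim] show ?thesis by (simp add: normal_deriv_def inner_prod_def)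
qed

lemma signorini_class_solution:
  fixes u :: "(real ^ 'm) \<times> real \<Rightarrow> real"
  assumes M: "0 < M" and u: "u \<in> signorini_class k M"
  obtains G f where "signorini_solution u G f M k"
proof -
  obtain \<alpha> where \<alpha>: "0 < \<alpha>" "C1_holder_on \<alpha> u upper_ball"
    using u unfolding signorini_class_def upper_ball_eq by auto
  obtain G where GG: "\<forall>x\<in>upper_ball. (u has_derivative (\<lambda>h. G x \<bullet> h)) (at x within upper_ball)"
      "\<forall>K. compact K \<and> K \<subseteq> upper_ball \<longrightarrow> (\<exists>C. \<forall>x\<in>K. \<forall>y\<in>K. norm (G x - G y) \<le> C * dist x y powr \<alpha>)"
    using \<alpha>(2) unfolding C1_holder_on_def by (elim exE conjE)
  have G: "(u has_derivative (\<lambda>h. G x \<bullet> h)) (at x within upper_ball)" if "x \<in> upper_ball" for x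
    using GG(1) that by (rule bspec)
  have hold: "\<exists>C. \<forall>x\<in>K. \<forall>y\<in>K. norm (G x - G y) \<le> C * dist x y powr \<alpha>" if "compact K" "K \<subseteq> upper_ball" for K
    using GG(2) that by (metis (no_types))
  obtain f0 where f0[measurable]: "f0 \<in> borel_measurable borel" and wl: "weak_laplacian_on u f0 (half_ball 1)"
    and fb: "AE x\<in>half_ball 1 in lborel. \<bar>f0 x\<bar> \<le> M * norm (fst x) ^ (k - 1)"
    using u unfolding signorini_class_def half_ball_eq by auto
  \<comment> \<open>The right-hand side is set to 0 on the null set where its bound fails. The weak
    equation is unaffected, and the bound now holds at every point.\<close>
  define f where "f x = (if \<bar>f0 x\<bar> \<le> M * norm (fst x) ^ (k - 1) then f0 x else 0)" for x
  have contG: "continuous_on upper_ball G" by (rule C1_holder_on_upper_ball_continuous[OF \<alpha>(1) hold])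
  have fst_m[measurable]: "(fst :: (real ^ 'm) \<times> real \<Rightarrow> real ^ 'm) \<in> borel_measurable borel"
    by (intro borel_measurable_continuous_onI continuous_intros)
  have fm: "f \<in> borel_measurable borel" unfolding f_def[abs_def] by measurable
  have der_at: "(u has_derivative (\<lambda>h. G x \<bullet> h)) (at x)" if x: "x \<in> half_ball 1" for x
  proof -
    have "x \<in> upper_ball" using x half_ball_subset_upper_ball by blast
    from has_derivative_subset[OF G[OF this] half_ball_subset_upper_ball]
    show ?thesis by (simp add: at_within_open[OF x open_half_ball])
  qed
  have g: "grad u x = G x" if "x \<in> half_ball 1" for x by (rule grad_eqI[OF der_at[OF that]])
  have n: "C1_norm u \<le> ennreal M" using u by (simp add: signorini_class_def)
  have bu: "\<bar>u x\<bar> \<le> M" if "x \<in> half_ball 1" for x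
  proof -
    have "ennreal \<bar>u x\<bar> \<le> (SUP x\<in>upper_half_ball \<union> thin_ball. ennreal \<bar>u x\<bar>)"
      using that by (intro SUP_upper) (simp add: half_ball_eq)
    also have "\<dots> \<le> C1_norm u" unfolding C1_norm_def by (rule add_increasing2) auto
    also note n
    finally show ?thesis using M by simp
  qed
  have bG: "norm (G x) \<le> M" if "x \<in> half_ball 1" for x
  proof -
    have "ennreal (norm (grad u x)) \<le> (SUP x\<in>upper_half_ball. ennreal (norm (grad u x)))"
      using that by (intro SUP_upper) (simp add: half_ball_eq)
    also have "\<dots> \<le> C1_norm u" unfolding C1_norm_def by (rule add_increasing) auto
    also note n
    finally show ?thesis using M g[OF that] by simp
  qed
  have weak: "weak_divergence G f"
    unfolding weak_divergence_def
  proof (intro allI impI)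
    fix \<phi> :: "(real ^ 'm) \<times> real \<Rightarrow> real" assume t: "C1_test_function \<phi> (half_ball 1)"
    then have "bounded_continuous_on UNIV \<phi>" by (rule C1_test_function_facts) blast
    then have pm: "\<phi> \<in> borel_measurable borel" by (intro borel_measurable_continuous_onI bounded_continuous_onD)
    have "(LINT x:half_ball 1|lborel. G x \<bullet> grad \<phi> x) = (LINT x:half_ball 1|lborel. grad u x \<bullet> grad \<phi> x)"
      by (rule set_lebesgue_integral_cong) (auto simp: g)
    also have "\<dots> = - (LINT x:half_ball 1|lborel. f0 x * \<phi> x)" using wl t by (auto simp: weak_laplacian_on_def)
    also have "(LINT x:half_ball 1|lborel. f0 x * \<phi> x) = (LINT x:half_ball 1|lborel. f x * \<phi> x)"
      unfolding set_lebesgue_integral_def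
    proof (rule integral_cong_AE)
      show "(\<lambda>x. indicator (half_ball 1) x *\<^sub>R (f0 x * \<phi> x)) \<in> borel_measurable lborel"
        "(\<lambda>x. indicator (half_ball 1) x *\<^sub>R (f x * \<phi> x)) \<in> borel_measurable lborel"
        using pm fm by measurable
      show "AE x in lborel. indicator (half_ball 1) x *\<^sub>R (f0 x * \<phi> x) = indicator (half_ball 1) x *\<^sub>R (f x * \<phi> x)"
        using fb by eventually_elim (auto simp: f_def indicator_def)
    qed
    finally show "(LINT x:half_ball 1|lborel. G x \<bullet> grad \<phi> x) = - (LINT x:half_ball 1|lborel. f x * \<phi> x)" .
  qed
  have thin: "0 \<le> u x" "snd (G x) \<le> 0" "u x * snd (G x) = 0" if x: "norm x < 1" "snd x = 0" for x
  proof -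
    have "x \<in> thin_ball" using x by (simp add: thin_ball_def)
    then have "0 \<le> u x \<and> 0 \<le> - normal_deriv u x \<and> u x * normal_deriv u x = 0"
      using u unfolding signorini_class_def by blast
    then show "0 \<le> u x" "snd (G x) \<le> 0" "u x * snd (G x) = 0"
      by (simp_all add: normal_deriv_eq[OF contG g x])
  qed
  \<comment> \<open>A free boundary point is a limit of zeros of \<open>u\<close> in the thin ball,
    and \<open>u\<close> is continuous up to the flat part.\<close>
  have u0: "u 0 = 0"
  proof -
    let ?Z = "{x \<in> thin_ball. u x = 0}"
    have "0 \<in> (top_of_set thin_ball) closure_of ?Z"
      using u by (simp add: signorini_class_def free_boundary_def frontier_of_def)
    then have "0 \<in> closure ?Z" by (auto simp: closure_of_subtopology Collect_conj_eq[symmetric] dest: subsetD[OF closure_mono, rotated])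
    then obtain X where X: "\<And>i. X i \<in> ?Z" "X \<longlonglongrightarrow> 0" unfolding closure_sequential by blast
    have "continuous_on upper_ball u" by (rule has_derivative_continuous_on) (rule G)
    then have "(\<lambda>i. u (X i)) \<longlonglongrightarrow> u 0"
      using X by (intro continuous_on_tendsto_compose[of upper_ball u X 0]) (auto simp: upper_ball_def thin_ball_def)
    moreover have "(\<lambda>i. u (X i)) = (\<lambda>i. 0)" using X(1) by auto
    ultimately show ?thesis using LIMSEQ_unique tendsto_const by metis
  qed
  have "signorini_solution u G f M k"
    by unfold_locales (use M G contG bu bG weak fm thin u0 in \<open>auto simp: f_def\<close>)
  then show thesis by (rule that)
qed

theorem theorem2p2p1:
  fixes M :: real and k :: nat
  assumes "0 < M" and "1 \<le> k"
  shows "\<exists>r\<^sub>M C\<^sub>M. 0 < r\<^sub>M \<and> r\<^sub>M \<le> 1 \<and> 0 < C\<^sub>M \<and>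
    (\<forall>u \<in> (signorini_class k M :: ((real ^ 'm) \<times> real \<Rightarrow> real) set).
       \<exists>g. mono_on {0<..<r\<^sub>M} g \<and>
         (AE r\<in>{0<..<r\<^sub>M} in lborel.
            log_trunc_height k (even_extension u) differentiable (at r) \<and>
            Phi C\<^sub>M k (even_extension u) r = g r))"
proof -
  let ?N = "DIM(real ^ 'm)"
  let ?H = "half_ball 1 :: ((real ^ 'm) \<times> real) set"
  \<comment> \<open>All constants below are built from \<open>M\<close> and the dimension alone;
    neither \<open>u\<close> nor \<open>k\<close> enters.\<close>
  define w0 where "w0 = measure lborel ?H"
  define c1 where "c1 = half_sphere_integral (\<lambda>_::(real ^ 'm) \<times> real. 1) 1"
  define C1 where "C1 = M\<^sup>2 * w0 + 1 + 2 ^ (?N + 2)"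
  define C2 where "C2 = (real ?N + 2) * C1 + 1"
  define C3 where "C3 = 4 * C2"
  define C4 where "C4 = C2 * (C3 + 1)"
  define C5 where "C5 = C1 * (C3 + 1)"
  define C6 where "C6 = M\<^sup>2 * w0 * C5 * C3 + 1"
  define C7 where "C7 = M\<^sup>2 * w0 * C3 + 1"
  define C8 where "C8 = M\<^sup>2 * c1 * C4 * C3 + 1"
  define C where "C = 4 * ((real ?N - 1) * C6 + (2 * C7 + C8)) + 1"
  \<comment> \<open>The four entries guarantee in turn that the radii stay in the unit ball, that
    the truncation power is absorbed into the energy, that \<open>I\<close> is at least half of
    \<open>D\<close>, and that \<open>1 + C * r\<close> is at most 2.\<close>
  define R where "R = min 1 (min (1 / (4 * C2)) (min (1 / (2 * C6)) (1 / C)))"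
  have w0: "0 < w0" unfolding w0_def by (rule measure_half_ball_pos)
  have c1: "0 < c1" unfolding c1_def half_sphere_integral_const using w0 by (simp add: w0_def)
  have "1 \<le> ?N" using DIM_positive[where 'a="real ^ 'm"] unfolding One_nat_def Suc_le_eq .
  from of_nat_mono[OF this, where 'a=real] have N: "1 \<le> real ?N" unfolding of_nat_1 .
  have C1p: "0 < C1" using w0 by (simp add: C1_def add_nonneg_pos)
  have C2p: "0 < C2" using C1p by (simp add: C2_def add_nonneg_pos)
  have C3p: "0 < C3" using C2p by (simp add: C3_def)
  have C4p: "0 < C4" "0 < C5" using C1p C2p C3p by (auto simp: C4_def C5_def)
  have C6p: "0 < C6" "0 < C7" "0 < C8" using w0 c1 C3p C4p by (auto simp: C6_def C7_def C8_def intro!: add_nonneg_pos mult_nonneg_nonneg)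
  have Cp: "0 < C"
  proof -
    have "0 \<le> (real ?N - 1) * C6" using N C6p by (intro mult_nonneg_nonneg) auto
    then have "0 \<le> (real ?N - 1) * C6 + (2 * C7 + C8)" using C6p by (intro add_nonneg_nonneg) auto
    moreover have "0 < 4 * X + 1" if "0 \<le> X" for X :: real using that by linarith
    ultimately show ?thesis unfolding C_def by blast
  qed
  have R0: "0 < R" using C2p C6p Cp by (simp add: R_def)
  have R1: "R \<le> 1" by (simp add: R_def)
  have R2: "4 * C2 * R \<le> 1"
  proof -
    have "R \<le> 1 / (4 * C2)" by (simp add: R_def)
    then show ?thesis using C2p by (simp add: le_divide_eq mult.commute)
  qed
  have R3: "2 * C6 * R \<le> 1"
  proof -
    have "R \<le> 1 / (2 * C6)" by (simp add: R_def)
    then show ?thesis using C6p by (simp add: le_divide_eq mult.commute)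
  qed
  have R4: "C * R \<le> 1"
  proof -
    have "R \<le> 1 / C" by (simp add: R_def)
    then show ?thesis using Cp by (simp add: le_divide_eq mult.commute)
  qed
  show ?thesis
  proof (rule exI[of _ R], rule exI[of _ C], intro conjI ballI R0 R1 Cp)
    fix u :: "(real ^ 'm) \<times> real \<Rightarrow> real" assume "u \<in> signorini_class k M"
    then obtain G f where "signorini_solution u G f M k" by (rule signorini_class_solution[OF assms(1)])
    then interpret s: signorini_solution u G f M k .
    let ?m = "CARD('m) + 2 * k"
    have m: "?m = ?N + 2 * k" by simp
    define h' where "h' r = real ?N / r * s.h r + 2 * s.I r" for r
    have dh: "((\<lambda>r. 2 * s.h r) has_real_derivative 2 * h' r) (at r)" if "0 < r" "r < R" for r
      unfolding h'_def using that R1 by (intro DERIV_cmult s.h_has_derivative) auto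
    have ch: "continuous_on {0<..<R} (\<lambda>r. 2 * h' r)"
    proof -
      have "continuous_on {0<..<R} s.h"
        using R1 by (intro continuous_at_imp_continuous_on ballI DERIV_isCont[OF s.h_has_derivative]) auto
      moreover have "continuous_on {0<..<R} s.I" using R1 by (intro continuous_on_subset[OF s.I_continuous]) auto
      ultimately show ?thesis unfolding h'_def by (intro continuous_intros) auto
    qed
    \<comment> \<open>The height of the even extension is \<open>2 * s.h\<close>, so the comparison
      with the power is made with the doubled quantity, while the factor 2 cancels in the
      quotient.\<close>
    let ?g = "\<lambda>r. (r + C * r\<^sup>2) * (if r ^ ?m < 2 * s.h r then 2 * h' r / (2 * s.h r) else ?m / r)"
    have "mono_on {0<..<R} ?g"
    proof (rule truncated_frequency_mono[OF dh ch less_imp_le[OF Cp]])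
      fix r assume r: "0 < r" "r < R" "r ^ ?m < 2 * s.h r"
      show "\<exists>d>0. \<forall>s\<in>{r<..<r+d}. s < R \<longrightarrow> (r + C * r\<^sup>2) * (2 * h' r / (2 * s.h r)) \<le> (s + C * s\<^sup>2) * (2 * h' s / (2 * s.h s))"
        unfolding mult_divide_mult_cancel_left_if using s.frequency_locally_increasing[OF assms(2)
          C1_def[unfolded w0_def] C2_def C3_def C4_def C5_def C6_def[unfolded w0_def] C7_def[unfolded w0_def] C8_def[unfolded c1_def]
          C_def r(1,2) R1 R2 R3 R4 r(3)[unfolded m]] by (simp add: h'_def)
    qed
    moreover
    have "AE r\<in>{0<..<R} in lborel. ((\<lambda>r. ln (max (2 * s.h r) (r ^ ?m))) has_real_derivative
           (if r ^ ?m < 2 * s.h r then 2 * h' r / (2 * s.h r) else ?m / r)) (at r)"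
      by (rule AE_ln_max_power_has_derivative[OF dh])
    then have "AE r\<in>{0<..<R} in lborel. log_trunc_height k (even_extension u) differentiable (at r) \<and>
        Phi C k (even_extension u) r = ?g r"
    proof (eventually_elim, intro impI)
      fix r assume *: "r \<in> {0<..<R} \<longrightarrow> ((\<lambda>r. ln (max (2 * s.h r) (r ^ ?m))) has_real_derivative
           (if r ^ ?m < 2 * s.h r then 2 * h' r / (2 * s.h r) else ?m / r)) (at r)" and r: "r \<in> {0<..<R}"
      have eq: "ln (max (2 * s.h t) (t ^ ?m)) = log_trunc_height k (even_extension u) t" if "t \<in> {0<..<R}" for t
        using height_even_extension[OF s.cont_u s.bc_u, of t] that R1 by (simp add: log_trunc_height_def s.h_def)
      have d: "(log_trunc_height k (even_extension u) has_real_derivative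
           (if r ^ ?m < 2 * s.h r then 2 * h' r / (2 * s.h r) else ?m / r)) (at r)"
        by (rule has_field_derivative_transform_within_open[OF mp[OF * r] open_greaterThanLessThan r]) (rule eq)
      show "log_trunc_height k (even_extension u) differentiable (at r) \<and> Phi C k (even_extension u) r = ?g r"
        using d DERIV_imp_deriv[OF d] by (auto simp: real_differentiable_def Phi_def)
    qed
    ultimately show "\<exists>g. mono_on {0<..<R} g \<and> (AE r\<in>{0<..<R} in lborel.
            log_trunc_height k (even_extension u) differentiable (at r) \<and> Phi C k (even_extension u) r = g r)"
      by blast
  qed
qed

end
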